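(* Let $q=e^t$ with $\mathrm{Re}(t)>0$, let $m\in\mathbb Z_{\ge0}$, and let $V(m)$ be the irreducible representation of $U_q(sl_2)$ with highest weight $2m$. For $0<|A|<1$ put $$I_m(\lambda,\mu,A)=q^{-\lambda\mu}\int_{|T_1|=\cdots=|T_m|=1}\prod_{j=1}^m\frac{(T_jA^{-2}q^{\lambda+m}-q^{-\lambda-m})(T_jA^{-2}q^{\mu+m}-q^{-\mu-m})}{(1-T_jA^2)(1-T_jA^{-2})}\prod_{1\le i<j\le m}\frac{q^{-2}(1-T_iT_j^{-1})^2}{(1-T_iT_j^{-1}q^{-2})(1-T_iT_j^{-1}q^2)}\bigwedge_{j=1}^m\frac{dT_j}{2\pi\sqrt{-1}\,T_j}.$$ This function continues analytically to a rational function of $A$, also denoted $I_m$; put $u_m(\lambda,\mu)=I_m(\lambda,\mu,q^m)$. Then $$u_{V(m)}(\lambda,\mu)=q^{(3m-1)m}\,\frac{[2m]_q!}{m!}\,(q-q^{-1})^m\,u_m(\lambda,\mu),$$ where $u_V(\lambda,\mu)=\delta_{V^*}(-\lambda-\rho)\,\delta_V(-\mu-\rho)\,\delta_q(\lambda)\,\Psi_V(q^{-1},-\lambda,-\mu-\rho)$ (regarded as a scalar function) is the modified trace function of $V$.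
   Context: $q^a:=e^{ta}$; $[a]_q=\frac{q^a-q^{-a}}{q-q^{-1}}$, $[n]_q!=[1]_q\cdots[n]_q$. $U_q(sl_2)$ is generated by $E,F,q^h$ with $q^hEq^{-h}=q^2E$, $q^hFq^{-h}=q^{-2}F$, $EF-FE=\frac{q^h-q^{-h}}{q-q^{-1}}$, $\Delta(E)=E\otimes q^h+1\otimes E$, $\Delta(F)=F\otimes1+q^{-h}\otimes F$, $\Delta(q^h)=q^h\otimes q^h$. Weights are identified with complex numbers: $v$ has weight $\mu$ if $q^hv=q^\mu v$; then $(\mu,\mu')=\mu\mu'/2$ and $\rho=1$. $M_\mu$ is the Verma module with highest weight $\mu$ and highest weight vector $v_\mu$. Let $V=V(m)$. The space $V[0]$ is one dimensional; for $w_0\in V[0]$ nonzero and generic $\mu$, $\Phi_\mu:M_\mu\to M_\mu\otimes V$ is the unique intertwiner with $\Phi_\mu v_\mu=v_\mu\otimes w_0+$ terms of lower weight in the first factor. The scalar function $\Psi_V(q,\lambda,\mu)$ is defined by $\mathrm{Tr}|_{M_\mu}(\Phi_\mu q^{2\lambda})=\Psi_V(q,\lambda,\mu)\,w_0$, where $q^{2\lambda}$ acts on a vector of weight $\nu$ by $q^{2(\lambda,\nu)}=q^{\lambda\nu}$ (the series converges in a suitable region and is continued to $q^{\lambda\mu}$ times a rational function of $q^{2\lambda},q^{2\mu}$). $\Psi_V(q^{-1},\lambda,\mu)$ is the same function with $q$ replaced by $q^{-1}$. Further, $\delta_q(\lambda)=q^{\lambda}-q^{-\lambda}$, and $\delta_V(\mu)=\delta_{V^*}(\mu)=\prod_{n=1}^{m}(q^{\mu+1-n}-q^{-(\mu+1)+n})$.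 *)

theory Defs
  imports
    "HOL-Complex_Analysis.Complex_Analysis"
    "HOL-Computational_Algebra.Polynomial"
    "HOL-Library.Poly_Mapping"
begin

section \<open>Powers of q, q-numbers\<close>

text \<open>Everything is parametrised by \<open>t\<close> with \<open>q = exp t\<close>, so that \<open>q\<^sup>a\<close> is unambiguous for complex
  \<open>a\<close>. Replacing \<open>q\<close> by its inverse means replacing \<open>t\<close> by \<open>- t\<close>.
  The spectral variable \<open>\<lambda>\<close> is written \<open>l\<close> in formal text.\<close>

definition qpow :: "complex \<Rightarrow> complex \<Rightarrow> complex"
  where "qpow t a = exp (t * a)"

definition qnum :: "complex \<Rightarrow> complex \<Rightarrow> complex"
  where "qnum t a = (qpow t a - qpow t (- a)) / (qpow t 1 - qpow t (- 1))"

definition qfact :: "complex \<Rightarrow> nat \<Rightarrow> complex"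
  where "qfact t n = (\<Prod>k=1..n. qnum t (of_nat k))"


section \<open>Representations of the quantum group\<close>

text \<open>A vector space with a basis indexed by a set \<open>J\<close> is the space of finitely supported functions
  with support in \<open>J\<close>. A linear map is given by the images of the basis vectors;
  \<open>lin f\<close> is its linear extension.\<close>

definition vscale :: "complex \<Rightarrow> ('i \<Rightarrow>\<^sub>0 complex) \<Rightarrow> ('i \<Rightarrow>\<^sub>0 complex)"
  where "vscale c x = Poly_Mapping.map ((*) c) x"

definition bvec :: "'i \<Rightarrow> ('i \<Rightarrow>\<^sub>0 complex)"
  where "bvec i = Poly_Mapping.single i 1"

definition lin :: "('i \<Rightarrow> ('j \<Rightarrow>\<^sub>0 complex)) \<Rightarrow> ('i \<Rightarrow>\<^sub>0 complex) \<Rightarrow> ('j \<Rightarrow>\<^sub>0 complex)"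
  where "lin f x = (\<Sum>i\<in>Poly_Mapping.keys x. vscale (Poly_Mapping.lookup x i) (f i))"

definition tens :: "('i \<Rightarrow>\<^sub>0 complex) \<Rightarrow> ('j \<Rightarrow>\<^sub>0 complex) \<Rightarrow> ('i \<times> 'j \<Rightarrow>\<^sub>0 complex)"
  where "tens x y = (\<Sum>i\<in>Poly_Mapping.keys x. \<Sum>j\<in>Poly_Mapping.keys y.
           Poly_Mapping.single (i, j) (Poly_Mapping.lookup x i * Poly_Mapping.lookup y j))"

text \<open>The fields hold the images of the basis vectors under \<open>E\<close>, \<open>F\<close>, \<open>q\<^sup>h\<close> and \<open>q\<^sup>-\<^sup>h\<close>.\<close>

record 'i uq_module =
  idx :: "'i set"
  opE :: "'i \<Rightarrow> ('i \<Rightarrow>\<^sub>0 complex)"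
  opF :: "'i \<Rightarrow> ('i \<Rightarrow>\<^sub>0 complex)"
  opK :: "'i \<Rightarrow> ('i \<Rightarrow>\<^sub>0 complex)"
  opKi :: "'i \<Rightarrow> ('i \<Rightarrow>\<^sub>0 complex)"

definition space_of :: "'i uq_module \<Rightarrow> ('i \<Rightarrow>\<^sub>0 complex) set"
  where "space_of M = {x. Poly_Mapping.keys x \<subseteq> idx M}"

definition is_uq_module :: "complex \<Rightarrow> 'i uq_module \<Rightarrow> bool"
  where "is_uq_module t M \<longleftrightarrow>
    (\<forall>i\<in>idx M.
       opE M i \<in> space_of M \<and> opF M i \<in> space_of M \<and> opK M i \<in> space_of M \<and> opKi M i \<in> space_of M \<and>
       lin (opK M) (opKi M i) = bvec i \<and> lin (opKi M) (opK M i) = bvec i \<and>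
       lin (opK M) (lin (opE M) (opKi M i)) = vscale (qpow t 2) (opE M i) \<and>
       lin (opK M) (lin (opF M) (opKi M i)) = vscale (qpow t (- 2)) (opF M i) \<and>
       lin (opE M) (opF M i) - lin (opF M) (opE M i)
         = vscale (1 / (qpow t 1 - qpow t (- 1))) (opK M i - opKi M i))"

definition weight_space :: "complex \<Rightarrow> 'i uq_module \<Rightarrow> complex \<Rightarrow> ('i \<Rightarrow>\<^sub>0 complex) set"
  where "weight_space t M \<nu> = {x \<in> space_of M. lin (opK M) x = vscale (qpow t \<nu>) x}"

definition is_submodule :: "'i uq_module \<Rightarrow> ('i \<Rightarrow>\<^sub>0 complex) set \<Rightarrow> bool"
  where "is_submodule M W \<longleftrightarrow> W \<subseteq> space_of M \<and> module.subspace vscale W \<and>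
    (\<forall>x\<in>W. lin (opE M) x \<in> W \<and> lin (opF M) x \<in> W \<and> lin (opK M) x \<in> W \<and> lin (opKi M) x \<in> W)"

definition is_irreducible :: "'i uq_module \<Rightarrow> bool"
  where "is_irreducible M \<longleftrightarrow> space_of M \<noteq> {0} \<and>
    (\<forall>W. is_submodule M W \<longrightarrow> W = {0} \<or> W = space_of M)"

definition has_highest_weight :: "complex \<Rightarrow> 'i uq_module \<Rightarrow> complex \<Rightarrow> bool"
  where "has_highest_weight t M \<nu> \<longleftrightarrow>
    (\<exists>v\<in>weight_space t M \<nu>. v \<noteq> 0 \<and> lin (opE M) v = 0)"

definition irreducible_highest_weight :: "complex \<Rightarrow> 'i uq_module \<Rightarrow> complex \<Rightarrow> bool"
  where "irreducible_highest_weight t M \<nu> \<longleftrightarrow>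
    is_uq_module t M \<and> is_irreducible M \<and> has_highest_weight t M \<nu>"

text \<open>The tensor product, with the action given by the coproduct
  \<open>\<Delta>(E) = E \<otimes> q\<^sup>h + 1 \<otimes> E\<close>, \<open>\<Delta>(F) = F \<otimes> 1 + q\<^sup>-\<^sup>h \<otimes> F\<close>, \<open>\<Delta>(q\<^sup>h) = q\<^sup>h \<otimes> q\<^sup>h\<close>.\<close>

definition tensor_module :: "'i uq_module \<Rightarrow> 'j uq_module \<Rightarrow> ('i \<times> 'j) uq_module"
  where "tensor_module M N =
    \<lparr> idx = idx M \<times> idx N,
      opE = (\<lambda>(i, j). tens (opE M i) (opK N j) + tens (bvec i) (opE N j)),
      opF = (\<lambda>(i, j). tens (opF M i) (bvec j) + tens (opKi M i) (opF N j)),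
      opK = (\<lambda>(i, j). tens (opK M i) (opK N j)),
      opKi = (\<lambda>(i, j). tens (opKi M i) (opKi N j)) \<rparr>"

text \<open>The Verma module with highest weight \<open>\<mu>\<close>: basis vector number \<open>k\<close> is \<open>F\<^sup>k v\<^sub>\<mu>\<close>, of weight
  \<open>\<mu> - 2 k\<close>.\<close>

definition verma :: "complex \<Rightarrow> complex \<Rightarrow> nat uq_module"
  where "verma t \<mu> =
    \<lparr> idx = UNIV,
      opE = (\<lambda>k. vscale (qnum t (of_nat k) * qnum t (\<mu> - of_nat k + 1)) (bvec (k - 1))),
      opF = (\<lambda>k. bvec (Suc k)),
      opK = (\<lambda>k. vscale (qpow t (\<mu> - 2 * of_nat k)) (bvec k)),
      opKi = (\<lambda>k. vscale (qpow t (- (\<mu> - 2 * of_nat k))) (bvec k)) \<rparr>"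

definition is_intertwiner ::
    "'i uq_module \<Rightarrow> 'j uq_module \<Rightarrow> ('i \<Rightarrow> ('j \<Rightarrow>\<^sub>0 complex)) \<Rightarrow> bool"
  where "is_intertwiner M N \<Phi> \<longleftrightarrow>
    (\<forall>i\<in>idx M. \<Phi> i \<in> space_of N \<and>
       lin \<Phi> (opE M i) = lin (opE N) (\<Phi> i) \<and> lin \<Phi> (opF M i) = lin (opF N) (\<Phi> i) \<and>
       lin \<Phi> (opK M i) = lin (opK N) (\<Phi> i) \<and> lin \<Phi> (opKi M i) = lin (opKi N) (\<Phi> i))"


section \<open>Trace functions\<close>

text \<open>Since the first factor of \<open>M\<^sub>\<mu> \<otimes> V\<close> is spanned by \<open>v\<^sub>\<mu>\<close> and vectors of lower weight, the
  normalisation says that the part of \<open>\<Phi> v\<^sub>\<mu>\<close> with first factor \<open>v\<^sub>\<mu>\<close> is \<open>v\<^sub>\<mu> \<otimes> w\<^sub>0\<close>.\<close>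

definition Phi :: "complex \<Rightarrow> 'i uq_module \<Rightarrow> ('i \<Rightarrow>\<^sub>0 complex) \<Rightarrow> complex \<Rightarrow> nat \<Rightarrow> (nat \<times> 'i \<Rightarrow>\<^sub>0 complex)"
  where "Phi t V w0 \<mu> = (THE \<Phi>. is_intertwiner (verma t \<mu>) (tensor_module (verma t \<mu>) V) \<Phi> \<and>
           (\<forall>j. Poly_Mapping.lookup (\<Phi> 0) (0, j) = Poly_Mapping.lookup w0 j))"

text \<open>The operator \<open>q\<^sup>2\<^sup>\<lambda>\<close> on the Verma module.\<close>

definition q2lam :: "complex \<Rightarrow> complex \<Rightarrow> complex \<Rightarrow> nat \<Rightarrow> (nat \<Rightarrow>\<^sub>0 complex)"
  where "q2lam t \<mu> l k = vscale (qpow t (l * (\<mu> - 2 * of_nat k))) (bvec k)"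

text \<open>The \<open>V\<close>-valued trace over the first factor of a linear map \<open>M \<rightarrow> M \<otimes> V\<close>, summed coordinatewise.\<close>

definition has_trace :: "(nat \<Rightarrow> (nat \<times> 'i \<Rightarrow>\<^sub>0 complex)) \<Rightarrow> ('i \<Rightarrow>\<^sub>0 complex) \<Rightarrow> bool"
  where "has_trace A w \<longleftrightarrow>
    (\<forall>j. (\<lambda>k. Poly_Mapping.lookup (A k) (k, j)) sums Poly_Mapping.lookup w j)"

text \<open>Genericity of \<open>\<mu>\<close>: the Verma module is irreducible.\<close>

definition generic_weight :: "complex \<Rightarrow> complex \<Rightarrow> bool"
  where "generic_weight t \<mu> \<longleftrightarrow> (\<forall>n::nat. qpow t (2 * (\<mu> - of_nat n)) \<noteq> 1)"

definition eval2 :: "complex poly poly \<Rightarrow> complex \<Rightarrow> complex \<Rightarrow> complex"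
  where "eval2 P x y = poly (poly P [:y:]) x"

text \<open>\<open>P / Q\<close> is the rational function whose value at \<open>(q\<^sup>2\<^sup>\<lambda>, q\<^sup>2\<^sup>\<mu>)\<close>, multiplied by \<open>q\<^sup>\<lambda>\<^sup>\<mu>\<close>, is the sum of
  the trace series in its region of convergence. Such a rational function is unique if the
  zero weight space is nonzero, because the required points are Zariski dense.\<close>

definition is_trace_function ::
    "complex \<Rightarrow> 'i uq_module \<Rightarrow> complex poly poly \<Rightarrow> complex poly poly \<Rightarrow> bool"
  where "is_trace_function t V P Q \<longleftrightarrow> Q \<noteq> 0 \<and>
    (\<forall>w0\<in>weight_space t V 0. w0 \<noteq> 0 \<longrightarrow>
      (\<forall>\<mu>. generic_weight t \<mu> \<longrightarrow>
        (\<exists>r>0. \<forall>l. norm (qpow t (- 2 * l)) < r \<longrightarrow>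
           eval2 Q (qpow t (2 * l)) (qpow t (2 * \<mu>)) \<noteq> 0 \<and>
           has_trace (\<lambda>k. lin (Phi t V w0 \<mu>) (q2lam t \<mu> l k))
             (vscale (qpow t (l * \<mu>) * eval2 P (qpow t (2 * l)) (qpow t (2 * \<mu>))
                       / eval2 Q (qpow t (2 * l)) (qpow t (2 * \<mu>))) w0))))"

definition Psi_regular :: "complex \<Rightarrow> 'i uq_module \<Rightarrow> complex \<Rightarrow> complex \<Rightarrow> bool"
  where "Psi_regular t V l \<mu> \<longleftrightarrow>
    (\<exists>P Q. is_trace_function t V P Q \<and> eval2 Q (qpow t (2 * l)) (qpow t (2 * \<mu>)) \<noteq> 0)"

definition Psi :: "complex \<Rightarrow> 'i uq_module \<Rightarrow> complex \<Rightarrow> complex \<Rightarrow> complex"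
  where "Psi t V l \<mu> = (THE c. \<exists>P Q. is_trace_function t V P Q \<and>
     eval2 Q (qpow t (2 * l)) (qpow t (2 * \<mu>)) \<noteq> 0 \<and>
     c = qpow t (l * \<mu>) * eval2 P (qpow t (2 * l)) (qpow t (2 * \<mu>))
           / eval2 Q (qpow t (2 * l)) (qpow t (2 * \<mu>)))"

definition delta_q :: "complex \<Rightarrow> complex \<Rightarrow> complex"
  where "delta_q t l = qpow t l - qpow t (- l)"

definition delta_V :: "complex \<Rightarrow> nat \<Rightarrow> complex \<Rightarrow> complex"
  where "delta_V t m \<mu> =
    (\<Prod>n=1..m. qpow t (\<mu> + 1 - of_nat n) - qpow t (- (\<mu> + 1) + of_nat n))"

text \<open>The modified trace function of \<open>V(m)\<close>. The argument \<open>V\<close> gives the representation \<open>V(m)\<close> for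
  each value of the parameter: \<open>V s\<close> is a module over the algebra with \<open>q = exp s\<close>. As the trace
  function is taken at the inverse of \<open>q\<close>, the module \<open>V (- t)\<close> occurs. Here \<open>\<rho> = 1\<close>,
  and \<open>delta_V\<close> also serves for the dual of \<open>V(m)\<close>.\<close>

definition u_V :: "complex \<Rightarrow> (complex \<Rightarrow> 'i uq_module) \<Rightarrow> nat \<Rightarrow> complex \<Rightarrow> complex \<Rightarrow> complex"
  where "u_V t V m l \<mu> = delta_V t m (- l - 1) * delta_V t m (- \<mu> - 1) * delta_q t l *
           Psi (- t) (V (- t)) (- l) (- \<mu> - 1)"


section \<open>The integral\<close>

text \<open>The integral of \<open>f \<and>\<^sub>j dT\<^sub>j / (2 \<pi> i T\<^sub>j)\<close> over the torus with variables \<open>T\<^sub>1, \<dots>, T\<^sub>n\<close>, as an iterated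
  contour integral; \<open>f\<close> must not depend on \<open>T j\<close> for other \<open>j\<close>.\<close>

fun torus_integral :: "nat \<Rightarrow> ((nat \<Rightarrow> complex) \<Rightarrow> complex) \<Rightarrow> complex" where
  "torus_integral 0 f = f (\<lambda>_. 1)"
| "torus_integral (Suc n) f =
     contour_integral (circlepath 0 1)
       (\<lambda>z. torus_integral n (\<lambda>T. f (T(Suc n := z))) / (2 * of_real pi * \<i> * z))"

definition integrand ::
    "complex \<Rightarrow> nat \<Rightarrow> complex \<Rightarrow> complex \<Rightarrow> complex \<Rightarrow> (nat \<Rightarrow> complex) \<Rightarrow> complex"
  where "integrand t m l \<mu> A T =
    (\<Prod>j=1..m.
       (T j / A^2 * qpow t (l + of_nat m) - qpow t (- l - of_nat m)) *
       (T j / A^2 * qpow t (\<mu> + of_nat m) - qpow t (- \<mu> - of_nat m)) /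
       ((1 - T j * A^2) * (1 - T j / A^2))) *
    (\<Prod>j=1..m. \<Prod>i\<in>{1..<j}.
       qpow t (- 2) * (1 - T i / T j)^2 /
       ((1 - T i / T j * qpow t (- 2)) * (1 - T i / T j * qpow t 2)))"

definition I_int :: "complex \<Rightarrow> nat \<Rightarrow> complex \<Rightarrow> complex \<Rightarrow> complex \<Rightarrow> complex"
  where "I_int t m l \<mu> A = qpow t (- l * \<mu>) * torus_integral m (integrand t m l \<mu> A)"

definition is_continuation ::
    "complex \<Rightarrow> nat \<Rightarrow> complex \<Rightarrow> complex \<Rightarrow> complex poly \<Rightarrow> complex poly \<Rightarrow> bool"
  where "is_continuation t m l \<mu> N D \<longleftrightarrow> D \<noteq> 0 \<and>
    (\<forall>A. 0 < norm A \<and> norm A < 1 \<longrightarrow> poly D A \<noteq> 0 \<and> I_int t m l \<mu> A = poly N A / poly D A)"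

definition u_m :: "complex \<Rightarrow> nat \<Rightarrow> complex \<Rightarrow> complex \<Rightarrow> complex"
  where "u_m t m l \<mu> = (THE c. \<exists>N D. is_continuation t m l \<mu> N D \<and>
           poly D (qpow t (of_nat m)) \<noteq> 0 \<and>
           c = poly N (qpow t (of_nat m)) / poly D (qpow t (of_nat m)))"


section \<open>Verma modules are modules, and irreducible modules exist\<close>

lemma lookup_vscale [simp]: "Poly_Mapping.lookup (vscale c x) i = c * Poly_Mapping.lookup x i"
  by (simp add: vscale_def Poly_Mapping.map.rep_eq when_def)

lemma module_vscale: "module vscale"
  by unfold_locales (auto intro!: poly_mapping_eqI simp: algebra_simps lookup_add)

lemma lin_superset:
  assumes "finite A" "Poly_Mapping.keys x \<subseteq> A"
  shows "lin f x = (\<Sum>i\<in>A. vscale (Poly_Mapping.lookup x i) (f i))"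
  unfolding lin_def
  by (rule sum.mono_neutral_left) (use assms in \<open>auto simp: in_keys_iff intro!: poly_mapping_eqI\<close>)

lemma lin_bvec [simp]: "lin f (bvec i) = f i"
  by (simp add: lin_def bvec_def) (auto intro!: poly_mapping_eqI)

lemma lin_0 [simp]: "lin f 0 = 0"
  by (simp add: lin_def)

lemma lin_add: "lin f (x + y) = lin f x + lin f y"
proof -
  let ?A = "Poly_Mapping.keys x \<union> Poly_Mapping.keys y"
  have "lin f (x + y) = (\<Sum>i\<in>?A. vscale (Poly_Mapping.lookup (x + y) i) (f i))"
    by (rule lin_superset) (auto simp: in_keys_iff lookup_add)
  also have "\<dots> = (\<Sum>i\<in>?A. vscale (Poly_Mapping.lookup x i) (f i) + vscale (Poly_Mapping.lookup y i) (f i))"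
    by (intro sum.cong refl poly_mapping_eqI) (simp add: lookup_add algebra_simps)
  also have "\<dots> = lin f x + lin f y"
    by (simp add: sum.distrib lin_superset[of ?A])
  finally show ?thesis .
qed

lemma vscale_sum: "vscale c (sum g A) = (\<Sum>i\<in>A. vscale c (g i))"
proof -
  interpret module vscale by (rule module_vscale)
  show ?thesis by (rule scale_sum_right)
qed

lemma vscale_vscale [simp]: "vscale a (vscale b x) = vscale (a * b) x"
  by (rule poly_mapping_eqI) simp

lemma vscale_1 [simp]: "vscale 1 x = x"
  by (rule poly_mapping_eqI) simp

lemma vscale_0 [simp]: "vscale 0 x = 0" "vscale c 0 = 0"
  by (rule poly_mapping_eqI, simp)+

lemma lin_vscale [simp]: "lin f (vscale c x) = vscale c (lin f x)"
proof -
  have "lin f (vscale c x) = (\<Sum>i\<in>Poly_Mapping.keys x. vscale (Poly_Mapping.lookup (vscale c x) i) (f i))"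
    by (rule lin_superset) (auto simp: in_keys_iff)
  then show ?thesis by (simp add: lin_def vscale_sum)
qed

lemma qnum_add:
  assumes "Re t \<noteq> 0"
  shows "qnum t (a + 1) * qnum t b - qnum t a * qnum t (b + 1) = qnum t (b - a)"
proof -
  define u where "u = exp t"
  have [simp]: "u \<noteq> 0" by (simp add: u_def)
  have "u * u \<noteq> 1"
  proof
    assume "u * u = 1"
    then have "norm u * norm u = 1" by (metis norm_mult norm_one)
    then have "exp (Re t) * exp (Re t) = 1" by (simp add: u_def)
    then show False using assms by (simp flip: exp_add)
  qed
  then have n: "u - 1 / u \<noteq> 0" by (simp add: field_simps)
  define x y where "x = exp (t * a)" and "y = exp (t * b)"
  have [simp]: "x \<noteq> 0" "y \<noteq> 0" by (simp_all add: x_def y_def)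
  have e: "qpow t (a + 1) = x * u" "qpow t (- (a + 1)) = 1 / (x * u)"
     "qpow t (b + 1) = y * u" "qpow t (- (b + 1)) = 1 / (y * u)"
     "qpow t a = x" "qpow t (- a) = 1 / x" "qpow t b = y" "qpow t (- b) = 1 / y"
     "qpow t (b - a) = y / x" "qpow t (- (b - a)) = x / y" "qpow t 1 = u" "qpow t (- 1) = 1 / u"
    by (simp_all add: qpow_def x_def y_def u_def algebra_simps exp_add exp_diff exp_minus field_simps)
  have "(x * u - 1 / (x * u)) * (y - 1 / y) - (x - 1 / x) * (y * u - 1 / (y * u)) = (y / x - x / y) * (u - 1 / u)"
    by (simp add: field_simps)
  then show ?thesis
    unfolding qnum_def e using n
    by (simp add: divide_simps) (simp add: algebra_simps)
qed

lemma qpow_mult_minus [simp]: "qpow t a * qpow t (- a) = 1" "qpow t (- a) * qpow t a = 1"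
  by (simp_all add: qpow_def flip: exp_add)

lemma qnum_0 [simp]: "qnum t 0 = 0"
  by (simp add: qnum_def)


lemma qpow_add: "qpow t a * qpow t b = qpow t (a + b)"
  by (simp add: qpow_def distrib_left exp_add)

lemma qpow_mult_diff [simp]: "qpow t (a - b) * qpow t (b - a) = 1"
  by (simp add: qpow_def flip: exp_add distrib_left)

lemma vscale_bvec_in_space [simp]: "i \<in> idx M \<Longrightarrow> vscale c (bvec i) \<in> space_of M"
  by (auto simp: space_of_def bvec_def in_keys_iff lookup_single when_def split: if_splits)

lemma bvec_in_space [simp]: "i \<in> idx M \<Longrightarrow> bvec i \<in> space_of M"
  by (auto simp: space_of_def bvec_def)

lemma verma_EF:
  assumes "Re t \<noteq> 0"
  shows "qnum t (of_nat (Suc k)) * qnum t (\<mu> - of_nat (Suc k) + 1) - qnum t (of_nat k) * qnum t (\<mu> - of_nat k + 1)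
       = qnum t (\<mu> - 2 * of_nat k)"
  using qnum_add[OF assms, of "of_nat k" "\<mu> - of_nat k"] by (simp add: algebra_simps)

lemma vscale_diff_left: "vscale (a - b) x = vscale a x - vscale b x"
  by (rule poly_mapping_eqI) (simp add: lookup_minus algebra_simps)

lemma vscale_diff_right: "vscale a (x - y) = vscale a x - vscale a y"
  by (rule poly_mapping_eqI) (simp add: lookup_minus algebra_simps)

lemma KmKi: "vscale (1 / (qpow t 1 - qpow t (- 1))) (vscale (qpow t a) x - vscale (qpow t (- a)) x)
   = vscale (qnum t a) x"
  by (simp add: qnum_def flip: vscale_diff_left)

lemma verma_is_uq_module:
  assumes "Re t \<noteq> 0"
  shows "is_uq_module t (verma t \<mu>)"
  unfolding is_uq_module_def
proof (intro ballI)
  fix k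
  note [simp] = verma_def
  have 1: "lin (opK (verma t \<mu>)) (opKi (verma t \<mu>) k) = bvec k" "lin (opKi (verma t \<mu>)) (opK (verma t \<mu>) k) = bvec k"
    by simp_all
  have 2: "lin (opK (verma t \<mu>)) (lin (opE (verma t \<mu>)) (opKi (verma t \<mu>) k)) = vscale (qpow t 2) (opE (verma t \<mu>) k)"
  proof (cases k)
    case (Suc n)
    have "qpow t (- (\<mu> - 2 * of_nat k)) * qpow t (\<mu> - 2 * of_nat n) = qpow t 2"
      by (simp add: qpow_add Suc algebra_simps)
    then show ?thesis by (simp add: Suc mult_ac)
  qed simp
  have 3: "lin (opK (verma t \<mu>)) (lin (opF (verma t \<mu>)) (opKi (verma t \<mu>) k)) = vscale (qpow t (- 2)) (opF (verma t \<mu>) k)"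
    by (simp add: qpow_add algebra_simps)
  have 4: "lin (opE (verma t \<mu>)) (opF (verma t \<mu>) k) - lin (opF (verma t \<mu>)) (opE (verma t \<mu>) k)
         = vscale (1 / (qpow t 1 - qpow t (- 1))) (opK (verma t \<mu>) k - opKi (verma t \<mu>) k)"
    unfolding KmKi verma_def uq_module.simps lin_bvec lin_vscale verma_EF[OF assms, of k \<mu>, symmetric] vscale_diff_left
    by (cases k) simp_all
  show "opE (verma t \<mu>) k \<in> space_of (verma t \<mu>) \<and>
    opF (verma t \<mu>) k \<in> space_of (verma t \<mu>) \<and> opK (verma t \<mu>) k \<in> space_of (verma t \<mu>) \<and> opKi (verma t \<mu>) k \<in> space_of (verma t \<mu>) \<and>
       lin (opK (verma t \<mu>)) (opKi (verma t \<mu>) k) = bvec k \<and> lin (opKi (verma t \<mu>)) (opK (verma t \<mu>) k) = bvec k \<and>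
       lin (opK (verma t \<mu>)) (lin (opE (verma t \<mu>)) (opKi (verma t \<mu>) k)) = vscale (qpow t 2) (opE (verma t \<mu>) k) \<and>
       lin (opK (verma t \<mu>)) (lin (opF (verma t \<mu>)) (opKi (verma t \<mu>) k)) = vscale (qpow t (- 2)) (opF (verma t \<mu>) k) \<and>
       lin (opE (verma t \<mu>)) (opF (verma t \<mu>) k) - lin (opF (verma t \<mu>)) (opE (verma t \<mu>) k)
         = vscale (1 / (qpow t 1 - qpow t (- 1))) (opK (verma t \<mu>) k - opKi (verma t \<mu>) k)"
    using 1 2 3 4 by (auto simp: space_of_def)
qed

text \<open>The module with highest weight \<open>n\<close> and dimension \<open>n + 1\<close>, which shows that irreducible
  modules of highest weight \<open>n\<close> exist.\<close>

definition fd_model :: "complex \<Rightarrow> nat \<Rightarrow> nat uq_module"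
  where "fd_model t n = (verma t (of_nat n))
    \<lparr> idx := {..n}, opF := (\<lambda>k. if k < n then bvec (Suc k) else 0) \<rparr>"

lemma qnum_nonzero:
  assumes "Re t \<noteq> 0" "k > 0"
  shows "qnum t (of_nat k) \<noteq> 0"
proof -
  have *: "qpow t (of_nat j) - qpow t (- of_nat j) \<noteq> 0" if "j > 0" for j :: nat
  proof
    assume "qpow t (of_nat j) - qpow t (- of_nat j) = 0"
    then have "norm (qpow t (of_nat j)) = norm (qpow t (- of_nat j))" by simp
    then show False using assms that by (simp add: qpow_def)
  qed
  from *[of k] *[of 1] assms show ?thesis by (simp add: qnum_def)
qed

lemma fd_model_is_uq_module:
  assumes "Re t \<noteq> 0"
  shows "is_uq_module t (fd_model t n)"
  unfolding is_uq_module_def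
proof (intro ballI)
  fix k
  assume "k \<in> idx (fd_model t n)"
  then have k: "k \<le> n" by (simp add: fd_model_def)
  let ?M = "fd_model t n"
  note [simp] = verma_def fd_model_def
  have 1: "lin (opK ?M) (opKi ?M k) = bvec k" "lin (opKi ?M) (opK ?M k) = bvec k"
    by simp_all
  have 2: "lin (opK ?M) (lin (opE ?M) (opKi ?M k)) = vscale (qpow t 2) (opE ?M k)"
  proof (cases k)
    case (Suc i)
    have "qpow t (- (of_nat n - 2 * of_nat k)) * qpow t (of_nat n - 2 * of_nat i) = qpow t 2"
      by (simp add: qpow_add Suc algebra_simps)
    then show ?thesis by (simp add: Suc mult_ac)
  qed simp
  have 3: "lin (opK ?M) (lin (opF ?M) (opKi ?M k)) = vscale (qpow t (- 2)) (opF ?M k)"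
    by (simp add: qpow_add algebra_simps)
  have 4: "lin (opE ?M) (opF ?M k) - lin (opF ?M) (opE ?M k)
         = vscale (1 / (qpow t 1 - qpow t (- 1))) (opK ?M k - opKi ?M k)"
  proof (cases "k < n")
    case True
    then show ?thesis
      unfolding KmKi verma_def fd_model_def uq_module.simps lin_bvec lin_vscale
        verma_EF[OF assms, of k "of_nat n", symmetric] vscale_diff_left
      by (cases k) simp_all
  next
    case False
    with k have "k = n" by simp
    then show ?thesis
      unfolding KmKi verma_def fd_model_def uq_module.simps lin_bvec lin_vscale
        verma_EF[OF assms, of k "of_nat n", symmetric] vscale_diff_left
      by (cases k) simp_all
  qed
  have "opE ?M k \<in> space_of ?M"
    using k by (simp del: verma_def) (auto simp: fd_model_def verma_def)
  moreover have "opF ?M k \<in> space_of ?M"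
    using k by (auto simp: space_of_def bvec_def)
  ultimately show "opE ?M k \<in> space_of ?M \<and>
    opF ?M k \<in> space_of ?M \<and> opK ?M k \<in> space_of ?M \<and> opKi ?M k \<in> space_of ?M \<and>
       lin (opK ?M) (opKi ?M k) = bvec k \<and> lin (opKi ?M) (opK ?M k) = bvec k \<and>
       lin (opK ?M) (lin (opE ?M) (opKi ?M k)) = vscale (qpow t 2) (opE ?M k) \<and>
       lin (opK ?M) (lin (opF ?M) (opKi ?M k)) = vscale (qpow t (- 2)) (opF ?M k) \<and>
       lin (opE ?M) (opF ?M k) - lin (opF ?M) (opE ?M k)
         = vscale (1 / (qpow t 1 - qpow t (- 1))) (opK ?M k - opKi ?M k)"
    using 1 2 3 4 k by simp
qed

lemma poly_mapping_sum_bvec: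
  "(\<Sum>i\<in>Poly_Mapping.keys y. vscale (Poly_Mapping.lookup y i) (bvec i)) = y"
proof (rule poly_mapping_eqI)
  fix k
  have "(\<Sum>i\<in>Poly_Mapping.keys y. Poly_Mapping.lookup y i * Poly_Mapping.lookup (bvec i) k)
      = (\<Sum>i\<in>Poly_Mapping.keys y. if i = k then Poly_Mapping.lookup y i else 0)"
    by (intro sum.cong refl) (simp add: bvec_def lookup_single when_def)
  then show "Poly_Mapping.lookup (\<Sum>i\<in>Poly_Mapping.keys y. vscale (Poly_Mapping.lookup y i) (bvec i)) k
      = Poly_Mapping.lookup y k"
    by (simp add: lookup_sum in_keys_iff)
qed

lemma lookup_opE:
  "Poly_Mapping.lookup (lin (opE (fd_model t n)) x) i =
     Poly_Mapping.lookup x (Suc i) * (qnum t (of_nat (Suc i)) * qnum t (of_nat n - of_nat i))"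
proof -
  let ?A = "insert (Suc i) (Poly_Mapping.keys x)"
  have "lin (opE (fd_model t n)) x = (\<Sum>k\<in>?A. vscale (Poly_Mapping.lookup x k) (opE (fd_model t n) k))"
    by (rule lin_superset) auto
  also have "Poly_Mapping.lookup \<dots> i =
      (\<Sum>k\<in>?A. Poly_Mapping.lookup x k * Poly_Mapping.lookup (opE (fd_model t n) k) i)"
    by (simp add: lookup_sum)
  also have "\<dots> = (\<Sum>k\<in>{Suc i}. Poly_Mapping.lookup x k * Poly_Mapping.lookup (opE (fd_model t n) k) i)"
  proof (rule sum.mono_neutral_right)
    show "\<forall>k\<in>?A - {Suc i}. Poly_Mapping.lookup x k * Poly_Mapping.lookup (opE (fd_model t n) k) i = 0"
    proof
      fix k assume "k \<in> ?A - {Suc i}"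
      then show "Poly_Mapping.lookup x k * Poly_Mapping.lookup (opE (fd_model t n) k) i = 0"
        by (cases k) (auto simp: fd_model_def verma_def bvec_def lookup_single when_def)
    qed
  qed auto
  finally show ?thesis
    by (simp add: fd_model_def verma_def bvec_def lookup_single algebra_simps)
qed

lemma fd_model_irreducible:
  assumes "Re t \<noteq> 0"
  shows "is_irreducible (fd_model t n)"
  unfolding is_irreducible_def
proof (intro conjI allI impI)
  let ?M = "fd_model t n"
  interpret module vscale by (rule module_vscale)
  have "bvec 0 \<in> space_of ?M" by (simp add: fd_model_def)
  moreover have "bvec (0::nat) \<noteq> 0"
    by (metis bvec_def lookup_single_eq lookup_zero zero_neq_one)
  ultimately show "space_of ?M \<noteq> {0}" by blast
  fix W
  assume W: "is_submodule ?M W"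
  then have sub: "subspace W" and Ws: "W \<subseteq> space_of ?M"
    and E: "\<And>x. x \<in> W \<Longrightarrow> lin (opE ?M) x \<in> W" and F: "\<And>x. x \<in> W \<Longrightarrow> lin (opF ?M) x \<in> W"
    by (auto simp: is_submodule_def)
  have *: "bvec 0 \<in> W" if "x \<in> W" "Poly_Mapping.keys x \<subseteq> {..j}" "Poly_Mapping.lookup x j \<noteq> 0" for x j
    using that
  proof (induction j arbitrary: x)
    case 0
    have "vscale (1 / Poly_Mapping.lookup x 0) x = bvec 0"
    proof (rule poly_mapping_eqI)
      fix k
      show "Poly_Mapping.lookup (vscale (1 / Poly_Mapping.lookup x 0) x) k = Poly_Mapping.lookup (bvec 0) k"
        using 0 by (cases k) (auto simp: bvec_def lookup_single when_def in_keys_iff subset_iff simp del: single_one)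
    qed
    then show ?case using 0 sub subspace_scale by metis
  next
    case (Suc j)
    have "Suc j \<in> Poly_Mapping.keys x" using Suc.prems by (simp add: in_keys_iff)
    then have "Suc j \<le> n" using Suc.prems(1) Ws by (auto simp: space_of_def fd_model_def)
    then have nj: "(of_nat n :: complex) - of_nat j = of_nat (n - j)" "n - j > 0"
      by (simp_all add: of_nat_diff)
    show ?case
    proof (rule Suc.IH)
      show "lin (opE ?M) x \<in> W" using E Suc.prems by blast
      show "Poly_Mapping.lookup (lin (opE ?M) x) j \<noteq> 0"
        unfolding lookup_opE nj
        using Suc.prems(3) qnum_nonzero[OF assms, of "Suc j"] qnum_nonzero[OF assms nj(2)]
        by (metis mult_eq_0_iff zero_less_Suc)
      show "Poly_Mapping.keys (lin (opE ?M) x) \<subseteq> {..j}"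
      proof
        fix i assume "i \<in> Poly_Mapping.keys (lin (opE ?M) x)"
        then have "Suc i \<in> Poly_Mapping.keys x" by (auto simp: in_keys_iff lookup_opE)
        then show "i \<in> {..j}" using Suc.prems by auto
      qed
    qed
  qed
  show "W = {0} \<or> W = space_of ?M"
  proof (rule disjCI)
    assume "W \<noteq> space_of ?M"
    show "W = {0}"
    proof (rule ccontr)
      assume "W \<noteq> {0}"
      then obtain x where x: "x \<in> W" "x \<noteq> 0" using sub subspace_0 by blast
      let ?K = "Poly_Mapping.keys x"
      have "Max ?K \<in> ?K" using x by simp
      then have b0: "bvec 0 \<in> W" using *[OF x(1), of "Max ?K"] Max_ge[of ?K] by (simp add: in_keys_iff subset_iff)
      have bk: "k \<le> n \<Longrightarrow> bvec k \<in> W" for k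
      proof (induction k)
        case (Suc k)
        then have "lin (opF ?M) (bvec k) \<in> W" by (intro F) simp
        then show ?case using Suc by (simp add: fd_model_def)
      qed (use b0 in simp)
      have "space_of ?M \<subseteq> W"
      proof
        fix y assume y: "y \<in> space_of ?M"
        have "(\<Sum>i\<in>Poly_Mapping.keys y. vscale (Poly_Mapping.lookup y i) (bvec i)) \<in> W"
          using y by (intro subspace_sum[OF sub] subspace_scale[OF sub] bk) (auto simp: space_of_def fd_model_def)
        moreover have "(\<Sum>i\<in>Poly_Mapping.keys y. vscale (Poly_Mapping.lookup y i) (bvec i)) = y"
          by (rule poly_mapping_sum_bvec)
        ultimately show "y \<in> W" by simp
      qed
      then show False using Ws \<open>W \<noteq> space_of ?M\<close> by blast
    qed
  qed
qed

lemma fd_model_irreducible_highest_weight: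
  assumes "Re t \<noteq> 0"
  shows "irreducible_highest_weight t (fd_model t n) (of_nat n)"
proof -
  have "bvec (0::nat) \<noteq> 0"
    by (metis bvec_def lookup_single_eq lookup_zero zero_neq_one)
  moreover have "bvec 0 \<in> {x \<in> space_of (fd_model t n). lin (opK (fd_model t n)) x = vscale (qpow t (of_nat n)) x}"
    by (simp add: fd_model_def verma_def)
  moreover have "lin (opE (fd_model t n)) (bvec 0) = 0"
    by (simp add: fd_model_def verma_def)
  ultimately show ?thesis
    unfolding irreducible_highest_weight_def has_highest_weight_def weight_space_def
    using fd_model_is_uq_module[OF assms] fd_model_irreducible[OF assms] by blast
qed
end

theory Submission
  imports Defs
begin

section \<open>Trace functions of quantum sl(2) as contour integrals\<close>

text \<open>Integral side. With \<open>p = q\<^sup>-\<^sup>2\<close> the pair factors of the integrand form, up to a power of \<open>p\<close>, the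
  Hall-Littlewood weight \<open>\<Prod>\<^sub>i\<^sub>\<noteq>\<^sub>j (1 - T\<^sub>i / T\<^sub>j) / (1 - p T\<^sub>i / T\<^sub>j)\<close>. An identity of Lagrange interpolation type
  shows that under the symmetric integral one may drop the factors with \<open>T\<^sub>n\<close> in the denominator of
  the argument, at the price of the constant \<open>n (1 - p) / (1 - p\<^sup>n)\<close>. Then \<open>T\<^sub>n\<close> has only two poles in the
  disc, at \<open>0\<close> and at \<open>p\<^sup>k B\<close> with \<open>B = A\<^sup>2\<close>, and the second residue turns the remaining one-variable
  weights into those with the pole at \<open>p\<^sup>k\<^sup>+\<^sup>1 B\<close>. The resulting two-term recursion is solved by a sum
  with Gaussian binomial coefficients.

  Trace side. \<open>\<Phi> v\<^sub>\<mu>\<close> is a combination of the vectors \<open>F\<^sup>k v\<^sub>\<mu> \<otimes> E\<^sup>k w\<^sub>0\<close> with coefficients forced by \<open>E \<Phi> v\<^sub>\<mu> = 0\<close>.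
  The Casimir element, a scalar on an irreducible highest weight module, gives \<open>F\<^sup>k E\<^sup>k w\<^sub>0\<close> as a multiple
  of \<open>w\<^sub>0\<close>, the Gaussian binomial theorem gives the powers of the coproduct of \<open>F\<close>, and the generating
  function of the Gaussian binomials sums the trace series. The zeros of the delta factors are exactly
  the poles of the trace function, and both sides become the same sum of \<open>m + 1\<close> terms.\<close>

subsection \<open>Averages over the torus\<close>

text \<open>A pair factor with \<open>T n\<close> in the denominator of its argument has its pole at
  \<open>T n\<close> = p \<open>T j\<close>, inside the disc and dependent on the other variables;
  with \<open>T n\<close> in the numerator the pole \<open>T j\<close> / p lies outside. This is why
  factors of the first kind have to be removed before integrating. At p^k B the quotient z / A^2 in
  the numerator equals p^k, so after the residues A survives only in factors 1 - p^i A^4. Hence the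
  continuation to A = q^m, a point outside the unit disc for m > 0, is mere substitution, and the
  denominators become 1 - q^(4m-2i). Up to powers of q and signs their product is a quotient of
  q-factorials with numerator [2m]_q!, which the constant of the theorem cancels. On the trace side
  the inversion of q gives convergence: for s = -t the base exp (2 s) of the Gaussian binomials has
  norm below 1. The two sums correspond under r = m - j, where r counts the residues at nonzero
  poles and j the power of E in the image of the highest weight vector.\<close>

definition torus :: "(nat \<Rightarrow> complex) set"
  where "torus = {T. \<forall>j. norm (T j) = 1}"

text \<open>The result is again a function on the whole torus, constant in coordinate
  \<open>i\<close>, so that averages over different coordinates compose as operators and can be
  commuted.\<close>

definition avg :: "nat \<Rightarrow> ((nat \<Rightarrow> complex) \<Rightarrow> complex) \<Rightarrow> (nat \<Rightarrow> complex) \<Rightarrow> complex"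
  where "avg i f S = integral {0..1} (\<lambda>x::real. f (S(i := cis (2 * pi * x))))"

fun avgs :: "nat \<Rightarrow> ((nat \<Rightarrow> complex) \<Rightarrow> complex) \<Rightarrow> (nat \<Rightarrow> complex) \<Rightarrow> complex" where
  "avgs 0 f = f"
| "avgs (Suc n) f = avg (Suc n) (avgs n f)"

text \<open>The derivative 2 pi i z of the parametrisation cancels the denominator, so both sides
  are the same real integral.\<close>

lemma contour_integral_unit_circle:
  "contour_integral (circlepath 0 1) (\<lambda>z. g z / (2 * of_real pi * \<i> * z))
     = integral {0..1} (\<lambda>x. g (cis (2 * pi * x)))"
  unfolding contour_integral_integral
proof (rule integral_cong)
  fix x :: real
  have "vector_derivative (circlepath 0 1) (at x) = 2 * of_real pi * \<i> * exp (2 * of_real pi * \<i> * of_real x)"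
    by (simp add: vector_derivative_circlepath)
  moreover have "circlepath 0 1 x = exp (2 * of_real pi * \<i> * of_real x)"
    by (simp add: circlepath)
  moreover have "exp (2 * of_real pi * \<i> * of_real x) = cis (2 * pi * x)"
    by (simp add: cis_conv_exp mult_ac)
  ultimately show "g (circlepath 0 1 x) / (2 * of_real pi * \<i> * circlepath 0 1 x) *
      vector_derivative (circlepath 0 1) (at x) = g (cis (2 * pi * x))"
    by (simp add: field_simps)
qed

text \<open>\<open>torus_integral\<close> substitutes into the integrand, \<open>avgs\<close> into
  the point. The two agree because coordinate \<open>k\<close> is not among those averaged.\<close>

lemma avgs_fun_upd:
  "n < k \<Longrightarrow> avgs n (\<lambda>T. f (T(k := z))) S = avgs n f (S(k := z))"
proof (induction n arbitrary: S)
  case (Suc n)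
  have "S(Suc n := w, k := z) = S(k := z, Suc n := w)" for w
    using Suc.prems by (intro fun_upd_twist) auto
  moreover have "avgs n (\<lambda>T. f (T(k := z))) T = avgs n f (T(k := z))" for T
    using Suc.prems by (intro Suc.IH) auto
  ultimately show ?case unfolding avgs.simps avg_def by (intro integral_cong) metis
qed simp

lemma torus_integral_eq_avgs: "torus_integral n f = avgs n f (\<lambda>_. 1)"
proof (induction n arbitrary: f)
  case (Suc n)
  have "torus_integral (Suc n) f
      = integral {0..1} (\<lambda>x. torus_integral n (\<lambda>T. f (T(Suc n := cis (2 * pi * x)))))"
    by (simp add: contour_integral_unit_circle)
  then show ?case by (simp add: Suc avgs_fun_upd avg_def)
qed simp

section \<open>Averages as linear operators on continuous functions on the torus\<close>

lemma torus_fun_upd [simp]: "S \<in> torus \<Longrightarrow> norm z = 1 \<Longrightarrow> S(i := z) \<in> torus"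
  by (simp add: torus_def)

lemma avg_cong:
  assumes "\<And>T. T \<in> torus \<Longrightarrow> f T = g T" "S \<in> torus"
  shows "avg i f S = avg i g S"
  unfolding avg_def by (rule integral_cong) (use assms in simp)

lemma avgs_cong:
  assumes "\<And>T. T \<in> torus \<Longrightarrow> f T = g T" "S \<in> torus"
  shows "avgs n f S = avgs n g S"
  using assms(2)
proof (induction n arbitrary: S)
  case (Suc n)
  show ?case unfolding avgs.simps by (rule avg_cong) (use Suc in auto)
qed (use assms in simp)

lemma continuous_on_fun_upd_cis:
  assumes "continuous_on X g" "continuous_on X h"
  shows "continuous_on X (\<lambda>y. (g y)(i := cis (2 * pi * h y)))"
proof (rule continuous_on_coordinatewise_then_product)
  fix j
  have "continuous_on X (\<lambda>y. g y j)"
    by (rule continuous_on_product_then_coordinatewise[OF assms(1)])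
  moreover have "continuous_on X (\<lambda>y. cis (2 * pi * h y))"
    by (intro continuous_intros assms)
  ultimately show "continuous_on X (\<lambda>y. ((g y)(i := cis (2 * pi * h y))) j)"
    by (cases "j = i") auto
qed

lemma continuous_on_avg:
  assumes "continuous_on torus f"
  shows "continuous_on torus (avg i f)"
proof -
  have "continuous_on (torus \<times> cbox (0::real) 1) (\<lambda>(S, x). f (S(i := cis (2 * pi * x))))"
    unfolding split_def
    by (rule continuous_on_compose2[OF assms], intro continuous_on_fun_upd_cis continuous_on_fst continuous_on_snd continuous_on_id continuous_on_const) auto
  from integral_continuous_on_param[OF this] show ?thesis
    by (simp add: avg_def[abs_def])
qed

lemma continuous_on_avgs: "continuous_on torus f \<Longrightarrow> continuous_on torus (avgs n f)"
  by (induction n) (auto intro: continuous_on_avg)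

lemma continuous_on_slice:
  assumes "continuous_on torus f" "S \<in> torus"
  shows "continuous_on X (\<lambda>x. f (S(i := cis (2 * pi * x))))"
  by (rule continuous_on_compose2[OF assms(1)], intro continuous_on_fun_upd_cis continuous_on_fst continuous_on_snd continuous_on_id continuous_on_const)
    (use assms in auto)

text \<open>Fubini on the unit square. This exchange is the main reason why continuity on the torus
  is carried through the later lemmas.\<close>

lemma avg_commute:
  assumes f: "continuous_on torus f" and S: "S \<in> torus"
  shows "avg i (avg j f) S = avg j (avg i f) S"
proof (cases "i = j")
  case False
  have "continuous_on (cbox (0::real, 0::real) (1, 1)) (\<lambda>(x, y). f (S(i := cis (2 * pi * x), j := cis (2 * pi * y))))"
    unfolding split_def
    by (rule continuous_on_compose2[OF f], intro continuous_on_fun_upd_cis continuous_on_fst continuous_on_snd continuous_on_id continuous_on_const)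
      (use S in auto)
  from integral_swap_continuous[OF this] show ?thesis
    using False by (simp add: avg_def fun_upd_twist)
qed simp

lemma avg_sum:
  assumes "\<And>k. k \<in> K \<Longrightarrow> continuous_on torus (f k)" "S \<in> torus" "finite K"
  shows "avg i (\<lambda>T. \<Sum>k\<in>K. f k T) S = (\<Sum>k\<in>K. avg i (f k) S)"
  unfolding avg_def using assms
  by (intro integral_sum integrable_continuous_interval continuous_on_slice) auto

lemma avg_cmult: "avg i (\<lambda>T. c * f T) S = c * avg i f S"
  unfolding avg_def by simp

lemma avgs_sum:
  assumes "\<And>k. k \<in> K \<Longrightarrow> continuous_on torus (f k)" "S \<in> torus" "finite K"
  shows "avgs n (\<lambda>T. \<Sum>k\<in>K. f k T) S = (\<Sum>k\<in>K. avgs n (f k) S)"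
  using assms(2)
proof (induction n arbitrary: S)
  case (Suc n)
  have "avgs (Suc n) (\<lambda>T. \<Sum>k\<in>K. f k T) S = avg (Suc n) (\<lambda>T. \<Sum>k\<in>K. avgs n (f k) T) S"
    unfolding avgs.simps by (rule avg_cong) (use Suc in auto)
  then show ?case
    using avg_sum[of K "\<lambda>k. avgs n (f k)" S "Suc n"] assms continuous_on_avgs Suc.prems by simp
qed simp

lemma avgs_cmult: "avgs n (\<lambda>T. c * f T) S = c * avgs n f S"
proof (induction n arbitrary: S)
  case (Suc n)
  then have "avgs n (\<lambda>T. c * f T) = (\<lambda>T. c * avgs n f T)" by (intro ext)
  then show ?case by (simp add: avg_cmult)
qed simp

lemma avg_avgs_commute:
  assumes "continuous_on torus f" "S \<in> torus"
  shows "avg i (avgs n f) S = avgs n (avg i f) S"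
  using assms(2)
proof (induction n arbitrary: S)
  case (Suc n)
  have "avg i (avgs (Suc n) f) S = avg (Suc n) (avg i (avgs n f)) S"
    using avg_commute[OF continuous_on_avgs[OF assms(1)] Suc.prems] by simp
  also have "\<dots> = avgs (Suc n) (avg i f) S"
    unfolding avgs.simps by (rule avg_cong) (use Suc in auto)
  finally show ?case .
qed simp

text \<open>The average over \<open>i\<close> can be moved innermost by Fubini, so equality after
  this single average already decides the iterated one.\<close>

lemma avgs_eqI:
  assumes "continuous_on torus f" "continuous_on torus g" "1 \<le> i" "i \<le> n"
    and "\<And>T. T \<in> torus \<Longrightarrow> avg i f T = avg i g T" "S \<in> torus"
  shows "avgs n f S = avgs n g S"
  using assms(4,6)
proof (induction n arbitrary: S)
  case (Suc n)
  show ?case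
  proof (cases "i = Suc n")
    case True
    with avg_avgs_commute[OF assms(1) Suc.prems(2)] avg_avgs_commute[OF assms(2) Suc.prems(2)]
      avgs_cong[OF assms(5) Suc.prems(2)]
    show ?thesis by simp
  next
    case False
    show ?thesis unfolding avgs.simps by (rule avg_cong) (use Suc False in auto)
  qed
qed (use assms in simp)

text \<open>The relabelling by which all summands of the symmetrized integrand get the same
  integral. The variables \<open>i\<close> and \<open>n\<close> are averaged as a pair, so
  exchanging them only exchanges two averages.\<close>

lemma avgs_transpose:
  assumes f: "continuous_on torus f" and i: "1 \<le> i" "i \<le> n" and S: "S \<in> torus"
  shows "avgs n (\<lambda>T. f (T \<circ> Transposition.transpose i n)) S = avgs n f S"
proof (cases "i = n")
  case False
  then obtain n' where n: "n = Suc n'" using i by (cases n) auto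
  have tr: "T \<circ> Transposition.transpose i n \<in> torus" if "T \<in> torus" for T using that by (auto simp: torus_def)
  have c: "continuous_on torus (\<lambda>T. f (T \<circ> Transposition.transpose i n))"
  proof (rule continuous_on_compose2[OF f])
    show "continuous_on torus (\<lambda>T::nat \<Rightarrow> complex. T \<circ> Transposition.transpose i n)"
      unfolding comp_def
      by (rule continuous_on_coordinatewise_then_product)
        (rule continuous_on_product_then_coordinatewise[OF continuous_on_id])
  qed (use tr in auto)
  have "avg i (avg n (\<lambda>T. f (T \<circ> Transposition.transpose i n))) T = avg i (avg n f) T" if "T \<in> torus" for T
  proof -
    have "(T(i := x, n := y)) \<circ> Transposition.transpose i n = T(n := x, i := y)" for x y
      using False by (auto simp: Transposition.transpose_def fun_eq_iff)
    then have "avg i (avg n (\<lambda>T. f (T \<circ> Transposition.transpose i n))) T = avg n (avg i f) T"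
      using False by (simp add: avg_def)
    then show ?thesis using avg_commute[OF f that] by simp
  qed
  then have "avgs n' (avg n (\<lambda>T. f (T \<circ> Transposition.transpose i n))) S = avgs n' (avg n f) S"
    by (intro avgs_eqI[where i = i] continuous_on_avg c f S) (use i False n in auto)
  then show ?thesis
    using avg_avgs_commute[OF c S, of n n'] avg_avgs_commute[OF f S, of n n'] by (simp add: n)
qed (simp add: comp_def)


subsection \<open>The Hall-Littlewood weight\<close>

lemma degree_prod_linear: "finite I \<Longrightarrow> degree (\<Prod>j\<in>I. [:- y j, 1:]) = card (I :: 'b set)" for y :: "'b \<Rightarrow> complex"
  by (subst degree_prod_sum_eq) auto

lemma sum_prod_ratio:
  fixes x :: "'a \<Rightarrow> complex"
  assumes fin: "finite I" and inj: "inj_on x I" and nz: "\<And>i. i \<in> I \<Longrightarrow> x i \<noteq> 0"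
  shows "(1 - p) * (\<Sum>i\<in>I. \<Prod>j\<in>I - {i}. (x i - p * x j) / (x i - x j)) = 1 - p ^ card I"
proof -
  \<comment> \<open>Interpolate the difference of \<open>F p\<close> and \<open>F 1\<close> at the points \<open>x i\<close> and evaluate at 0.\<close>
  define F where "F = (\<lambda>c. \<Prod>j\<in>I. [:- (c * x j), 1:])"
  define L where "L = (\<lambda>i. \<Prod>j\<in>I - {i}. [:- x j, 1:])"
  define H where "H = (\<Sum>i\<in>I. smult ((1 - p) * x i * (\<Prod>j\<in>I - {i}. (x i - p * x j) / (x i - x j))) (L i))"
  let ?n = "card I"
  have degF: "degree (F c) = ?n" for c unfolding F_def using fin by (rule degree_prod_linear)
  have "lead_coeff (F c) = 1" for c unfolding F_def by (simp add: lead_coeff_prod)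
  with degF have cF: "poly.coeff (F c) ?n = 1" for c by metis
  have cL: "degree (L i) < ?n" if "i \<in> I" for i
  proof -
    have "degree (L i) = card (I - {i})" unfolding L_def by (rule degree_prod_linear) (use fin in simp)
    then show ?thesis using card_Diff1_less[OF fin that] by simp
  qed
  then have cH: "poly.coeff H ?n = 0" unfolding H_def
    by (simp add: coeff_sum coeff_eq_0)
  have dH: "degree H \<le> ?n" unfolding H_def
    by (intro degree_sum_le fin order_trans[OF degree_smult_le]) (use cL in \<open>auto intro: less_imp_le\<close>)
  have "F p = F 1 + H"
  \<comment> \<open>Both sides have degree at most \<open>?n\<close> and coefficient 1 there, so
    agreement at the \<open>?n\<close> distinct points decides.\<close>
  proof (rule poly_eqI_degree_lead_coeff)
    show "poly.coeff (F p) ?n = poly.coeff (F 1 + H) ?n" by (simp add: cF cH)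
    show "card (x ` I) \<ge> ?n" using inj by (simp add: card_image)
    show "degree (F p) \<le> ?n" by (simp add: degF)
    show "degree (F 1 + H) \<le> ?n" by (intro degree_add_le) (auto simp: degF dH)
    fix z assume "z \<in> x ` I"
    then obtain i where i: "i \<in> I" and z: "z = x i" by blast
    have "poly (L k) (x i) = 0" if "k \<in> I - {i}" for k
      unfolding L_def poly_prod using that i fin by (intro prod_zero) auto
    then have "poly H (x i) = (1 - p) * x i * (\<Prod>j\<in>I - {i}. (x i - p * x j) / (x i - x j)) * poly (L i) (x i)"
      unfolding H_def poly_sum by (subst sum.remove[OF fin i]) simp
    also have "poly (L i) (x i) = (\<Prod>j\<in>I - {i}. x i - x j)" by (simp add: L_def poly_prod)
    also have "(1 - p) * x i * (\<Prod>j\<in>I - {i}. (x i - p * x j) / (x i - x j)) * (\<Prod>j\<in>I - {i}. x i - x j)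
        = (1 - p) * x i * (\<Prod>j\<in>I - {i}. x i - p * x j)"
    proof -
      have "x i - x j \<noteq> 0" if "j \<in> I - {i}" for j using that i inj by (auto simp: inj_on_def)
      then have "(\<Prod>j\<in>I - {i}. (x i - p * x j) / (x i - x j) * (x i - x j)) = (\<Prod>j\<in>I - {i}. x i - p * x j)"
        by (intro prod.cong) auto
      then show ?thesis unfolding prod.distrib by (simp only: mult.assoc)
    qed
    finally have 1: "poly H (x i) = (1 - p) * x i * (\<Prod>j\<in>I - {i}. x i - p * x j)" .
    have "poly (F 1) (x i) = 0" unfolding F_def poly_prod by (rule prod_zero[OF fin]) (use i in auto)
    moreover have "poly (F p) (x i) = (1 - p) * x i * (\<Prod>j\<in>I - {i}. x i - p * x j)"
      unfolding F_def poly_prod by (subst prod.remove[OF fin i]) (simp add: algebra_simps)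
    ultimately show "poly (F p) z = poly (F 1 + H) z" by (simp add: 1 z)
  qed
  then have e: "poly (F p) 0 = poly (F 1) 0 + poly H 0" by simp
  define X where "X = (\<Prod>j\<in>I. - x j)"
  have X: "X \<noteq> 0" unfolding X_def using fin nz by (simp add: prod_zero_iff)
  have "poly (F c) 0 = c ^ ?n * X" for c
  proof -
    have "poly (F c) 0 = (\<Prod>j\<in>I. c * - x j)" by (simp add: F_def poly_prod)
    then show ?thesis unfolding prod.distrib X_def by (simp only: prod_constant)
  qed
  moreover have "poly H 0 = (\<Sum>i\<in>I. (1 - p) * - (\<Prod>j\<in>I - {i}. (x i - p * x j) / (x i - x j)) * X)"
    unfolding H_def poly_sum
  proof (intro sum.cong refl)
    fix i assume i: "i \<in> I"
    have "X = - x i * poly (L i) 0" unfolding X_def L_def poly_prod using prod.remove[OF fin i, of "\<lambda>j. - x j"] by simp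
    moreover have "poly (smult ((1 - p) * x i * S) (L i)) 0 = (1 - p) * - S * (- x i * poly (L i) 0)" for S
      by simp
    ultimately show "poly (smult ((1 - p) * x i * (\<Prod>j\<in>I - {i}. (x i - p * x j) / (x i - x j))) (L i)) 0
        = (1 - p) * - (\<Prod>j\<in>I - {i}. (x i - p * x j) / (x i - x j)) * X" by presburger
  qed
  then have "poly H 0 = - ((1 - p) * (\<Sum>i\<in>I. \<Prod>j\<in>I - {i}. (x i - p * x j) / (x i - x j)) * X)"
    by (simp add: sum_distrib_left sum_distrib_right sum_negf)
  ultimately have "(p ^ ?n) * X = (1 - (1 - p) * (\<Sum>i\<in>I. \<Prod>j\<in>I - {i}. (x i - p * x j) / (x i - x j))) * X"
    using e by (simp add: algebra_simps)
  with X show ?thesis by simp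
qed

definition hl_factor :: "complex \<Rightarrow> complex \<Rightarrow> complex"
  where "hl_factor p x = (1 - x) / (1 - p * x)"

text \<open>The product runs over ordered pairs and is therefore symmetric in the variables, whereas
  the integrand has one factor for each pair i < j.\<close>

definition hl_weight :: "complex \<Rightarrow> 'a set \<Rightarrow> ('a \<Rightarrow> complex) \<Rightarrow> complex"
  where "hl_weight p I T = (\<Prod>i\<in>I. \<Prod>j\<in>I - {i}. hl_factor p (T i / T j))"

lemma hl_weight_remove:
  assumes "finite I" "i \<in> I"
  shows "hl_weight p I T = hl_weight p (I - {i}) T * (\<Prod>j\<in>I - {i}. hl_factor p (T i / T j)) *
    (\<Prod>j\<in>I - {i}. hl_factor p (T j / T i))"
proof -
  have "(\<Prod>k\<in>I - {i}. \<Prod>j\<in>I - {k}. hl_factor p (T k / T j)) =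
     (\<Prod>k\<in>I - {i}. hl_factor p (T k / T i) * (\<Prod>j\<in>I - {i} - {k}. hl_factor p (T k / T j)))"
  proof (intro prod.cong refl)
    fix k assume k: "k \<in> I - {i}"
    have "I - {k} - {i} = I - {i} - {k}" by blast
    then show "(\<Prod>j\<in>I - {k}. hl_factor p (T k / T j)) =
       hl_factor p (T k / T i) * (\<Prod>j\<in>I - {i} - {k}. hl_factor p (T k / T j))"
      using assms k by (subst prod.remove[of _ i]) auto
  qed
  then show ?thesis
    unfolding hl_weight_def by (subst prod.remove[OF assms]) (simp add: prod.distrib mult_ac)
qed

lemma hl_weight_reindex:
  assumes "inj s"
  shows "hl_weight p I (T \<circ> s) = hl_weight p (s ` I) T"
proof -
  have "s ` I - {s i} = s ` (I - {i})" for i using assms by (auto simp: inj_def)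
  then show ?thesis
    using assms by (simp add: hl_weight_def prod.reindex[OF inj_on_subset[OF assms subset_UNIV]])
qed

text \<open>Serves for two kinds of denominators: those of the pair factors, and, with
  \<open>B\<close> in place of \<open>p\<close>, the factors 1 - B z.\<close>

lemma hl_factor_denominator: "norm p < 1 \<Longrightarrow> norm x \<le> 1 \<Longrightarrow> 1 - p * x \<noteq> 0" for p x :: complex
proof
  assume "norm p < 1" "norm x \<le> 1" "1 - p * x = 0"
  then have "norm (p * x) = 1" by simp
  moreover have "norm (p * x) \<le> norm p * 1" unfolding norm_mult by (rule mult_left_mono) (use \<open>norm x \<le> 1\<close> in auto)
  ultimately show False using \<open>norm p < 1\<close> by simp
qed

text \<open>For coinciding \<open>T i\<close>, where the interpolation identity fails, both sides vanish.\<close>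

lemma hl_weight_symmetrization:
  assumes p: "norm p < 1" and fin: "finite I" and T: "\<And>i. i \<in> I \<Longrightarrow> norm (T i) = 1"
  shows "(1 - p ^ card I) * hl_weight p I T
    = (1 - p) * (\<Sum>i\<in>I. hl_weight p (I - {i}) T * (\<Prod>j\<in>I - {i}. hl_factor p (T i / T j)))"
proof (cases "inj_on T I")
  case True
  have nz: "T i \<noteq> 0" if "i \<in> I" for i using T[OF that] by auto
  have "(\<Prod>j\<in>I - {i}. (T i - p * T j) / (T i - T j)) * hl_weight p I T
      = hl_weight p (I - {i}) T * (\<Prod>j\<in>I - {i}. hl_factor p (T i / T j))" if i: "i \<in> I" for i
  proof -
    \<comment> \<open>The Lagrange ratio is the inverse of the factor with \<open>T i\<close> in the
      denominator, so multiplying the weight by it deletes exactly that factor.\<close>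
    have "(T i - p * T j) / (T i - T j) * hl_factor p (T j / T i) = 1" if j: "j \<in> I - {i}" for j
    proof -
      have "1 - p * (T j / T i) \<noteq> 0"
        by (rule hl_factor_denominator[OF p]) (use T i j in \<open>simp add: norm_divide\<close>)
      then have "T i - p * T j \<noteq> 0" using nz[OF i] by (simp add: field_simps)
      moreover have "T i - T j \<noteq> 0" using True i j by (auto simp: inj_on_def)
      ultimately show ?thesis using nz[OF i] unfolding hl_factor_def by (simp add: divide_simps)
    qed
    then have "(\<Prod>j\<in>I - {i}. (T i - p * T j) / (T i - T j)) * (\<Prod>j\<in>I - {i}. hl_factor p (T j / T i)) = 1"
      by (simp flip: prod.distrib)
    then show ?thesis unfolding hl_weight_remove[OF fin i] by (simp add: mult_ac)
  qed
  then have "(\<Sum>i\<in>I. hl_weight p (I - {i}) T * (\<Prod>j\<in>I - {i}. hl_factor p (T i / T j)))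
      = (\<Sum>i\<in>I. \<Prod>j\<in>I - {i}. (T i - p * T j) / (T i - T j)) * hl_weight p I T"
    by (simp add: sum_distrib_right)
  with sum_prod_ratio[OF fin True nz, of p] show ?thesis by (simp only: mult.assoc[symmetric])
next
  case False
  then obtain a b where ab: "a \<in> I" "b \<in> I" "a \<noteq> b" "T a = T b" by (auto simp: inj_on_def)
  then have hab: "hl_factor p (T a / T b) = 0" and hba: "hl_factor p (T b / T a) = 0"
    using T[OF ab(1)] T[OF ab(2)] by (auto simp: hl_factor_def)
  then have z: "hl_weight p J T = 0" if "a \<in> J" "b \<in> J" "finite J" for J
    unfolding hl_weight_def using that ab by (intro prod_zero bexI[of _ a] bexI[of _ b]) auto
  \<comment> \<open>If \<open>i\<close> is \<open>a\<close> or \<open>b\<close>, the vanishing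
    factor sits in the second product, otherwise in the first.\<close>
  have "hl_weight p (I - {i}) T * (\<Prod>j\<in>I - {i}. hl_factor p (T i / T j)) = 0" if "i \<in> I" for i
  proof (cases "i = a \<or> i = b")
    case True
    then have "\<exists>j\<in>I - {i}. hl_factor p (T i / T j) = 0"
    proof
      assume "i = a"
      then show ?thesis using ab(2,3) hab by (intro bexI[of _ b]) auto
    next
      assume "i = b"
      then show ?thesis using ab(1,3) hba by (intro bexI[of _ a]) auto
    qed
    then have "(\<Prod>j\<in>I - {i}. hl_factor p (T i / T j)) = 0"
      using fin by (auto intro: prod_zero)
    then show ?thesis by simp
  qed (use z[of "I - {i}"] fin ab in auto)
  then have "(\<Sum>i\<in>I. hl_weight p (I - {i}) T * (\<Prod>j\<in>I - {i}. hl_factor p (T i / T j))) = 0"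
    by (rule sum.neutral[OF ballI])
  then show ?thesis using z[OF ab(1,2) fin] by (simp only: mult_zero_right)
qed

lemma continuous_on_hl_weight:
  assumes "norm p < 1"
  shows "continuous_on torus (\<lambda>T. hl_factor p (T i / T j))"
    and "continuous_on torus (hl_weight p I)"
proof -
  have coord: "continuous_on torus (\<lambda>T. T i)" for i
    by (rule continuous_on_product_then_coordinatewise[OF continuous_on_id])
  show 1: "continuous_on torus (\<lambda>T. hl_factor p (T i / T j))" for i j
    unfolding hl_factor_def
  proof (intro continuous_on_divide continuous_on_diff continuous_on_mult continuous_on_const coord ballI)
    fix T assume "T \<in> torus"
    then have "norm (T i) = 1" "norm (T j) = 1" by (auto simp: torus_def)
    then show "T j \<noteq> 0" "1 - p * (T i / T j) \<noteq> 0"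
      using hl_factor_denominator[OF assms, of "T i / T j"] by (auto simp: norm_divide)
    then show "T j \<noteq> 0" by simp
  qed
  show "continuous_on torus (hl_weight p I)"
    unfolding hl_weight_def[abs_def] by (intro continuous_on_prod 1)
qed

text \<open>Partial fractions: 1 / (z (z - c)) is the difference of 1 / (z - c) and 1 / z, divided
  by c, and Cauchy's formula applies to each term.\<close>

lemma circle_average_residue:
  assumes hol: "\<phi> holomorphic_on cball 0 1" and c: "c \<noteq> 0" "norm c < 1"
  shows "integral {0..1} (\<lambda>x. \<phi> (cis (2 * pi * x)) / (cis (2 * pi * x) - c)) = (\<phi> c - \<phi> 0) / c"
proof -
  have C: "((\<lambda>u. \<phi> u / (u - w)) has_contour_integral (2 * of_real pi * \<i> * \<phi> w)) (circlepath 0 1)"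
    if "norm w < 1" for w
    by (rule Cauchy_integral_circlepath_simple[OF hol]) (use that in simp)
  have "((\<lambda>u. (\<phi> u / (u - c) - \<phi> u / (u - 0)) / (2 * of_real pi * \<i> * c)) has_contour_integral
     ((2 * of_real pi * \<i> * \<phi> c - 2 * of_real pi * \<i> * \<phi> 0) / (2 * of_real pi * \<i> * c))) (circlepath 0 1)"
    by (intro has_contour_integral_div has_contour_integral_diff C) (use c in auto)
  moreover have "(2 * of_real pi * \<i> * \<phi> c - 2 * of_real pi * \<i> * \<phi> 0) / (2 * of_real pi * \<i> * c) = (\<phi> c - \<phi> 0) / c"
    by (simp flip: right_diff_distrib)
  ultimately have "((\<lambda>u. (\<phi> u / (u - c) - \<phi> u / (u - 0)) / (2 * of_real pi * \<i> * c)) has_contour_integral (\<phi> c - \<phi> 0) / c) (circlepath 0 1)"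
    by simp
  then have "((\<lambda>z. \<phi> z / (z - c) / (2 * of_real pi * \<i> * z)) has_contour_integral (\<phi> c - \<phi> 0) / c) (circlepath 0 1)"
  proof (rule has_contour_integral_eq)
    fix z assume "z \<in> path_image (circlepath 0 (1::real))"
    then have "norm z = 1" by simp
    then have "z \<noteq> 0" "z - c \<noteq> 0" using c by auto
    then show "(\<phi> z / (z - c) - \<phi> z / (z - 0)) / (2 * of_real pi * \<i> * c) = \<phi> z / (z - c) / (2 * of_real pi * \<i> * z)"
      using c by (simp add: divide_simps) (simp add: algebra_simps)
  qed
  then show ?thesis
    using contour_integral_unit_circle[of "\<lambda>z. \<phi> z / (z - c)"] by (simp add: contour_integral_unique)
qed


subsection \<open>Gaussian binomial coefficients and the residue recursion\<close>

text \<open>For \<open>k\<close> > \<open>n\<close> the factor with \<open>i\<close> =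
  \<open>n\<close> is 1 - P^0 = 0, so truncated subtraction yields the customary value 0.\<close>

definition gauss_binomial :: "complex \<Rightarrow> nat \<Rightarrow> nat \<Rightarrow> complex"
  where "gauss_binomial P n k = (\<Prod>i<k. (1 - P ^ (n - i)) / (1 - P ^ Suc i))"

lemma gauss_binomial_0 [simp]: "gauss_binomial P n 0 = 1"
  by (simp add: gauss_binomial_def)

lemma gauss_binomial_eq_0: "n < k \<Longrightarrow> gauss_binomial P n k = 0"
  unfolding gauss_binomial_def by (rule prod_zero) (auto intro!: bexI[of _ n])

lemma gauss_binomial_Suc:
  "gauss_binomial P n (Suc k) = gauss_binomial P n k * (1 - P ^ (n - k)) / (1 - P ^ Suc k)"
  by (simp add: gauss_binomial_def)

lemma gauss_binomial_Suc_Suc: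
  "gauss_binomial P (Suc n) (Suc k) = (1 - P ^ Suc n) / (1 - P ^ Suc k) * gauss_binomial P n k"
proof (induction k)
  case (Suc k)
  then show ?case unfolding gauss_binomial_Suc[of P "Suc n" "Suc k"] gauss_binomial_Suc[of P n k] by (simp add: mult_ac)
qed (simp add: gauss_binomial_def)

text \<open>With u = P^(n-k) and v = P^(k+1) these are the two splittings 1 - u v = (1 - u) + u (1 -
  v) = v (1 - u) + (1 - v). The first form drives the residue recursion and the powers of F on the
  tensor product, the second the generating function.\<close>

lemma gauss_binomial_pascal:
  assumes "\<And>j. j > 0 \<Longrightarrow> P ^ j \<noteq> 1"
  shows "gauss_binomial P (Suc n) (Suc k) = gauss_binomial P n (Suc k) + P ^ (n - k) * gauss_binomial P n k"
    and "gauss_binomial P (Suc n) (Suc k) = P ^ Suc k * gauss_binomial P n (Suc k) + gauss_binomial P n k"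
proof -
  have nz: "1 - P ^ Suc k \<noteq> 0" using assms[of "Suc k"] by simp
  have "gauss_binomial P (Suc n) (Suc k) = gauss_binomial P n (Suc k) + P ^ (n - k) * gauss_binomial P n k \<and>
    gauss_binomial P (Suc n) (Suc k) = P ^ Suc k * gauss_binomial P n (Suc k) + gauss_binomial P n k"
  proof (cases "k \<le> n")
    case True
    then have e: "P ^ Suc n = P ^ (n - k) * P ^ Suc k" by (simp flip: power_add power_Suc)
    have "(1 - u * v) / (1 - v) * g = g * (1 - u) / (1 - v) + u * g \<and>
      (1 - u * v) / (1 - v) * g = v * (g * (1 - u) / (1 - v)) + g" if "1 - v \<noteq> 0" for u v g :: complex
      using that by (simp add: divide_simps) (simp add: algebra_simps)
    from this[OF nz] show ?thesis unfolding gauss_binomial_Suc_Suc e gauss_binomial_Suc[of P n k] .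
  qed (simp add: gauss_binomial_eq_0)
  then show "gauss_binomial P (Suc n) (Suc k) = gauss_binomial P n (Suc k) + P ^ (n - k) * gauss_binomial P n k"
    and "gauss_binomial P (Suc n) (Suc k) = P ^ Suc k * gauss_binomial P n (Suc k) + gauss_binomial P n k"
    by blast+
qed

text \<open>\<open>B\<close> will be A^2 and \<open>g\<close> the numerator for one variable. The
  recursion uses only the values of \<open>g\<close> at 0 and at the poles.\<close>

locale hl_integral =
  fixes p B :: complex and g :: "complex \<Rightarrow> complex"
  assumes p: "p \<noteq> 0" "norm p < 1" and B: "B \<noteq> 0" "norm B < 1" and g: "g holomorphic_on UNIV"
begin

definition pole :: "nat \<Rightarrow> complex" where "pole k = p ^ k * B"

text \<open>For \<open>k\<close> = 0 this is g z / ((1 - B z) (1 - z / B)), the one-variable factor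
  of the integrand. The prefactor - B is kept for all \<open>k\<close>, so that only the pole
  changes.\<close>

definition weight :: "nat \<Rightarrow> complex \<Rightarrow> complex"
  where "weight k z = - B * g z / ((1 - B * z) * (z - pole k))"

text \<open>The residue of \<open>weight k z\<close> / z at z = \<open>pole k\<close>; the residue
  at 0 is g 0 / p^k.\<close>

definition residue_coeff :: "nat \<Rightarrow> complex"
  where "residue_coeff k = - g (pole k) / (p ^ k * (1 - p ^ k * B ^ 2))"

definition total :: "nat \<Rightarrow> nat \<Rightarrow> (nat \<Rightarrow> complex) \<Rightarrow> complex"
  where "total n k = avgs n (\<lambda>T. (\<Prod>j\<in>{1..n}. weight k (T j)) * hl_weight p {1..n} T)"

text \<open>A sum over lattice paths: each of the \<open>n\<close> variables either takes the
  residue at 0, with factor g 0 / p^i for the current index i, or the residue at the pole, which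
  raises the index by one. For \<open>r\<close> steps of the second kind the pole residues form a
  fixed product, and the powers of 1/p from the zero residues add up over all orders to the Gaussian
  binomial.\<close>

definition chain_sum :: "nat \<Rightarrow> nat \<Rightarrow> complex"
  where "chain_sum n k = (\<Sum>r\<le>n. gauss_binomial (1 / p) n r * (g 0 / p ^ k) ^ (n - r) *
     (\<Prod>i<r. residue_coeff (k + i)))"

lemma pole: "pole k \<noteq> 0" "norm (pole k) < 1"
proof -
  show "pole k \<noteq> 0" using p B by (simp add: pole_def)
  have "norm (pole k) \<le> 1 * norm B" unfolding pole_def norm_mult norm_power
    by (intro mult_right_mono power_le_one) (use p in auto)
  then show "norm (pole k) < 1" using B by simp
qed

lemma continuous_on_weight: "continuous_on torus (\<lambda>T. weight k (T j))"
  unfolding weight_def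
proof (intro continuous_on_divide continuous_on_diff continuous_on_mult continuous_on_const ballI)
  show coord: "continuous_on torus (\<lambda>T. T j)"
    by (rule continuous_on_product_then_coordinatewise[OF continuous_on_id])
  then show "continuous_on torus (\<lambda>T. T j)" .
  show "continuous_on torus (\<lambda>T. g (T j))"
    by (rule continuous_on_compose2[OF holomorphic_on_imp_continuous_on[OF g] coord]) auto
  fix T assume "T \<in> torus"
  then have "norm (T j) = 1" by (simp add: torus_def)
  then show "(1 - B * T j) * (T j - pole k) \<noteq> 0"
    using hl_factor_denominator[OF B(2), of "T j"] pole(2)[of k] by auto
qed

text \<open>For c = \<open>pole k\<close> the pair factor is (z - c) / (z - p c): it cancels the old
  pole and creates the next one.\<close>

lemma weight_shift: "norm z = 1 \<Longrightarrow> weight k z * hl_factor p (pole k / z) = weight (Suc k) z"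
proof -
  assume z: "norm z = 1"
  have "z \<noteq> 0" "z - pole k \<noteq> 0" "z - pole (Suc k) \<noteq> 0" using z pole(2)[of k] pole(2)[of "Suc k"] by auto
  moreover have "pole (Suc k) = p * pole k" by (simp add: pole_def)
  moreover from calculation have "hl_factor p (pole k / z) = (z - pole k) / (z - pole (Suc k))"
    unfolding hl_factor_def by (simp add: divide_simps)
  ultimately show ?thesis unfolding weight_def by simp
qed

text \<open>The product over \<open>J\<close> is holomorphic on the closed disc and equals 1 at 0,
  so only the residue at \<open>pole k\<close> retains it.\<close>

lemma avg_weight:
  assumes T: "T \<in> torus" and "finite J" "i \<notin> J"
  shows "avg i (\<lambda>T. weight k (T i) * (\<Prod>j\<in>J. hl_factor p (T i / T j))) T
    = g 0 / p ^ k + residue_coeff k * (\<Prod>j\<in>J. hl_factor p (pole k / T j))"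
proof -
  define \<phi> where "\<phi> = (\<lambda>z. - B * g z / (1 - B * z) * (\<Prod>j\<in>J. hl_factor p (z / T j)))"
  have n: "norm (T j) = 1" for j using T by (simp add: torus_def)
  then have T0: "T j \<noteq> 0" for j by (metis norm_zero zero_neq_one)
  have "\<phi> holomorphic_on cball 0 1"
    unfolding \<phi>_def hl_factor_def
  proof (intro holomorphic_intros)
    show "g holomorphic_on cball 0 1" using g by (rule holomorphic_on_subset) simp
    fix z :: complex assume "z \<in> cball 0 1"
    then have z: "norm z \<le> 1" by simp
    show "1 - B * z \<noteq> 0" by (rule hl_factor_denominator[OF B(2) z])
    show "1 - p * (z / T j) \<noteq> 0" for j
      by (rule hl_factor_denominator[OF p(2)]) (use z n in \<open>simp add: norm_divide\<close>)
  qed (use T0 in auto)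
  from circle_average_residue[OF this pole]
  have "integral {0..1} (\<lambda>x. \<phi> (cis (2 * pi * x)) / (cis (2 * pi * x) - pole k)) = (\<phi> (pole k) - \<phi> 0) / pole k" .
  moreover have "avg i (\<lambda>T. weight k (T i) * (\<Prod>j\<in>J. hl_factor p (T i / T j))) T
      = integral {0..1} (\<lambda>x. \<phi> (cis (2 * pi * x)) / (cis (2 * pi * x) - pole k))"
    unfolding avg_def
  proof (rule integral_cong)
    fix x :: real
    have "(\<Prod>j\<in>J. hl_factor p (cis (2 * pi * x) / (T(i := cis (2 * pi * x))) j)) = (\<Prod>j\<in>J. hl_factor p (cis (2 * pi * x) / T j))"
      using assms by (intro prod.cong) auto
    then show "weight k ((T(i := cis (2 * pi * x))) i) *
          (\<Prod>j\<in>J. hl_factor p ((T(i := cis (2 * pi * x))) i / (T(i := cis (2 * pi * x))) j)) =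
         \<phi> (cis (2 * pi * x)) / (cis (2 * pi * x) - pole k)"
      by (simp add: weight_def \<phi>_def)
  qed
  moreover have "(\<phi> (pole k) - \<phi> 0) / pole k
     = g 0 / p ^ k + residue_coeff k * (\<Prod>j\<in>J. hl_factor p (pole k / T j))"
  proof -
    have e: "1 - B * pole k = 1 - p ^ k * B ^ 2" by (simp add: pole_def power2_eq_square)
    have "1 - B * pole k \<noteq> 0" by (rule hl_factor_denominator[OF B(2)]) (use pole(2)[of k] in simp)
    moreover have "\<phi> 0 = - B * g 0" by (simp add: \<phi>_def hl_factor_def)
    moreover have "\<phi> (pole k) = - B * g (pole k) / (1 - p ^ k * B ^ 2) * (\<Prod>j\<in>J. hl_factor p (pole k / T j))"
      by (simp add: \<phi>_def e)
    moreover have "(- B * v / d * w - - B * u) / (c * B) = u / c + - v / (c * d) * w"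
      if "d \<noteq> 0" "c \<noteq> 0" for u v w c d
      using that B by (simp add: field_simps)
    ultimately show ?thesis
      unfolding residue_coeff_def using p by (simp only: e) (simp add: pole_def)
  qed
  ultimately show ?thesis by simp
qed

lemma avg_cmult_indep:
  assumes "\<And>x. f (T(i := cis (2 * pi * x))) = f T"
  shows "avg i (\<lambda>T. f T * h T) T = f T * avg i h T"
  using assms unfolding avg_def by simp

lemma continuous_on_split:
  "continuous_on torus (\<lambda>T. (\<Prod>j\<in>J. weight k (T j)) * (hl_weight p I T * (\<Prod>j\<in>K. hl_factor p (T i / T j))))"
  by (intro continuous_on_mult continuous_on_prod continuous_on_weight continuous_on_hl_weight[OF p(2)])

lemma total_Suc:
  assumes S: "S \<in> torus"
  shows "(1 - p ^ Suc n) * total (Suc n) k S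
    = of_nat (Suc n) * (1 - p) * (g 0 / p ^ k * total n k S + residue_coeff k * total n (Suc k) S)"
proof -
  define I where "I = {1..Suc n}"
  define f where "f = (\<lambda>i T. (\<Prod>j\<in>I. weight k (T j)) *
     (hl_weight p (I - {i}) T * (\<Prod>j\<in>I - {i}. hl_factor p (T i / T j))))"
  have fin: "finite I" "card I = Suc n" by (simp_all add: I_def)
  have I': "I - {Suc n} = {1..n}" by (auto simp: I_def)
  have cf: "continuous_on torus (f i)" for i unfolding f_def by (rule continuous_on_split)
  have 1: "(1 - p ^ Suc n) * total (Suc n) k S = (1 - p) * (\<Sum>i\<in>I. avgs (Suc n) (f i) S)"
  proof -
    have "(1 - p ^ Suc n) * total (Suc n) k S
       = avgs (Suc n) (\<lambda>T. (1 - p ^ Suc n) * ((\<Prod>j\<in>I. weight k (T j)) * hl_weight p I T)) S"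
      unfolding avgs_cmult by (simp add: total_def I_def)
    also have "\<dots> = avgs (Suc n) (\<lambda>T. (1 - p) * (\<Sum>i\<in>I. f i T)) S"
    proof (rule avgs_cong[OF _ S])
      fix T assume "T \<in> torus"
      then have "(1 - p ^ card I) * hl_weight p I T
         = (1 - p) * (\<Sum>i\<in>I. hl_weight p (I - {i}) T * (\<Prod>j\<in>I - {i}. hl_factor p (T i / T j)))"
        by (intro hl_weight_symmetrization p fin) (auto simp: torus_def)
      then have "(\<Prod>j\<in>I. weight k (T j)) * ((1 - p ^ card I) * hl_weight p I T)
         = (\<Prod>j\<in>I. weight k (T j)) * ((1 - p) * (\<Sum>i\<in>I. hl_weight p (I - {i}) T * (\<Prod>j\<in>I - {i}. hl_factor p (T i / T j))))"
        by (rule arg_cong)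
      then show "(1 - p ^ Suc n) * ((\<Prod>j\<in>I. weight k (T j)) * hl_weight p I T) = (1 - p) * (\<Sum>i\<in>I. f i T)"
        unfolding f_def fin sum_distrib_left[symmetric] by (simp only: mult_ac)
    qed
    also have "\<dots> = (1 - p) * (\<Sum>i\<in>I. avgs (Suc n) (f i) S)"
      unfolding avgs_cmult avgs_sum[OF cf S fin(1)] ..
    finally show ?thesis .
  qed
  \<comment> \<open>Apart from the distinguished index everything in \<open>f i\<close> is
    symmetric, so \<open>f i\<close> is \<open>f (Suc n)\<close> with two variables
    exchanged.\<close>
  have 2: "avgs (Suc n) (f i) S = avgs (Suc n) (f (Suc n)) S" if i: "i \<in> I" for i
  proof -
    define s where "s = Transposition.transpose i (Suc n)"
    have s: "inj s" "s ` I = I" "s (Suc n) = i"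
    proof -
      show "inj s" unfolding s_def by (rule inj_transpose)
      show "s ` I = I" unfolding s_def using i by (intro transpose_image_eq) (auto simp: I_def)
      show "s (Suc n) = i" by (simp add: s_def)
    qed
    then have sd: "s ` (I - {Suc n}) = I - {i}" by (simp add: image_set_diff)
    have "f i T = f (Suc n) (T \<circ> s)" for T
    proof -
      have "(\<Prod>j\<in>I. weight k ((T \<circ> s) j)) = (\<Prod>j\<in>s ` I. weight k (T j))"
        using s(1) by (subst prod.reindex) (auto intro: inj_on_subset)
      moreover have "(\<Prod>j\<in>I - {Suc n}. hl_factor p ((T \<circ> s) (Suc n) / (T \<circ> s) j))
         = (\<Prod>j\<in>s ` (I - {Suc n}). hl_factor p (T i / T j))"
        using s(1,3) by (subst prod.reindex) (auto intro: inj_on_subset)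
      ultimately show ?thesis
        unfolding f_def hl_weight_reindex[OF s(1)] sd s(2) by simp
    qed
    then have "f i = (\<lambda>T. f (Suc n) (T \<circ> Transposition.transpose i (Suc n)))"
      unfolding s_def by (rule ext)
    moreover have "avgs (Suc n) (\<lambda>T. f (Suc n) (T \<circ> Transposition.transpose i (Suc n))) S = avgs (Suc n) (f (Suc n)) S"
      by (rule avgs_transpose[OF cf]) (use i S in \<open>auto simp: I_def\<close>)
    ultimately show ?thesis by (simp only:)
  qed
  have 3: "avgs (Suc n) (f (Suc n)) S = g 0 / p ^ k * total n k S + residue_coeff k * total n (Suc k) S"
  proof -
    let ?F = "\<lambda>k T. (\<Prod>j\<in>{1..n}. weight k (T j)) * hl_weight p {1..n} T"
    have "avgs (Suc n) (f (Suc n)) S = avgs n (avg (Suc n) (f (Suc n))) S"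
      using avg_avgs_commute[OF cf S] by simp
    \<comment> \<open>The two residues are written as a sum over the booleans, so that
      \<open>avgs_sum\<close> splits them.\<close>
    also have "\<dots> = avgs n (\<lambda>T. \<Sum>b\<in>UNIV. if b then g 0 / p ^ k * ?F k T else residue_coeff k * ?F (Suc k) T) S"
    proof (rule avgs_cong[OF _ S])
      fix T assume T: "T \<in> torus"
      have "f (Suc n) T' = ?F k T' * (weight k (T' (Suc n)) * (\<Prod>j\<in>{1..n}. hl_factor p (T' (Suc n) / T' j)))" for T'
        unfolding f_def I' unfolding I_def by (simp add: mult_ac)
      then have "avg (Suc n) (f (Suc n)) T
         = avg (Suc n) (\<lambda>T'. ?F k T' * (weight k (T' (Suc n)) * (\<Prod>j\<in>{1..n}. hl_factor p (T' (Suc n) / T' j)))) T"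
        by presburger
      also have "\<dots> = ?F k T * avg (Suc n) (\<lambda>T'. (weight k (T' (Suc n)) * (\<Prod>j\<in>{1..n}. hl_factor p (T' (Suc n) / T' j)))) T"
        by (rule avg_cmult_indep) (auto simp: hl_weight_def intro!: arg_cong2[where f = "(*)"] prod.cong)
      also have "\<dots> = ?F k T * (g 0 / p ^ k + residue_coeff k * (\<Prod>j\<in>{1..n}. hl_factor p (pole k / T j)))"
        by (subst avg_weight[OF T]) auto
      also have "(\<Prod>j\<in>{1..n}. weight (Suc k) (T j)) = (\<Prod>j\<in>{1..n}. weight k (T j)) * (\<Prod>j\<in>{1..n}. hl_factor p (pole k / T j))"
        unfolding prod.distrib[symmetric] using T by (intro prod.cong refl weight_shift[symmetric]) (simp add: torus_def)
      then have "?F k T * (g 0 / p ^ k + residue_coeff k * (\<Prod>j\<in>{1..n}. hl_factor p (pole k / T j)))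
         = (\<Sum>b\<in>UNIV. if b then g 0 / p ^ k * ?F k T else residue_coeff k * ?F (Suc k) T)"
        by (simp add: UNIV_bool algebra_simps)
      finally show "avg (Suc n) (f (Suc n)) T = (\<Sum>b\<in>UNIV. if b then g 0 / p ^ k * ?F k T else residue_coeff k * ?F (Suc k) T)" .
    qed
    also have "\<dots> = (\<Sum>b\<in>UNIV. avgs n (\<lambda>T. if b then g 0 / p ^ k * ?F k T else residue_coeff k * ?F (Suc k) T) S)"
    proof (rule avgs_sum[OF _ S])
      have c: "continuous_on torus (?F k)" for k
        by (intro continuous_on_mult continuous_on_prod continuous_on_weight continuous_on_hl_weight[OF p(2)])
      show "continuous_on torus (\<lambda>T. if b then g 0 / p ^ k * ?F k T else residue_coeff k * ?F (Suc k) T)" for b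
        by (cases b; simp only: if_True if_False; rule continuous_on_mult[OF continuous_on_const c])
    qed auto
    also have "\<dots> = g 0 / p ^ k * total n k S + residue_coeff k * total n (Suc k) S"
    proof -
      have "(\<Sum>b\<in>UNIV. h b) = h True + h False" for h :: "bool \<Rightarrow> complex"
        by (simp add: UNIV_bool)
      moreover have "avgs n (\<lambda>T. z * ?F k T) S = z * total n k S" for z k
        by (simp only: avgs_cmult total_def)
      ultimately show ?thesis by (simp only: if_True if_False)
    qed
    finally show ?thesis .
  qed
  have "(\<Sum>i\<in>I. avgs (Suc n) (f i) S) = of_nat (Suc n) * avgs (Suc n) (f (Suc n)) S"
    using sum.cong[OF refl 2, of I] fin by simp
  then show ?thesis unfolding 1 3 by (simp only: mult_ac)
qed

lemma power_neq_1: "j > 0 \<Longrightarrow> p ^ j \<noteq> 1"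
proof
  assume "j > 0" "p ^ j = 1"
  then have "norm p ^ j = 1" by (metis norm_one norm_power)
  moreover have "norm p ^ j < 1" using p \<open>j > 0\<close> by (simp add: power_less_one_iff)
  ultimately show False by simp
qed

text \<open>The first Pascal rule, read as a choice for the variable integrated first. In its second
  term the power of 1/p turns g 0 / p^k into g 0 / p^(k+1), which is the shift of the pole.\<close>

lemma chain_sum_Suc:
  "chain_sum (Suc n) k = g 0 / p ^ k * chain_sum n k + residue_coeff k * chain_sum n (Suc k)"
proof -
  let ?P = "1 / p" and ?z = "g 0 / p ^ k"
  let ?R = "\<lambda>r. \<Prod>i<r. residue_coeff (k + i)"
  have P: "?P ^ j \<noteq> 1" if "j > 0" for j using power_neq_1[OF that] p by (simp add: power_one_over)
  have "chain_sum (Suc n) k = ?z ^ Suc n + (\<Sum>r\<le>n. gauss_binomial ?P (Suc n) (Suc r) * ?z ^ (n - r) * ?R (Suc r))"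
    unfolding chain_sum_def sum.atMost_Suc_shift by simp
  also have "(\<Sum>r\<le>n. gauss_binomial ?P (Suc n) (Suc r) * ?z ^ (n - r) * ?R (Suc r))
     = (\<Sum>r\<le>n. gauss_binomial ?P n (Suc r) * ?z ^ (n - r) * ?R (Suc r))
       + (\<Sum>r\<le>n. ?P ^ (n - r) * gauss_binomial ?P n r * ?z ^ (n - r) * ?R (Suc r))"
  proof -
    have "gauss_binomial ?P (Suc n) (Suc r) = gauss_binomial ?P n (Suc r) + ?P ^ (n - r) * gauss_binomial ?P n r" for r
      using P by (intro gauss_binomial_pascal(1))
    then show ?thesis unfolding sum.distrib[symmetric] by (simp only: ring_distribs)
  qed
  also have "(\<Sum>r\<le>n. ?P ^ (n - r) * gauss_binomial ?P n r * ?z ^ (n - r) * ?R (Suc r))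
     = residue_coeff k * chain_sum n (Suc k)"
    unfolding chain_sum_def sum_distrib_left
  proof (intro sum.cong refl)
    fix r
    have "?R (Suc r) = residue_coeff k * (\<Prod>i<r. residue_coeff (Suc k + i))"
      by (subst prod.lessThan_Suc_shift) simp
    moreover have "(g 0 / p ^ Suc k) ^ (n - r) = ?P ^ (n - r) * ?z ^ (n - r)"
      by (simp flip: power_mult_distrib)
    ultimately show "?P ^ (n - r) * gauss_binomial ?P n r * ?z ^ (n - r) * ?R (Suc r)
       = residue_coeff k * (gauss_binomial ?P n r * (g 0 / p ^ Suc k) ^ (n - r) * (\<Prod>i<r. residue_coeff (Suc k + i)))"
      by (simp only: mult_ac)
  qed
  also have "?z ^ Suc n + ((\<Sum>r\<le>n. gauss_binomial ?P n (Suc r) * ?z ^ (n - r) * ?R (Suc r)) + residue_coeff k * chain_sum n (Suc k))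
     = (\<Sum>r\<le>Suc n. gauss_binomial ?P n r * ?z ^ (Suc n - r) * ?R r) + residue_coeff k * chain_sum n (Suc k)"
    unfolding sum.atMost_Suc_shift by simp
  also have "(\<Sum>r\<le>Suc n. gauss_binomial ?P n r * ?z ^ (Suc n - r) * ?R r) = ?z * chain_sum n k"
    unfolding chain_sum_def sum_distrib_left sum.atMost_Suc
    by (simp add: gauss_binomial_eq_0) (auto intro!: sum.cong simp: Suc_diff_le)
  finally show ?thesis .
qed

lemma total_eq:
  assumes S: "S \<in> torus"
  shows "total n k S = (\<Prod>j=1..n. of_nat j * (1 - p) / (1 - p ^ j)) * chain_sum n k"
proof (induction n arbitrary: k)
  case 0
  show ?case by (simp add: total_def chain_sum_def hl_weight_def)
next
  case (Suc n)
  have "1 - p ^ Suc n \<noteq> 0" using power_neq_1[of "Suc n"] by simp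
  then have "total (Suc n) k S
    = of_nat (Suc n) * (1 - p) / (1 - p ^ Suc n) * (g 0 / p ^ k * total n k S + residue_coeff k * total n (Suc k) S)"
    using total_Suc[OF S, of n k] by (simp add: divide_simps mult_ac)
  moreover have "(\<Prod>j=1..Suc n. of_nat j * (1 - p) / (1 - p ^ j))
     = (\<Prod>j=1..n. of_nat j * (1 - p) / (1 - p ^ j)) * (of_nat (Suc n) * (1 - p) / (1 - p ^ Suc n))"
    by (simp add: prod.nat_ivl_Suc' mult.commute del: of_nat_Suc power_Suc)
  moreover have "c * (u * (z * v) + w * (z * y)) = z * c * (u * v + w * y)" for c u v w y z :: complex
    by (simp add: algebra_simps)
  ultimately show ?case unfolding Suc chain_sum_Suc by presburger
qed

end


subsection \<open>The integral\<close>

lemma qpow_power: "qpow t a ^ n = qpow t (of_nat n * a)"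
  by (simp add: qpow_def mult_ac flip: exp_of_nat_mult)

lemma qpow_nonzero [simp]: "qpow t a \<noteq> 0"
  by (simp add: qpow_def)

lemma qpow_minus: "qpow t (- a) = 1 / qpow t a"
  by (simp add: qpow_def exp_minus field_simps)

lemma norm_qpow_minus_2_less_1: "Re t > 0 \<Longrightarrow> norm (qpow t (- 2)) < 1"
  by (simp add: qpow_def)

text \<open>Each of the m (m - 1) / 2 pairs contributes p^2 with p = q^(-2), and the product over
  \<open>j\<close> stems from the symmetrization.\<close>

definition int_const :: "complex \<Rightarrow> nat \<Rightarrow> complex \<Rightarrow> complex \<Rightarrow> complex"
  where "int_const t m l \<mu> = qpow t (- l * \<mu>) * qpow t (- 2) ^ (m * (m - 1)) *
    (\<Prod>j=1..m. of_nat j * (1 - qpow t (- 2)) / (1 - qpow t (- 2) ^ j))"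

text \<open>The part of summand \<open>r\<close> of \<open>chain_sum\<close> that is free of A: at
  the pole p^i A^2 the quotient of the variable by A^2 is p^i.\<close>

definition int_coeff :: "complex \<Rightarrow> nat \<Rightarrow> complex \<Rightarrow> complex \<Rightarrow> nat \<Rightarrow> complex"
  where "int_coeff t m l \<mu> r = gauss_binomial (qpow t 2) m r *
    (qpow t (- l - of_nat m) * qpow t (- \<mu> - of_nat m)) ^ (m - r) *
    (\<Prod>i<r. - ((qpow t (- 2) ^ i * qpow t (l + of_nat m) - qpow t (- l - of_nat m)) *
       (qpow t (- 2) ^ i * qpow t (\<mu> + of_nat m) - qpow t (- \<mu> - of_nat m))) / qpow t (- 2) ^ i)"

text \<open>Since 1 - x / p = - (x / p) (1 - p / x) and (1 - x)^2 = - x (1 - x) (1 - 1 / x), the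
  prefactor p of the integrand becomes p^2.\<close>

lemma hl_factor_pair:
  assumes "Re t > 0" "norm x = 1"
  shows "qpow t (- 2) * (1 - x)\<^sup>2 / ((1 - x * qpow t (- 2)) * (1 - x * qpow t 2))
    = qpow t (- 2) ^ 2 * (hl_factor (qpow t (- 2)) x * hl_factor (qpow t (- 2)) (1 / x))"
proof -
  define p where "p = qpow t (- 2)"
  have p: "p \<noteq> 0" "norm p < 1" using assms norm_qpow_minus_2_less_1 by (auto simp: p_def)
  have q: "qpow t 2 = 1 / p" by (simp add: p_def qpow_minus)
  have x: "x \<noteq> 0" "1 - p * x \<noteq> 0" "x - p \<noteq> 0" using hl_factor_denominator[OF p(2), of x] assms p by auto
  have a: "1 - x * (1 / p) = (p - x) / p" "1 - p * (1 / x) = (x - p) / x" "1 - 1 / x = (x - 1) / x"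
    using p x by (simp_all add: field_simps)
  have "p - x \<noteq> 0" using x by simp
  then show ?thesis
    unfolding q hl_factor_def p_def[symmetric] a using p x
    by (simp add: divide_simps power2_eq_square) (simp add: algebra_simps)
qed

lemma pair_product_eq_hl_weight:
  assumes "Re t > 0" "T \<in> torus"
  shows "(\<Prod>j=1..m. \<Prod>i\<in>{1..<j}. qpow t (- 2) * (1 - T i / T j)\<^sup>2 /
       ((1 - T i / T j * qpow t (- 2)) * (1 - T i / T j * qpow t 2)))
     = qpow t (- 2) ^ (m * (m - 1)) * hl_weight (qpow t (- 2)) {1..m} T"
proof (induction m)
  case 0
  show ?case by (simp add: hl_weight_def)
next
  case (Suc m)
  let ?p = "qpow t (- 2)"
  have "(\<Prod>i\<in>{1..<Suc m}. ?p * (1 - T i / T (Suc m))\<^sup>2 /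
       ((1 - T i / T (Suc m) * ?p) * (1 - T i / T (Suc m) * qpow t 2)))
     = (\<Prod>i\<in>{1..m}. ?p ^ 2 * (hl_factor ?p (T (Suc m) / T i) * hl_factor ?p (T i / T (Suc m))))"
  proof (rule prod.cong)
    fix i assume "i \<in> {1..m}"
    have "norm (T i / T (Suc m)) = 1" using assms by (simp add: torus_def norm_divide)
    from hl_factor_pair[OF assms(1) this]
    show "?p * (1 - T i / T (Suc m))\<^sup>2 / ((1 - T i / T (Suc m) * ?p) * (1 - T i / T (Suc m) * qpow t 2))
       = ?p ^ 2 * (hl_factor ?p (T (Suc m) / T i) * hl_factor ?p (T i / T (Suc m)))"
      by (simp only: divide_divide_eq_right mult_1 mult_ac) 
  qed auto
  also have "\<dots> = ?p ^ (2 * m) * ((\<Prod>i\<in>{1..m}. hl_factor ?p (T (Suc m) / T i)) * (\<Prod>i\<in>{1..m}. hl_factor ?p (T i / T (Suc m))))"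
    by (simp only: prod.distrib prod_constant power_mult card_atLeastAtMost) simp
  finally have 1: "(\<Prod>i\<in>{1..<Suc m}. ?p * (1 - T i / T (Suc m))\<^sup>2 /
       ((1 - T i / T (Suc m) * ?p) * (1 - T i / T (Suc m) * qpow t 2))) = \<dots>" .
  have "{1..Suc m} - {Suc m} = {1..m}" by auto
  then have 2: "hl_weight ?p {1..Suc m} T = hl_weight ?p {1..m} T * (\<Prod>i\<in>{1..m}. hl_factor ?p (T (Suc m) / T i)) *
     (\<Prod>i\<in>{1..m}. hl_factor ?p (T i / T (Suc m)))"
    using hl_weight_remove[of "{1..Suc m}" "Suc m" ?p T] by simp
  have 3: "?p ^ (Suc m * (Suc m - 1)) = ?p ^ (m * (m - 1)) * ?p ^ (2 * m)"
  proof -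
    have "Suc m * (Suc m - 1) = m * (m - 1) + 2 * m" by (cases m) simp_all
    then show ?thesis by (simp only: power_add)
  qed
  have p1: "(\<Prod>j=1..Suc m. h j) = (\<Prod>j=1..m. h j) * h (Suc m)" for h :: "nat \<Rightarrow> complex"
    by (simp add: prod.nat_ivl_Suc' mult.commute)
  show ?case unfolding p1 Suc 1 2 3 by (simp only: mult_ac)
qed

text \<open>The closed form for \<open>total\<close> at pole index 0 with B = A^2, whence 1 - p^i
  B^2 = 1 - p^i A^4.\<close>

lemma I_int_eq:
  assumes t: "Re t > 0" and A: "0 < norm A" "norm A < 1"
  shows "I_int t m l \<mu> A = int_const t m l \<mu> *
    (\<Sum>r\<le>m. int_coeff t m l \<mu> r / (\<Prod>i<r. 1 - qpow t (- 2) ^ i * A ^ 4))"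
proof -
  let ?p = "qpow t (- 2)"
  define g where "g = (\<lambda>z. (z / A^2 * qpow t (l + of_nat m) - qpow t (- l - of_nat m)) *
       (z / A^2 * qpow t (\<mu> + of_nat m) - qpow t (- \<mu> - of_nat m)))"
  have A0: "A \<noteq> 0" using A by auto
  interpret hl_integral ?p "A^2" g
  proof
    show "norm ?p < 1" by (rule norm_qpow_minus_2_less_1[OF t])
    show "norm (A^2) < 1" using A by (simp add: norm_power power_less_one_iff)
    show "g holomorphic_on UNIV" unfolding g_def using A0 by (intro holomorphic_intros) auto
  qed (use A0 in auto)
  have one: "(\<lambda>_. 1) \<in> torus" by (simp add: torus_def)
  have "integrand t m l \<mu> A T = ?p ^ (m * (m - 1)) * ((\<Prod>j\<in>{1..m}. weight 0 (T j)) * hl_weight ?p {1..m} T)"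
    if T: "T \<in> torus" for T
  proof -
    have "(\<Prod>j=1..m. (T j / A^2 * qpow t (l + of_nat m) - qpow t (- l - of_nat m)) *
       (T j / A^2 * qpow t (\<mu> + of_nat m) - qpow t (- \<mu> - of_nat m)) / ((1 - T j * A^2) * (1 - T j / A^2)))
      = (\<Prod>j\<in>{1..m}. weight 0 (T j))"
    proof (rule prod.cong[OF refl])
      fix j
      have "norm (T j) = 1" using T by (simp add: torus_def)
      then have "1 - A^2 * T j \<noteq> 0" "T j - A^2 \<noteq> 0" using hl_factor_denominator[OF B(2), of "T j"] B by auto
      moreover have "1 - T j / A^2 = - (T j - A^2) / A^2" using A0 by (simp add: field_simps)
      ultimately show "(T j / A^2 * qpow t (l + of_nat m) - qpow t (- l - of_nat m)) *
       (T j / A^2 * qpow t (\<mu> + of_nat m) - qpow t (- \<mu> - of_nat m)) / ((1 - T j * A^2) * (1 - T j / A^2)) = weight 0 (T j)"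
        unfolding weight_def g_def[symmetric, THEN fun_cong] pole_def using A0
        by (simp add: divide_simps mult_ac) (simp add: algebra_simps)
    qed
    then show ?thesis
      unfolding integrand_def pair_product_eq_hl_weight[OF t T] by (simp only: mult_ac)
  qed
  then have "torus_integral m (integrand t m l \<mu> A) = ?p ^ (m * (m - 1)) * total m 0 (\<lambda>_. 1)"
    unfolding torus_integral_eq_avgs total_def avgs_cmult[symmetric] by (intro avgs_cong one)
  also have "total m 0 (\<lambda>_. 1) = (\<Prod>j=1..m. of_nat j * (1 - ?p) / (1 - ?p ^ j)) * chain_sum m 0"
    by (rule total_eq[OF one])
  also have "chain_sum m 0 = (\<Sum>r\<le>m. int_coeff t m l \<mu> r / (\<Prod>i<r. 1 - ?p ^ i * A ^ 4))"
    unfolding chain_sum_def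
  proof (intro sum.cong refl)
    fix r
    have "residue_coeff (0 + i) = - ((?p ^ i * qpow t (l + of_nat m) - qpow t (- l - of_nat m)) *
       (?p ^ i * qpow t (\<mu> + of_nat m) - qpow t (- \<mu> - of_nat m))) / ?p ^ i / (1 - ?p ^ i * A ^ 4)" for i
      unfolding residue_coeff_def pole_def unfolding g_def using A0 by (simp flip: power_mult)
    moreover have "g 0 = qpow t (- l - of_nat m) * qpow t (- \<mu> - of_nat m)" by (simp add: g_def)
    moreover have "1 / ?p = qpow t 2" by (simp add: qpow_minus)
    ultimately show "gauss_binomial (1 / ?p) m r * (g 0 / ?p ^ 0) ^ (m - r) * (\<Prod>i<r. residue_coeff (0 + i))
       = int_coeff t m l \<mu> r / (\<Prod>i<r. 1 - ?p ^ i * A ^ 4)"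
      unfolding int_coeff_def by (simp only: prod_dividef power_0 div_by_1 times_divide_eq_right)
  qed
  finally show ?thesis unfolding I_int_def int_const_def by (simp only: mult_ac)
qed

text \<open>Agreement on the punctured disc, an infinite set, is agreement as rational functions.
  Multiplied out, it also decides the value at points outside the disc.\<close>

lemma continuation_unique:
  assumes "is_continuation t m l \<mu> N D" "is_continuation t m l \<mu> N' D'"
  shows "N * D' = N' * D"
proof -
  have "poly (N * D' - N' * D) A = 0" if "A \<in> ball 0 1 - {0}" for A
  proof -
    have "0 < norm A" "norm A < 1" using that by auto
    then have "poly D A \<noteq> 0" "poly D' A \<noteq> 0" "poly N A / poly D A = poly N' A / poly D' A"
      using assms unfolding is_continuation_def by metis+
    then show ?thesis by (simp add: divide_simps)
  qed
  moreover have "infinite (ball (0::complex) 1 - {0})"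
    using uncountable_ball[of 1 "0::complex"] uncountable_infinite by (auto simp: infinite_remove)
  ultimately have "N * D' - N' * D = 0"
    using poly_roots_finite[of "N * D' - N' * D"] finite_subset[of "ball 0 1 - {0}" "{A. poly (N * D' - N' * D) A = 0}"]
    by blast
  then show ?thesis by simp
qed

text \<open>The common denominator is the product of the 1 - p^i A^4 with i < m. It has no zero for
  |A| < 1, and at A = q^m its factors are 1 - q^(4m-2i), whose exponent is positive.\<close>

lemma continuation_exists:
  assumes t: "Re t > 0"
  obtains N D where "is_continuation t m l \<mu> N D" "poly D (qpow t (of_nat m)) \<noteq> 0"
    "poly N (qpow t (of_nat m)) / poly D (qpow t (of_nat m)) = int_const t m l \<mu> *
       (\<Sum>r\<le>m. int_coeff t m l \<mu> r / (\<Prod>i<r. 1 - qpow t (4 * of_nat m - 2 * of_nat i)))"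
proof -
  let ?p = "qpow t (- 2)"
  define f where "f = (\<lambda>i. 1 - monom (?p ^ i) 4)"
  have f: "poly (f i) A = 1 - ?p ^ i * A ^ 4" for i A by (simp add: f_def poly_monom)
  define D where "D = (\<Prod>i<m. f i)"
  define N where "N = smult (int_const t m l \<mu>) (\<Sum>r\<le>m. smult (int_coeff t m l \<mu> r) (\<Prod>i\<in>{r..<m}. f i))"
  have ND: "poly N A / poly D A = int_const t m l \<mu> * (\<Sum>r\<le>m. int_coeff t m l \<mu> r / (\<Prod>i<r. 1 - ?p ^ i * A ^ 4))"
    if "poly D A \<noteq> 0" for A
  proof -
    have "(\<Prod>i\<in>{r..<m}. poly (f i) A) / poly D A = 1 / (\<Prod>i<r. 1 - ?p ^ i * A ^ 4)" if "r \<le> m" for r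
    proof -
      have "poly D A = (\<Prod>i<r. poly (f i) A) * (\<Prod>i\<in>{r..<m}. poly (f i) A)"
        unfolding D_def poly_prod using prod.atLeastLessThan_concat[of 0 r m "\<lambda>i. poly (f i) A"] that
        by (simp add: atLeast0LessThan)
      with \<open>poly D A \<noteq> 0\<close> show ?thesis by (simp add: f)
    qed
    then have "(\<Sum>r\<le>m. int_coeff t m l \<mu> r * ((\<Prod>i\<in>{r..<m}. poly (f i) A) / poly D A))
       = (\<Sum>r\<le>m. int_coeff t m l \<mu> r * (1 / (\<Prod>i<r. 1 - ?p ^ i * A ^ 4)))"
      by (intro sum.cong) auto
    moreover have "(\<Sum>r\<le>m. int_coeff t m l \<mu> r * ((\<Prod>i\<in>{r..<m}. poly (f i) A) / poly D A))
       = (\<Sum>r\<le>m. int_coeff t m l \<mu> r * (\<Prod>i\<in>{r..<m}. poly (f i) A)) / poly D A"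
      by (simp add: sum_divide_distrib)
    moreover have "poly N A = int_const t m l \<mu> * (\<Sum>r\<le>m. int_coeff t m l \<mu> r * (\<Prod>i\<in>{r..<m}. poly (f i) A))"
      by (simp add: N_def poly_sum poly_prod)
    ultimately show ?thesis by simp
  qed
  have D1: "poly D A \<noteq> 0" if "norm A < 1" for A
  proof -
    have "1 - ?p ^ i * A ^ 4 \<noteq> 0" for i
    proof -
      have "norm (?p ^ i * A ^ 4) \<le> 1 * norm A ^ 4" unfolding norm_mult norm_power
        by (intro mult_right_mono power_le_one) (use norm_qpow_minus_2_less_1[OF t] in auto)
      moreover have "norm A ^ 4 < 1" using that by (simp add: power_less_one_iff)
      ultimately show ?thesis by auto
    qed
    then show ?thesis by (simp add: D_def poly_prod f)
  qed
  have pm: "?p ^ i * qpow t (of_nat m) ^ 4 = qpow t (4 * of_nat m - 2 * of_nat i)" for i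
    by (simp add: qpow_power qpow_add algebra_simps)
  have D2: "poly D (qpow t (of_nat m)) \<noteq> 0"
  proof -
    have "1 - qpow t (4 * of_nat m - 2 * of_nat i) \<noteq> 0" if "i < m" for i
    proof
      assume "1 - qpow t (4 * of_nat m - 2 * of_nat i) = 0"
      then have "norm (qpow t (4 * of_nat m - 2 * of_nat i)) = 1" by simp
      then have "Re t * (4 * of_nat m - 2 * of_nat i) = 0" by (simp add: qpow_def)
      then show False using t that by auto
    qed
    then show ?thesis by (simp add: D_def poly_prod f pm)
  qed
  show ?thesis
  proof
    show "is_continuation t m l \<mu> N D"
      unfolding is_continuation_def
    proof (intro conjI allI impI)
      show "D \<noteq> 0" using D2 by auto
      fix A :: complex assume A: "0 < norm A \<and> norm A < 1"
      then show "poly D A \<noteq> 0" using D1 by simp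
      then show "I_int t m l \<mu> A = poly N A / poly D A" using I_int_eq[OF t, of A m l \<mu>] ND A by simp
    qed
    show "poly D (qpow t (of_nat m)) \<noteq> 0" by (rule D2)
    show "poly N (qpow t (of_nat m)) / poly D (qpow t (of_nat m)) = int_const t m l \<mu> *
       (\<Sum>r\<le>m. int_coeff t m l \<mu> r / (\<Prod>i<r. 1 - qpow t (4 * of_nat m - 2 * of_nat i)))"
      unfolding ND[OF D2] pm ..
  qed
qed

lemma u_m_eq:
  assumes t: "Re t > 0"
  shows "u_m t m l \<mu> = int_const t m l \<mu> *
     (\<Sum>r\<le>m. int_coeff t m l \<mu> r / (\<Prod>i<r. 1 - qpow t (4 * of_nat m - 2 * of_nat i)))"
proof -
  obtain N D where ND: "is_continuation t m l \<mu> N D" "poly D (qpow t (of_nat m)) \<noteq> 0"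
    "poly N (qpow t (of_nat m)) / poly D (qpow t (of_nat m)) = int_const t m l \<mu> *
       (\<Sum>r\<le>m. int_coeff t m l \<mu> r / (\<Prod>i<r. 1 - qpow t (4 * of_nat m - 2 * of_nat i)))"
    using continuation_exists[OF t] .
  let ?x = "qpow t (of_nat m)"
  have "poly N' ?x / poly D' ?x = poly N ?x / poly D ?x"
    if "is_continuation t m l \<mu> N' D'" "poly D' ?x \<noteq> 0" for N' D'
  proof -
    have "poly (N' * D) ?x = poly (N * D') ?x" using continuation_unique[OF that(1) ND(1)] by simp
    then show ?thesis using that(2) ND(2) by (simp add: divide_simps)
  qed
  then show ?thesis unfolding u_m_def ND(3)[symmetric] using ND(1,2) by (intro the_equality) blast+
qed


subsection \<open>Modules over the quantum group\<close>

lemma bvec_nonzero [simp]: "bvec i \<noteq> 0"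
  by (metis bvec_def lookup_single_eq lookup_zero zero_neq_one)

lemma lookup_bvec: "Poly_Mapping.lookup (bvec i) j = (if i = j then 1 else 0)"
  by (simp add: bvec_def lookup_single when_def)

lemma lin_sum: "lin f (sum h A) = (\<Sum>a\<in>A. lin f (h a))"
  by (induction A rule: infinite_finite_induct) (simp_all add: lin_add)

lemma lin_minus: "lin f (x - y) = lin f x - lin f y"
proof -
  have "x - y = x + vscale (- 1) y" by (rule poly_mapping_eqI) (simp add: lookup_add lookup_minus)
  then have "lin f (x - y) = lin f x + vscale (- 1) (lin f y)" by (simp only: lin_add lin_vscale)
  also have "\<dots> = lin f x - lin f y" by (rule poly_mapping_eqI) (simp add: lookup_add lookup_minus)
  finally show ?thesis .
qed

lemma lin_compose: "lin f (lin g x) = lin (\<lambda>i. lin f (g i)) x"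
  unfolding lin_def[of g] lin_def[of "\<lambda>i. lin f (g i)"] lin_sum lin_vscale ..

lemma lin_cong: "(\<And>i. i \<in> Poly_Mapping.keys x \<Longrightarrow> f i = g i) \<Longrightarrow> lin f x = lin g x"
  unfolding lin_def by (rule sum.cong) auto

lemma lin_bvec_id [simp]: "lin bvec x = x"
  unfolding lin_def by (rule poly_mapping_sum_bvec)

lemma vscale_add_right: "vscale a (x + y) = vscale a x + vscale a y"
  by (rule poly_mapping_eqI) (simp add: lookup_add algebra_simps)

lemma vscale_add_left: "vscale (a + b) x = vscale a x + vscale b x"
  by (rule poly_mapping_eqI) (simp add: lookup_add algebra_simps)

lemma lin_fun_add: "lin (\<lambda>i. f i + g i) x = lin f x + lin g x"
  by (simp add: lin_def vscale_add_right sum.distrib)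

lemma lin_fun_diff: "lin (\<lambda>i. f i - g i) x = lin f x - lin g x"
  by (simp add: lin_def vscale_diff_right sum_subtractf)

lemma lin_fun_vscale: "lin (\<lambda>i. vscale c (f i)) x = vscale c (lin f x)"
  by (simp add: lin_def vscale_sum mult.commute)

lemma vscale_eq_0_iff [simp]: "vscale c x = 0 \<longleftrightarrow> c = 0 \<or> x = 0"
proof
  assume "vscale c x = 0"
  then have "vscale (1 / c) (vscale c x) = 0" by simp
  then show "c = 0 \<or> x = 0" by (cases "c = 0") auto
qed auto

lemma zero_in_space [simp]: "0 \<in> space_of M"
  by (simp add: space_of_def)

lemma add_in_space: "x \<in> space_of M \<Longrightarrow> y \<in> space_of M \<Longrightarrow> x + y \<in> space_of M"
  unfolding space_of_def using keys_add[of x y] by blast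

lemma vscale_in_space: "x \<in> space_of M \<Longrightarrow> vscale c x \<in> space_of M"
  by (auto simp: space_of_def in_keys_iff subset_iff)

lemma sum_in_space: "(\<And>a. a \<in> A \<Longrightarrow> h a \<in> space_of M) \<Longrightarrow> sum h A \<in> space_of M"
  by (induction A rule: infinite_finite_induct) (auto intro: add_in_space)

lemma lin_in_space:
  assumes "\<And>i. i \<in> idx M \<Longrightarrow> f i \<in> space_of N" "x \<in> space_of M"
  shows "lin f x \<in> space_of N"
  unfolding lin_def by (intro sum_in_space vscale_in_space assms(1)) (use assms(2) in \<open>auto simp: space_of_def\<close>)

lemma subspaceI_vscale:
  assumes "0 \<in> W" "\<And>x y. x \<in> W \<Longrightarrow> y \<in> W \<Longrightarrow> x + y \<in> W" "\<And>c x. x \<in> W \<Longrightarrow> vscale c x \<in> W"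
  shows "module.subspace vscale W"
  using assms unfolding module.subspace_def[OF module_vscale] by blast

lemma qpow_0 [simp]: "qpow t 0 = 1"
  by (simp add: qpow_def)

lemma qpow_neq_1: "Re s \<noteq> 0 \<Longrightarrow> r \<noteq> 0 \<Longrightarrow> qpow s (of_real r) \<noteq> 1"
proof
  assume "Re s \<noteq> 0" "r \<noteq> 0" "qpow s (of_real r) = 1"
  then have "norm (qpow s (of_real r)) = 1" by simp
  then show False using \<open>Re s \<noteq> 0\<close> \<open>r \<noteq> 0\<close> by (simp add: qpow_def)
qed

lemma qpow_1_diff_nonzero: "Re s \<noteq> 0 \<Longrightarrow> qpow s 1 - qpow s (- 1) \<noteq> 0"
proof
  assume s: "Re s \<noteq> 0" and "qpow s 1 - qpow s (- 1) = 0"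
  then have "qpow s 1 * qpow s 1 = qpow s 1 * qpow s (- 1)" by simp
  then have "qpow s (of_real 2) = 1" unfolding qpow_add by simp
  with qpow_neq_1[OF s, of 2] show False by simp
qed

lemma qnum_1 [simp]: "Re s \<noteq> 0 \<Longrightarrow> qnum s 1 = 1"
  using qpow_1_diff_nonzero by (simp add: qnum_def)

text \<open>Instantiated for V, for the factors of a tensor product and for the tensor product
  itself. The parameter \<open>s\<close> will be -t; the sign of its real part matters only for the
  convergence of the trace series.\<close>

locale uq_rep =
  fixes s :: complex and M :: "'i uq_module"
  assumes s: "Re s \<noteq> 0" and rep: "is_uq_module s M"
begin

abbreviation "E \<equiv> lin (opE M)"
abbreviation "F \<equiv> lin (opF M)"
abbreviation "K \<equiv> lin (opK M)"
abbreviation "Ki \<equiv> lin (opKi M)"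
abbreviation "W \<equiv> weight_space s M"

lemma op_in_space:
  assumes "x \<in> space_of M"
  shows "E x \<in> space_of M" "F x \<in> space_of M" "K x \<in> space_of M" "Ki x \<in> space_of M"
  using rep assms by (auto intro!: lin_in_space[of M] simp: is_uq_module_def)

lemma op_relations:
  assumes x: "x \<in> space_of M"
  shows "K (Ki x) = x" "Ki (K x) = x" "K (E (Ki x)) = vscale (qpow s 2) (E x)"
    "K (F (Ki x)) = vscale (qpow s (- 2)) (F x)"
    "E (F x) = F (E x) + vscale (1 / (qpow s 1 - qpow s (- 1))) (K x - Ki x)"
proof -
  have i: "i \<in> idx M" if "i \<in> Poly_Mapping.keys x" for i using x that by (auto simp: space_of_def)
  have "K (Ki x) = lin bvec x" unfolding lin_compose
    by (rule lin_cong) (use rep i in \<open>auto simp: is_uq_module_def\<close>)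
  then show "K (Ki x) = x" by simp
  have "Ki (K x) = lin bvec x" unfolding lin_compose
    by (rule lin_cong) (use rep i in \<open>auto simp: is_uq_module_def\<close>)
  then show "Ki (K x) = x" by simp
  have "K (E (Ki x)) = lin (\<lambda>i. vscale (qpow s 2) (opE M i)) x" unfolding lin_compose[of "opE M" "opKi M" x] lin_compose[of "opK M" "\<lambda>i. E (opKi M i)" x]
    by (rule lin_cong) (use rep i in \<open>auto simp: is_uq_module_def\<close>)
  then show "K (E (Ki x)) = vscale (qpow s 2) (E x)" by (simp add: lin_fun_vscale)
  have "K (F (Ki x)) = lin (\<lambda>i. vscale (qpow s (- 2)) (opF M i)) x" unfolding lin_compose[of "opF M" "opKi M" x] lin_compose[of "opK M" "\<lambda>i. F (opKi M i)" x]
    by (rule lin_cong) (use rep i in \<open>auto simp: is_uq_module_def\<close>)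
  then show "K (F (Ki x)) = vscale (qpow s (- 2)) (F x)" by (simp add: lin_fun_vscale)
  have "E (F x) - F (E x) = lin (\<lambda>i. vscale (1 / (qpow s 1 - qpow s (- 1))) (opK M i - opKi M i)) x"
    unfolding lin_compose lin_fun_diff[symmetric]
    by (rule lin_cong) (use rep i in \<open>auto simp: is_uq_module_def\<close>)
  then show "E (F x) = F (E x) + vscale (1 / (qpow s 1 - qpow s (- 1))) (K x - Ki x)"
    by (simp add: lin_fun_vscale lin_fun_diff algebra_simps)
qed

lemma K_commute:
  assumes x: "x \<in> space_of M"
  shows "K (E x) = vscale (qpow s 2) (E (K x))" "Ki (E x) = vscale (qpow s (- 2)) (E (Ki x))"
    "K (F x) = vscale (qpow s (- 2)) (F (K x))" "Ki (F x) = vscale (qpow s 2) (F (Ki x))"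
proof -
  show "K (E x) = vscale (qpow s 2) (E (K x))" "K (F x) = vscale (qpow s (- 2)) (F (K x))"
    using op_relations(2,3,4)[of "K x"] op_relations(2)[OF x] op_in_space(3)[OF x] by simp_all
  have "vscale (qpow s 2) (Ki (E x)) = E (Ki x)"
    using arg_cong[OF op_relations(3)[OF x], of Ki] op_relations(2)[of "E (Ki x)"] op_in_space x by simp
  from arg_cong[OF this, of "vscale (qpow s (- 2))"]
  show "Ki (E x) = vscale (qpow s (- 2)) (E (Ki x))" by (simp add: qpow_add)
  have "vscale (qpow s (- 2)) (Ki (F x)) = F (Ki x)"
    using arg_cong[OF op_relations(4)[OF x], of Ki] op_relations(2)[of "F (Ki x)"] op_in_space x by simp
  from arg_cong[OF this, of "vscale (qpow s 2)"]
  show "Ki (F x) = vscale (qpow s 2) (F (Ki x))" by (simp add: qpow_add)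
qed

lemma weight_space_iff: "x \<in> W \<nu> \<longleftrightarrow> x \<in> space_of M \<and> K x = vscale (qpow s \<nu>) x"
  by (simp add: weight_space_def)

lemma weight_Ki: "x \<in> W \<nu> \<Longrightarrow> Ki x = vscale (qpow s (- \<nu>)) x"
proof -
  assume x: "x \<in> W \<nu>"
  then have "x = vscale (qpow s \<nu>) (Ki x)" using op_relations(2)[of x] by (simp add: weight_space_iff)
  from arg_cong[OF this, of "vscale (qpow s (- \<nu>))"] show ?thesis by simp
qed

lemma weight_E: "x \<in> W \<nu> \<Longrightarrow> E x \<in> W (\<nu> + 2)"
  by (simp add: weight_space_iff op_in_space K_commute qpow_add add.commute)

lemma weight_F: "x \<in> W \<nu> \<Longrightarrow> F x \<in> W (\<nu> - 2)"
  by (simp add: weight_space_iff op_in_space K_commute qpow_add)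

lemma weight_E_power: "x \<in> W \<nu> \<Longrightarrow> (E ^^ n) x \<in> W (\<nu> + 2 * of_nat n)"
proof (induction n)
  case (Suc n)
  then show ?case using weight_E[of "(E ^^ n) x" "\<nu> + 2 * of_nat n"] by (simp add: algebra_simps)
qed simp

lemma weight_F_power: "x \<in> W \<nu> \<Longrightarrow> (F ^^ n) x \<in> W (\<nu> - 2 * of_nat n)"
proof (induction n)
  case (Suc n)
  then show ?case using weight_F[of "(F ^^ n) x" "\<nu> - 2 * of_nat n"] by (simp add: algebra_simps)
qed simp

lemma weight_EF: "x \<in> W \<nu> \<Longrightarrow> E (F x) = F (E x) + vscale (qnum s \<nu>) x"
  using op_relations(5)[of x] weight_Ki[of x \<nu>] KmKi[of s \<nu> x] by (simp add: weight_space_iff)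

text \<open>The coefficients are those in \<open>opE\<close> of the Verma module. Hence a vector of
  weight mu killed by E determines a map out of that module.\<close>

lemma E_F_power:
  assumes "x \<in> W \<nu>" "E x = 0"
  shows "E ((F ^^ Suc n) x) = vscale (qnum s (of_nat (Suc n)) * qnum s (\<nu> - of_nat n)) ((F ^^ n) x)"
proof (induction n)
  case 0
  show ?case using weight_EF[OF assms(1)] assms(2) s by simp
next
  case (Suc n)
  have "E ((F ^^ Suc (Suc n)) x) = F (E ((F ^^ Suc n) x)) + vscale (qnum s (\<nu> - 2 * of_nat (Suc n))) ((F ^^ Suc n) x)"
    using weight_EF[OF weight_F_power[OF assms(1), of "Suc n"]] by simp
  also have "F (E ((F ^^ Suc n) x)) = vscale (qnum s (of_nat (Suc n)) * qnum s (\<nu> - of_nat (Suc n) + 1)) ((F ^^ Suc n) x)"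
  proof -
    have "\<nu> - of_nat (Suc n) + 1 = \<nu> - of_nat n" by simp
    then show ?thesis unfolding Suc by simp
  qed
  finally have "E ((F ^^ Suc (Suc n)) x) = vscale (qnum s (of_nat (Suc n)) * qnum s (\<nu> - of_nat (Suc n) + 1)
     + qnum s (\<nu> - 2 * of_nat (Suc n))) ((F ^^ Suc n) x)"
    by (simp only: vscale_add_left)
  also have "qnum s (of_nat (Suc n)) * qnum s (\<nu> - of_nat (Suc n) + 1) + qnum s (\<nu> - 2 * of_nat (Suc n))
     = qnum s (of_nat (Suc (Suc n))) * qnum s (\<nu> - of_nat (Suc (Suc n)) + 1)"
    using verma_EF[OF s, of "Suc n" \<nu>] by (simp only: diff_eq_eq add.commute)
  also have "\<nu> - of_nat (Suc (Suc n)) + 1 = \<nu> - of_nat (Suc n)" by simp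
  finally show ?case .
qed

lemma E_power_F_power:
  assumes "x \<in> W \<nu>" "E x = 0"
  shows "(E ^^ n) ((F ^^ n) x) = vscale (\<Prod>k<n. qnum s (of_nat (Suc k)) * qnum s (\<nu> - of_nat k)) x"
proof (induction n)
  case (Suc n)
  have hom: "(E ^^ n) (vscale c y) = vscale c ((E ^^ n) y)" for c y by (induction n) auto
  have "(E ^^ Suc n) ((F ^^ Suc n) x) = (E ^^ n) (E ((F ^^ Suc n) x))" by (simp add: funpow_swap1)
  also have "\<dots> = vscale (qnum s (of_nat (Suc n)) * qnum s (\<nu> - of_nat n)) ((E ^^ n) ((F ^^ n) x))"
    unfolding E_F_power[OF assms] hom ..
  finally show ?case unfolding Suc by (simp add: mult_ac)
qed simp

text \<open>The weights q and 1/q of K and its inverse compensate for the commutator of E and F,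
  which makes this operator central.\<close>

definition casimir :: "('i \<Rightarrow>\<^sub>0 complex) \<Rightarrow> ('i \<Rightarrow>\<^sub>0 complex)"
  where "casimir x = F (E x) + vscale (1 / (qpow s 1 - qpow s (- 1))\<^sup>2)
     (vscale (qpow s 1) (K x) + vscale (qpow s (- 1)) (Ki x))"

lemma casimir_commute:
  assumes x: "x \<in> space_of M"
  shows "casimir (E x) = E (casimir x)" "casimir (F x) = F (casimir x)"
    "casimir (K x) = K (casimir x)" "casimir (Ki x) = Ki (casimir x)"
proof -
  define q q' where "q = qpow s 1" and "q' = qpow s (- 1)"
  have qq: "q * q' = 1" "q' * q = 1" by (simp_all add: q_def q'_def)
  have q2: "qpow s 2 = q * q" "qpow s (- 2) = q' * q'" by (simp_all add: q_def q'_def qpow_add)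
  have d: "q - q' \<noteq> 0" unfolding q_def q'_def by (rule qpow_1_diff_nonzero[OF s])
  define c where "c = 1 / (q - q')"
  have c: "1 / (q - q')\<^sup>2 = c * c" "c * (q - q') = 1" using d by (simp_all add: c_def power2_eq_square)
  note sp = op_in_space
  note defs = casimir_def q_def[symmetric] q'_def[symmetric] c(1) c_def[symmetric]
  have EF: "E (F y) = F (E y) + vscale c (K y - Ki y)" if "y \<in> space_of M" for y
    using op_relations(5)[OF that] unfolding defs .
  show "casimir (E x) = E (casimir x)"
  proof (rule poly_mapping_eqI)
    fix k
    \<comment> \<open>Comparing one coordinate turns the operator identity into a scalar one in
      \<open>B\<close>, \<open>C\<close>, \<open>G\<close>, which follows from c (q - q') = 1 and q
      q' = 1.\<close>
    define B C G where "B = Poly_Mapping.lookup (E (K x)) k" and "C = Poly_Mapping.lookup (E (Ki x)) k"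
      and "G = Poly_Mapping.lookup (E (F (E x))) k"
    have "F (E (E x)) = E (F (E x)) - vscale c (K (E x) - Ki (E x))"
      using EF[of "E x"] sp x by simp
    then have "Poly_Mapping.lookup (casimir (E x)) k = G - c * (q * q * B - q' * q' * C) + c * c * (q * (q * q * B) + q' * (q' * q' * C))"
      unfolding defs K_commute[OF x] q2 B_def C_def G_def by (simp add: lookup_add lookup_minus)
    moreover have "Poly_Mapping.lookup (E (casimir x)) k = G + c * c * (q * B + q' * C)"
      unfolding defs B_def C_def G_def by (simp add: lin_add lookup_add)
    moreover have "G - c * (q * q * B - q' * q' * C) + c * c * (q * (q * q * B) + q' * (q' * q' * C)) = G + c * c * (q * B + q' * C)"
      using c(2) qq by algebra
    ultimately show "Poly_Mapping.lookup (casimir (E x)) k = Poly_Mapping.lookup (E (casimir x)) k" by simp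
  qed
  show "casimir (F x) = F (casimir x)"
  proof (rule poly_mapping_eqI)
    fix k
    define B C G where "B = Poly_Mapping.lookup (F (K x)) k" and "C = Poly_Mapping.lookup (F (Ki x)) k"
      and "G = Poly_Mapping.lookup (F (F (E x))) k"
    have "Poly_Mapping.lookup (casimir (F x)) k = G + c * (B - C) + c * c * (q * (q' * q' * B) + q' * (q * q * C))"
      unfolding defs K_commute[OF x] q2 EF[OF x] B_def C_def G_def by (simp add: lin_add lin_minus lookup_add lookup_minus)
    moreover have "Poly_Mapping.lookup (F (casimir x)) k = G + c * c * (q * B + q' * C)"
      unfolding defs B_def C_def G_def by (simp add: lin_add lookup_add)
    moreover have "G + c * (B - C) + c * c * (q * (q' * q' * B) + q' * (q * q * C)) = G + c * c * (q * B + q' * C)"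
      using c(2) qq by algebra
    ultimately show "Poly_Mapping.lookup (casimir (F x)) k = Poly_Mapping.lookup (F (casimir x)) k" by simp
  qed
  show "casimir (K x) = K (casimir x)"
  proof -
    have "K (F (E x)) = F (E (K x))"
      using K_commute(3)[of "E x"] K_commute(1)[OF x] sp x by (simp add: qpow_add)
    then show ?thesis unfolding defs using op_relations(1,2)[OF x] by (simp add: lin_add)
  qed
  show "casimir (Ki x) = Ki (casimir x)"
  proof -
    have "Ki (F (E x)) = F (E (Ki x))"
      using K_commute(4)[of "E x"] K_commute(2)[OF x] sp x by (simp add: qpow_add)
    then show ?thesis unfolding defs using op_relations(1,2)[OF x] by (simp add: lin_add)
  qed
qed

lemma casimir_linear: "casimir (x + y) = casimir x + casimir y" "casimir (vscale a x) = vscale a (casimir x)" "casimir 0 = 0"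
  by (simp_all add: casimir_def lin_add vscale_add_right add_ac mult_ac)

lemma casimir_weight:
  assumes "x \<in> W \<nu>"
  shows "casimir x = F (E x) + vscale ((qpow s (\<nu> + 1) + qpow s (- \<nu> - 1)) / (qpow s 1 - qpow s (- 1))\<^sup>2) x"
proof -
  have "K x = vscale (qpow s \<nu>) x" using assms by (simp add: weight_space_iff)
  moreover have "qpow s (\<nu> + 1) = qpow s 1 * qpow s \<nu>" "qpow s (- \<nu> - 1) = qpow s (- 1) * qpow s (- \<nu>)"
    unfolding qpow_add by (rule arg_cong[of _ _ "qpow s"], simp)+
  ultimately show ?thesis unfolding casimir_def weight_Ki[OF assms]
    by (simp add: vscale_add_left[symmetric] add_divide_distrib)
qed

end


text \<open>Neither finite dimension nor a basis of weight vectors is part of the assumptions; what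
  the trace computation requires of V is derived from irreducibility.\<close>

locale spin_rep = uq_rep s M for s :: complex and M :: "'i uq_module" +
  fixes m :: nat
  assumes irreducible: "is_irreducible M" and highest_weight: "has_highest_weight s M (2 * of_nat m)"
begin

text \<open>The source of all global statements about V: a linear condition that is stable under the
  generators and holds at the highest weight vector holds everywhere.\<close>

lemma submodule_eq_space:
  assumes "is_submodule M U" "v \<in> U" "v \<noteq> 0"
  shows "U = space_of M"
  using irreducible assms unfolding is_irreducible_def by blast

definition casimir_value :: complex
  where "casimir_value = (qpow s (2 * of_nat m + 1) + qpow s (- (2 * of_nat m) - 1)) / (qpow s 1 - qpow s (- 1))\<^sup>2"

lemma casimir_scalar:
  assumes "x \<in> space_of M"
  shows "casimir x = vscale casimir_value x"
proof -
  obtain v where v: "v \<in> W (2 * of_nat m)" "v \<noteq> 0" "E v = 0"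
    using highest_weight unfolding has_highest_weight_def by blast
  define U where "U = {x \<in> space_of M. casimir x = vscale casimir_value x}"
  have "U = space_of M"
  proof (rule submodule_eq_space)
    show "is_submodule M U"
      unfolding is_submodule_def
    proof (intro conjI ballI)
      show "module.subspace vscale U"
        by (rule subspaceI_vscale) (auto simp: U_def casimir_linear add_in_space vscale_in_space vscale_add_right mult.commute)
    qed (auto simp: U_def op_in_space casimir_commute)
    show "v \<in> U"
      using v casimir_weight[OF v(1)] by (simp add: U_def casimir_value_def weight_space_iff)
  qed fact
  then show ?thesis using assms unfolding U_def by blast
qed

text \<open>F E is the Casimir scalar minus the part of the Casimir element that the weight
  determines. With a = q^m and b = q^k the difference factors as (a/b - b/a) (a b q - 1/(a b q)), up
  to the common denominator.\<close>

lemma F_E_weight: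
  assumes u: "u \<in> W (2 * of_nat k)"
  shows "F (E u) = vscale (qnum s (of_nat m - of_nat k) * qnum s (of_nat m + of_nat k + 1)) u"
proof -
  define a b where "a = qpow s (of_nat m)" and "b = qpow s (of_nat k)"
  define q where "q = qpow s 1"
  have nz: "a \<noteq> 0" "b \<noteq> 0" "q \<noteq> 0" by (simp_all add: a_def b_def q_def qpow_def)
  have e: "qpow s (2 * of_nat m + 1) = a * a * q" "qpow s (- (2 * of_nat m) - 1) = 1 / (a * a * q)"
    "qpow s (2 * of_nat k + 1) = b * b * q" "qpow s (- (2 * of_nat k) - 1) = 1 / (b * b * q)"
    "qpow s (of_nat m - of_nat k) = a / b" "qpow s (- (of_nat m - of_nat k)) = b / a"
    "qpow s (of_nat m + of_nat k + 1) = a * b * q" "qpow s (- (of_nat m + of_nat k + 1)) = 1 / (a * b * q)"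
    unfolding a_def b_def q_def qpow_def by (simp_all add: field_simps flip: exp_add exp_diff)
  have d: "q - qpow s (- 1) \<noteq> 0" unfolding q_def by (rule qpow_1_diff_nonzero[OF s])
  have "casimir u = F (E u) + vscale ((qpow s (2 * of_nat k + 1) + qpow s (- (2 * of_nat k) - 1)) / (qpow s 1 - qpow s (- 1))\<^sup>2) u"
    using casimir_weight[OF u] by simp
  then have "F (E u) = vscale casimir_value u - vscale ((qpow s (2 * of_nat k + 1) + qpow s (- (2 * of_nat k) - 1)) / (qpow s 1 - qpow s (- 1))\<^sup>2) u"
    unfolding eq_diff_eq using casimir_scalar[of u] u by (simp add: weight_space_iff)
  also have "\<dots> = vscale (casimir_value - (qpow s (2 * of_nat k + 1) + qpow s (- (2 * of_nat k) - 1)) / (qpow s 1 - qpow s (- 1))\<^sup>2) u"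
    by (simp only: vscale_diff_left)
  also have "casimir_value - (qpow s (2 * of_nat k + 1) + qpow s (- (2 * of_nat k) - 1)) / (qpow s 1 - qpow s (- 1))\<^sup>2
    = qnum s (of_nat m - of_nat k) * qnum s (of_nat m + of_nat k + 1)"
  proof -
    have "a * a * q + 1 / (a * a * q) - (b * b * q + 1 / (b * b * q)) = (a / b - b / a) * (a * b * q - 1 / (a * b * q))"
      using nz by (simp add: field_simps)
    then show ?thesis unfolding casimir_value_def qnum_def e q_def[symmetric]
      by (simp add: power2_eq_square diff_divide_distrib[symmetric])
  qed
  finally show ?thesis .
qed

text \<open>Makes the singular vector below a finite sum. The vectors killed by some power of E form
  a submodule that contains the highest weight vector.\<close>

lemma E_nilpotent:
  assumes "x \<in> space_of M"
  shows "\<exists>n. (E ^^ n) x = 0"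
proof -
  obtain v where v: "v \<in> W (2 * of_nat m)" "v \<noteq> 0" "E v = 0"
    using highest_weight unfolding has_highest_weight_def by blast
  have sp: "(E ^^ n) x \<in> space_of M" if "x \<in> space_of M" for n x
    using that by (induction n) (auto intro: op_in_space)
  have z: "(E ^^ n) 0 = 0" for n by (induction n) auto
  have add: "(E ^^ n) (x + y) = (E ^^ n) x + (E ^^ n) y" for n x y
    by (induction n) (auto simp: lin_add)
  have scale: "(E ^^ n) (vscale c x) = vscale c ((E ^^ n) x)" for n c x
    by (induction n) auto
  have mono: "(E ^^ (n + k)) x = 0" if "(E ^^ n) x = 0" for n k x
    using that z by (simp add: add.commute[of n] funpow_add)
  have K: "(E ^^ n) (K x) = vscale (qpow s (- 2 * of_nat n)) (K ((E ^^ n) x))" if x: "x \<in> space_of M" for n x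
  proof (induction n)
    case (Suc n)
    have "E (K y) = vscale (qpow s (- 2)) (K (E y))" if "y \<in> space_of M" for y
      using arg_cong[OF K_commute(1)[OF that], of "vscale (qpow s (- 2))"] by simp
    from this[OF sp[OF x, of n]] show ?case by (simp add: Suc qpow_add algebra_simps)
  qed simp
  have Ki: "(E ^^ n) (Ki x) = vscale (qpow s (2 * of_nat n)) (Ki ((E ^^ n) x))" if x: "x \<in> space_of M" for n x
  proof (induction n)
    case (Suc n)
    have "E (Ki y) = vscale (qpow s 2) (Ki (E y))" if "y \<in> space_of M" for y
      using arg_cong[OF K_commute(2)[OF that], of "vscale (qpow s 2)"] by simp
    from this[OF sp[OF x, of n]] show ?case by (simp add: Suc qpow_add algebra_simps)
  qed simp
  \<comment> \<open>One E is moved past F. This leaves F (E x), covered by the induction hypothesis,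
    and multiples of K x and Ki x, which are killed by the same power of E as x.\<close>
  have F: "(E ^^ Suc n) (F x) = 0" if "x \<in> space_of M" "(E ^^ n) x = 0" for n x
    using that
  proof (induction n arbitrary: x)
    case (Suc n)
    have "(E ^^ Suc (Suc n)) (F x) = (E ^^ Suc n) (E (F x))" by (simp add: funpow_swap1)
    also have "E (F x) = F (E x) + vscale (1 / (qpow s 1 - qpow s (- 1))) (K x + vscale (- 1) (Ki x))"
      unfolding op_relations(5)[OF Suc.prems(1)]
      by (rule poly_mapping_eqI) (simp add: lookup_add lookup_minus)
    also have "(E ^^ Suc n) \<dots> = 0"
      using Suc.IH[of "E x"] Suc.prems K[OF Suc.prems(1), of "Suc n"] Ki[OF Suc.prems(1), of "Suc n"] op_in_space
      unfolding add scale by (simp add: funpow_swap1)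
    finally show ?case .
  qed simp
  define U where "U = {x \<in> space_of M. \<exists>n. (E ^^ n) x = 0}"
  have "U = space_of M"
  proof (rule submodule_eq_space)
    show "is_submodule M U"
      unfolding is_submodule_def
    proof (intro conjI ballI)
      show "module.subspace vscale U"
      proof (rule subspaceI_vscale)
        show "0 \<in> U" by (auto simp: U_def z)
        fix x y assume "x \<in> U" "y \<in> U"
        then obtain n k where "x \<in> space_of M" "y \<in> space_of M" "(E ^^ n) x = 0" "(E ^^ k) y = 0"
          unfolding U_def by blast
        then have "x + y \<in> space_of M" "(E ^^ (n + k)) (x + y) = 0"
          using mono[of n x k] mono[of k y n] by (auto simp: add add_in_space add.commute)
        then show "x + y \<in> U" unfolding U_def by blast
      qed (auto simp: U_def scale vscale_in_space)
      fix x assume "x \<in> U"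
      then obtain n where x: "x \<in> space_of M" and n: "(E ^^ n) x = 0" unfolding U_def by blast
      have "(E ^^ n) (E x) = 0" using mono[OF n, of 1] by (simp add: funpow_swap1)
      moreover have "(E ^^ Suc n) (F x) = 0" by (rule F[OF x n])
      moreover have "(E ^^ n) (K x) = 0" "(E ^^ n) (Ki x) = 0" using K[OF x, of n] Ki[OF x, of n] n by simp_all
      ultimately show "E x \<in> U" "F x \<in> U" "K x \<in> U" "Ki x \<in> U"
        unfolding U_def using op_in_space[OF x] by blast+
    qed (auto simp: U_def)
    have "(E ^^ 1) v = 0" using v by simp
    then show "v \<in> U" using v(1) unfolding U_def weight_space_iff by blast
  qed fact
  then show ?thesis using assms unfolding U_def by blast
qed

lemma F_power_E_power:
  assumes "u \<in> W 0"
  shows "(F ^^ k) ((E ^^ k) u) = vscale (\<Prod>i<k. qnum s (of_nat m - of_nat i) * qnum s (of_nat m + of_nat i + 1)) u"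
proof (induction k)
  case (Suc k)
  have hom: "(F ^^ n) (vscale c y) = vscale c ((F ^^ n) y)" for n c y by (induction n) auto
  have "(E ^^ k) u \<in> W (2 * of_nat k)" using weight_E_power[OF assms, of k] by simp
  from F_E_weight[OF this]
  have "(F ^^ Suc k) ((E ^^ Suc k) u) =
     vscale (qnum s (of_nat m - of_nat k) * qnum s (of_nat m + of_nat k + 1)) ((F ^^ k) ((E ^^ k) u))"
    by (simp add: funpow_swap1 hom)
  then show ?case unfolding Suc by (simp add: mult_ac)
qed simp

text \<open>Without such a vector the condition on trace functions would be vacuous and
  \<open>Psi\<close> undetermined. For the highest weight vector v, E^m F^m v is v times the product
  of the [k+1] [2m-k] with k < m, so F^m v is not 0.\<close>

lemma zero_weight_vector: "\<exists>w\<in>W 0. w \<noteq> 0"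
proof -
  obtain v where v: "v \<in> W (2 * of_nat m)" "v \<noteq> 0" "E v = 0"
    using highest_weight unfolding has_highest_weight_def by blast
  have "(F ^^ m) v \<in> W 0" using weight_F_power[OF v(1), of m] by simp
  moreover have "(F ^^ m) v \<noteq> 0"
  proof
    assume 0: "(F ^^ m) v = 0"
    have "(E ^^ n) 0 = 0" for n by (induction n) auto
    then have "vscale (\<Prod>k<m. qnum s (of_nat (Suc k)) * qnum s (2 * of_nat m - of_nat k)) v = 0"
      using E_power_F_power[OF v(1,3), of m] 0 by simp
    then obtain k where "k < m" and *: "qnum s (of_nat (Suc k)) * qnum s (2 * of_nat m - of_nat k) = 0"
      using v(2) by auto
    have "2 * of_nat m - of_nat k = (of_nat (2 * m - k) :: complex)" using \<open>k < m\<close> by (simp add: of_nat_diff)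
    moreover have "0 < 2 * m - k" using \<open>k < m\<close> by simp
    ultimately have "qnum s (2 * of_nat m - of_nat k) \<noteq> 0" using qnum_nonzero[OF s, of "2 * m - k"] by metis
    moreover have "qnum s (of_nat (Suc k)) \<noteq> 0" by (rule qnum_nonzero[OF s]) simp
    ultimately show False using * by (metis mult_eq_0_iff)
  qed
  ultimately show ?thesis by blast
qed

end

subsection \<open>Tensor products with a Verma module\<close>

lemma lookup_tens: "Poly_Mapping.lookup (tens x y) (i, j) = Poly_Mapping.lookup x i * Poly_Mapping.lookup y j"
proof -
  have "Poly_Mapping.lookup (tens x y) (i, j)
     = (\<Sum>a\<in>Poly_Mapping.keys x. \<Sum>b\<in>Poly_Mapping.keys y. (if a = i then if b = j then Poly_Mapping.lookup x a * Poly_Mapping.lookup y b else 0 else 0))"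
    unfolding tens_def lookup_sum by (intro sum.cong refl) (simp add: lookup_single when_def)
  also have "\<dots> = (\<Sum>a\<in>Poly_Mapping.keys x. if a = i then (\<Sum>b\<in>Poly_Mapping.keys y. if b = j then Poly_Mapping.lookup x a * Poly_Mapping.lookup y b else 0) else 0)"
    by (intro sum.cong refl) auto
  also have "\<dots> = Poly_Mapping.lookup x i * Poly_Mapping.lookup y j"
    by (simp add: in_keys_iff)
  finally show ?thesis .
qed

lemma tens_eqI:
  assumes "\<And>i j. Poly_Mapping.lookup X (i, j) = Poly_Mapping.lookup Y (i, j)"
  shows "X = Y"
proof (rule poly_mapping_eqI)
  show "Poly_Mapping.lookup X k = Poly_Mapping.lookup Y k" for k using assms by (cases k) simp
qed

lemma tens_bilinear:
  "tens (x + x') y = tens x y + tens x' y" "tens x (y + y') = tens x y + tens x y'"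
  "tens (vscale c x) y = vscale c (tens x y)" "tens x (vscale c y) = vscale c (tens x y)"
  "tens (x - x') y = tens x y - tens x' y" "tens x (y - y') = tens x y - tens x y'"
  "tens 0 y = 0" "tens x 0 = 0"
  by (auto intro!: tens_eqI simp: lookup_tens lookup_add lookup_minus algebra_simps)

lemma tens_sum: "tens (sum h A) y = (\<Sum>a\<in>A. tens (h a) y)" "tens x (sum h A) = (\<Sum>a\<in>A. tens x (h a))"
  by (induction A rule: infinite_finite_induct) (simp_all add: tens_bilinear)

lemma tens_bvec: "tens (bvec i) (bvec j) = bvec (i, j)"
  by (rule tens_eqI) (simp add: lookup_tens lookup_bvec)

lemma lin_tens: "lin (\<lambda>(i, j). tens (f i) (g j)) (tens x y) = tens (lin f x) (lin g y)"
proof -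
  have "tens x y = tens (lin bvec x) (lin bvec y)" by simp
  also have "\<dots> = (\<Sum>i\<in>Poly_Mapping.keys x. \<Sum>j\<in>Poly_Mapping.keys y.
     vscale (Poly_Mapping.lookup x i) (vscale (Poly_Mapping.lookup y j) (bvec (i, j))))"
    unfolding lin_def tens_sum(1) unfolding tens_sum(2) by (simp add: tens_bilinear tens_bvec mult.commute)
  finally have "lin (\<lambda>(i, j). tens (f i) (g j)) (tens x y) = (\<Sum>i\<in>Poly_Mapping.keys x. \<Sum>j\<in>Poly_Mapping.keys y.
     vscale (Poly_Mapping.lookup x i) (vscale (Poly_Mapping.lookup y j) (tens (f i) (g j))))"
    by (simp only: lin_sum lin_vscale lin_bvec case_prod_conv)
  also have "\<dots> = tens (lin f x) (lin g y)"
    unfolding lin_def tens_sum(1) unfolding tens_sum(2) by (simp add: tens_bilinear mult.commute)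
  finally show ?thesis .
qed

lemma lin_fun_add_split: "lin (\<lambda>(i, j). f i j + g i j) x = lin (\<lambda>(i, j). f i j) x + lin (\<lambda>(i, j). g i j) x"
  using lin_fun_add[of "case_prod f" "case_prod g" x] by (simp add: split_def)

lemma tensor_ops:
  "lin (opE (tensor_module M N)) (tens x y) = tens (lin (opE M) x) (lin (opK N) y) + tens x (lin (opE N) y)"
  "lin (opF (tensor_module M N)) (tens x y) = tens (lin (opF M) x) y + tens (lin (opKi M) x) (lin (opF N) y)"
  "lin (opK (tensor_module M N)) (tens x y) = tens (lin (opK M) x) (lin (opK N) y)"
  "lin (opKi (tensor_module M N)) (tens x y) = tens (lin (opKi M) x) (lin (opKi N) y)"
  by (simp_all add: tensor_module_def lin_fun_add_split lin_tens)

lemma tensor_basis_ops: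
  "opE (tensor_module M N) (i, j) = tens (opE M i) (opK N j) + tens (bvec i) (opE N j)"
  "opF (tensor_module M N) (i, j) = tens (opF M i) (bvec j) + tens (opKi M i) (opF N j)"
  "opK (tensor_module M N) (i, j) = tens (opK M i) (opK N j)"
  "opKi (tensor_module M N) (i, j) = tens (opKi M i) (opKi N j)"
  "idx (tensor_module M N) = idx M \<times> idx N"
  by (simp_all add: tensor_module_def)

lemma tens_in_space:
  "x \<in> space_of M \<Longrightarrow> y \<in> space_of N \<Longrightarrow> tens x y \<in> space_of (tensor_module M N)"
  by (auto simp: space_of_def tensor_module_def in_keys_iff subset_iff lookup_tens)

lemma tensor_is_uq_module:
  assumes "Re s \<noteq> 0" "is_uq_module s M" "is_uq_module s N"
  shows "is_uq_module s (tensor_module M N)"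
  unfolding is_uq_module_def
proof (intro ballI)
  interpret M: uq_rep s M by unfold_locales (use assms in auto)
  interpret N: uq_rep s N by unfold_locales (use assms in auto)
  fix k assume "k \<in> idx (tensor_module M N)"
  then obtain i j where k: "k = (i, j)" and ij: "i \<in> idx M" "j \<in> idx N" by (auto simp: tensor_module_def)
  let ?T = "tensor_module M N"
  let ?c = "1 / (qpow s 1 - qpow s (- 1))"
  have b: "bvec i \<in> space_of M" "bvec j \<in> space_of N" using ij by auto
  have sp: "opE M i \<in> space_of M" "opF M i \<in> space_of M" "opK M i \<in> space_of M" "opKi M i \<in> space_of M"
    "opE N j \<in> space_of N" "opF N j \<in> space_of N" "opK N j \<in> space_of N" "opKi N j \<in> space_of N"
    using M.op_in_space[OF b(1)] N.op_in_space[OF b(2)] by simp_all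
  have 1: "opE ?T k \<in> space_of ?T" "opF ?T k \<in> space_of ?T" "opK ?T k \<in> space_of ?T" "opKi ?T k \<in> space_of ?T"
    unfolding k tensor_basis_ops using sp b by (auto intro!: add_in_space tens_in_space)
  have 2: "lin (opK ?T) (opKi ?T k) = bvec k" "lin (opKi ?T) (opK ?T k) = bvec k"
    unfolding k tensor_basis_ops tensor_ops
    using M.op_relations(1,2)[OF b(1)] N.op_relations(1,2)[OF b(2)] by (simp_all add: tens_bvec)
  have 3: "lin (opK ?T) (lin (opE ?T) (opKi ?T k)) = vscale (qpow s 2) (opE ?T k)"
    "lin (opK ?T) (lin (opF ?T) (opKi ?T k)) = vscale (qpow s (- 2)) (opF ?T k)"
    unfolding k tensor_basis_ops tensor_ops lin_add
    using M.op_relations(1-4)[OF b(1)] N.op_relations(1-4)[OF b(2)] M.op_relations(1)[OF sp(4)]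
    by (simp_all add: tens_bilinear vscale_add_right)
  have 4: "lin (opE ?T) (opF ?T k) - lin (opF ?T) (opE ?T k) = vscale ?c (opK ?T k - opKi ?T k)"
  proof -
    \<comment> \<open>The mixed terms in the commutator of E and F cancel: moving the inverse of K
      past E and K past F produces opposite powers of q.\<close>
    have x: "tens (lin (opE M) (opKi M i)) (lin (opK N) (opF N j)) = tens (lin (opKi M) (opE M i)) (lin (opF N) (opK N j))"
      using M.K_commute(2)[OF b(1)] N.K_commute(3)[OF b(2)] by (simp add: tens_bilinear qpow_add)
    have y: "lin (opE M) (opF M i) = lin (opF M) (opE M i) + vscale ?c (opK M i - opKi M i)"
      "lin (opE N) (opF N j) = lin (opF N) (opE N j) + vscale ?c (opK N j - opKi N j)"
      using M.op_relations(5)[OF b(1)] N.op_relations(5)[OF b(2)] by simp_all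
    show ?thesis
      unfolding k tensor_basis_ops lin_add tensor_ops lin_bvec x y
      by (simp add: tens_bilinear vscale_add_right vscale_diff_right)
  qed
  show "opE ?T k \<in> space_of ?T \<and> opF ?T k \<in> space_of ?T \<and> opK ?T k \<in> space_of ?T \<and> opKi ?T k \<in> space_of ?T \<and>
    lin (opK ?T) (opKi ?T k) = bvec k \<and> lin (opKi ?T) (opK ?T k) = bvec k \<and>
    lin (opK ?T) (lin (opE ?T) (opKi ?T k)) = vscale (qpow s 2) (opE ?T k) \<and>
    lin (opK ?T) (lin (opF ?T) (opKi ?T k)) = vscale (qpow s (- 2)) (opF ?T k) \<and>
    lin (opE ?T) (opF ?T k) - lin (opF ?T) (opE ?T k) = vscale ?c (opK ?T k - opKi ?T k)"
    using 1 2 3 4 by blast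
qed


text \<open>The V-component at basis vector number \<open>k\<close> of the first factor. Written as
  a linear extension, it inherits linearity and composition from \<open>lin\<close>.\<close>

definition slice :: "'a \<Rightarrow> ('a \<times> 'b \<Rightarrow>\<^sub>0 complex) \<Rightarrow> ('b \<Rightarrow>\<^sub>0 complex)"
  where "slice k = lin (\<lambda>(i, j). if i = k then bvec j else 0)"

lemma slice_bvec: "slice k (bvec (i, j)) = (if i = k then bvec j else 0)"
  by (simp add: slice_def)

lemma lookup_slice: "Poly_Mapping.lookup (slice k X) j = Poly_Mapping.lookup X (k, j)"
proof -
  have "Poly_Mapping.lookup (slice k X) j = (\<Sum>a\<in>Poly_Mapping.keys X. if a = (k, j) then Poly_Mapping.lookup X a else 0)"
    unfolding slice_def lin_def lookup_sum
    by (intro sum.cong refl) (auto simp: lookup_bvec split: prod.splits)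
  then show ?thesis by (simp add: in_keys_iff)
qed

lemma slice_eqI: "(\<And>k. slice k X = slice k Y) \<Longrightarrow> X = Y"
  by (rule tens_eqI) (metis lookup_slice)

lemma slice_linear:
  "slice k (X + Y) = slice k X + slice k Y" "slice k (vscale c X) = vscale c (slice k X)" "slice k 0 = 0"
  "slice k (sum h A) = (\<Sum>a\<in>A. slice k (h a))"
  by (simp_all add: slice_def lin_add lin_sum)

lemma slice_lin: "slice k (lin f X) = lin (\<lambda>a. slice k (f a)) X"
  by (simp add: slice_def lin_compose)

lemma slice_tens: "slice k (tens x y) = vscale (Poly_Mapping.lookup x k) y"
  by (rule poly_mapping_eqI) (simp add: lookup_slice lookup_tens)

lemma verma_ops:
  "idx (verma t \<mu>) = UNIV"
  "opE (verma t \<mu>) k = vscale (qnum t (of_nat k) * qnum t (\<mu> - of_nat k + 1)) (bvec (k - 1))"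
  "opF (verma t \<mu>) k = bvec (Suc k)"
  "opK (verma t \<mu>) k = vscale (qpow t (\<mu> - 2 * of_nat k)) (bvec k)"
  "opKi (verma t \<mu>) k = vscale (qpow t (- (\<mu> - 2 * of_nat k))) (bvec k)"
  by (simp_all add: verma_def)

text \<open>Turns operators on the tensor product into recursions for sequences of vectors in V. In
  the formula for F the case \<open>k\<close> = 0 is separate, because k - 1 would truncate to 0
  although no basis vector is mapped to number 0.\<close>

lemma slice_tensor_ops:
  fixes V :: "'i uq_module"
  shows "slice k (lin (opE (tensor_module (verma t \<mu>) V)) X)
      = vscale (qnum t (of_nat (Suc k)) * qnum t (\<mu> - of_nat k)) (lin (opK V) (slice (Suc k) X)) + lin (opE V) (slice k X)"
    and "slice k (lin (opF (tensor_module (verma t \<mu>) V)) X)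
      = (if k = 0 then 0 else slice (k - 1) X) + vscale (qpow t (2 * of_nat k - \<mu>)) (lin (opF V) (slice k X))"
    and "slice k (lin (opK (tensor_module (verma t \<mu>) V)) X) = vscale (qpow t (\<mu> - 2 * of_nat k)) (lin (opK V) (slice k X))"
proof -
  note ops = tensor_basis_ops verma_ops slice_linear slice_tens lookup_bvec slice_bvec
  let ?T = "tensor_module (verma t \<mu>) V" and ?c = "qnum t (of_nat (Suc k)) * qnum t (\<mu> - of_nat k)"
  have E: "slice k (opE ?T (i, j)) =
     vscale ?c (lin (opK V) (slice (Suc k) (bvec (i, j)))) + lin (opE V) (slice k (bvec (i, j)))" for i j
    by (cases i) (auto simp: ops)
  have "slice k (lin (opE ?T) X) = lin (\<lambda>a. vscale ?c (lin (opK V) (slice (Suc k) (bvec a))) + lin (opE V) (slice k (bvec a))) X"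
    unfolding slice_lin using E by (intro lin_cong) (metis surj_pair)
  also have "\<dots> = vscale ?c (lin (opK V) (slice (Suc k) X)) + lin (opE V) (slice k X)"
    unfolding slice_def lin_fun_add lin_fun_vscale lin_compose lin_bvec ..
  finally show "slice k (lin (opE ?T) X) = vscale ?c (lin (opK V) (slice (Suc k) X)) + lin (opE V) (slice k X)" .
  have F: "slice k (opF (tensor_module (verma t \<mu>) V) (i, j)) =
      (if k = 0 then 0 else slice (k - 1) (bvec (i, j))) + vscale (qpow t (2 * of_nat k - \<mu>)) (lin (opF V) (slice k (bvec (i, j))))" for i j
    by (cases k) (auto simp: ops)
  have "slice k (lin (opF (tensor_module (verma t \<mu>) V)) X)
      = lin (\<lambda>a. (if k = 0 then 0 else slice (k - 1) (bvec a)) + vscale (qpow t (2 * of_nat k - \<mu>)) (lin (opF V) (slice k (bvec a)))) X"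
    unfolding slice_lin using F by (intro lin_cong) (metis surj_pair)
  also have "\<dots> = (if k = 0 then 0 else slice (k - 1) X) + vscale (qpow t (2 * of_nat k - \<mu>)) (lin (opF V) (slice k X))"
    unfolding slice_def lin_fun_add lin_fun_vscale lin_compose lin_bvec by (simp add: lin_def)
  finally show "slice k (lin (opF (tensor_module (verma t \<mu>) V)) X)
      = (if k = 0 then 0 else slice (k - 1) X) + vscale (qpow t (2 * of_nat k - \<mu>)) (lin (opF V) (slice k X))" .
  have K: "slice k (opK ?T (i, j)) = vscale (qpow t (\<mu> - 2 * of_nat k)) (lin (opK V) (slice k (bvec (i, j))))" for i j
    by (auto simp: ops)
  have "slice k (lin (opK ?T) X) = lin (\<lambda>a. vscale (qpow t (\<mu> - 2 * of_nat k)) (lin (opK V) (slice k (bvec a)))) X"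
    unfolding slice_lin using K by (intro lin_cong) (metis surj_pair)
  also have "\<dots> = vscale (qpow t (\<mu> - 2 * of_nat k)) (lin (opK V) (slice k X))"
    unfolding slice_def lin_fun_vscale lin_compose lin_bvec ..
  finally show "slice k (lin (opK ?T) X) = vscale (qpow t (\<mu> - 2 * of_nat k)) (lin (opK V) (slice k X))" .
qed

section \<open>The intertwiner, the powers of F and the diagonal components\<close>

context spin_rep
begin

text \<open>With q = exp s, slice k of E X = 0 reads [k+1] [mu-k] q^(2k+2) c_(k+1) + c_k = 0, where
  q^(2k+2) is the eigenvalue of K on E^(k+1) w. This is the solution with c_0 = 1.\<close>

definition phi_coeff :: "complex \<Rightarrow> nat \<Rightarrow> complex"
  where "phi_coeff \<mu> k = (\<Prod>i<k. - qpow s (- 2 * of_nat i - 2) / (qnum s (of_nat (Suc i)) * qnum s (\<mu> - of_nat i)))"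

lemma generic_qnum_nonzero:
  assumes "generic_weight s \<mu>"
  shows "qnum s (of_nat (Suc k)) \<noteq> 0" "qnum s (\<mu> - of_nat k) \<noteq> 0"
proof -
  show "qnum s (of_nat (Suc k)) \<noteq> 0" by (rule qnum_nonzero[OF s]) simp
  show "qnum s (\<mu> - of_nat k) \<noteq> 0"
  proof
    assume "qnum s (\<mu> - of_nat k) = 0"
    then have "qpow s (\<mu> - of_nat k) - qpow s (- (\<mu> - of_nat k)) = 0"
      using qpow_1_diff_nonzero[OF s] unfolding qnum_def by simp
    then have "qpow s (\<mu> - of_nat k) * qpow s (\<mu> - of_nat k) = qpow s (\<mu> - of_nat k) * qpow s (- (\<mu> - of_nat k))" by simp
    then have "qpow s (2 * (\<mu> - of_nat k)) = 1" unfolding qpow_add by simp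
    with assms show False unfolding generic_weight_def by blast
  qed
qed

lemma phi_coeff_Suc:
  assumes "generic_weight s \<mu>"
  shows "qnum s (of_nat (Suc k)) * qnum s (\<mu> - of_nat k) * phi_coeff \<mu> (Suc k) * qpow s (2 * of_nat k + 2) = - phi_coeff \<mu> k"
proof -
  have "qpow s (- 2 * of_nat k - 2) * qpow s (2 * of_nat k + 2) = 1" by (simp add: qpow_add)
  moreover have "x * y * (c * (- u / (x * y))) * v = - c" if "x \<noteq> 0" "y \<noteq> 0" "u * v = 1" for x y c u v :: complex
    using that by (simp add: field_simps)
  ultimately show ?thesis using generic_qnum_nonzero[OF assms, of k] by (simp add: phi_coeff_def)
qed

definition tensor :: "complex \<Rightarrow> (nat \<times> 'i) uq_module" where "tensor \<mu> = tensor_module (verma s \<mu>) M"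

text \<open>The powers E^k w vanish from the least such index on, so the truncation only serves
  finiteness; by \<open>slice_singular_vector\<close> no slice is lost.\<close>

definition singular_vector :: "complex \<Rightarrow> ('i \<Rightarrow>\<^sub>0 complex) \<Rightarrow> (nat \<times> 'i \<Rightarrow>\<^sub>0 complex)"
  where "singular_vector \<mu> w = (\<Sum>k<(LEAST n. (E ^^ n) w = 0). tens (bvec k) (vscale (phi_coeff \<mu> k) ((E ^^ k) w)))"

lemma slice_singular_vector:
  assumes "w \<in> space_of M"
  shows "slice k (singular_vector \<mu> w) = vscale (phi_coeff \<mu> k) ((E ^^ k) w)"
proof -
  define N where "N = (LEAST n. (E ^^ n) w = 0)"
  have N: "(E ^^ N) w = 0" unfolding N_def using E_nilpotent[OF assms] by (rule LeastI_ex)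
  have "(E ^^ k) w = 0" if "N \<le> k"
  proof -
    have "(E ^^ n) 0 = 0" for n by (induction n) auto
    moreover have "(E ^^ k) w = (E ^^ (k - N)) ((E ^^ N) w)"
      using that by (metis comp_apply funpow_add le_add_diff_inverse2)
    ultimately show ?thesis using N by simp
  qed
  moreover have "slice k (singular_vector \<mu> w) = (\<Sum>i<N. if i = k then vscale (phi_coeff \<mu> i) ((E ^^ i) w) else 0)"
    unfolding singular_vector_def N_def[symmetric] slice_linear
    by (intro sum.cong refl) (auto simp: slice_tens lookup_bvec)
  ultimately show ?thesis by auto
qed

lemma E_power_in_space: "x \<in> space_of M \<Longrightarrow> (E ^^ n) x \<in> space_of M"
  by (induction n) (auto intro: op_in_space)

text \<open>The vector X has weight mu and is killed by E, and \<open>E_F_power\<close> in the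
  tensor product then reproduces the action on the Verma module.\<close>

lemma intertwiner_exists:
  assumes gen: "generic_weight s \<mu>" and w: "w \<in> W 0"
  shows "is_intertwiner (verma s \<mu>) (tensor \<mu>) (\<lambda>n. (lin (opF (tensor \<mu>)) ^^ n) (singular_vector \<mu> w))"
proof -
  interpret T: uq_rep s "tensor \<mu>"
    by unfold_locales (simp_all add: tensor_def s tensor_is_uq_module[OF s verma_is_uq_module[OF s] rep])
  let ?X = "singular_vector \<mu> w"
  have wM: "w \<in> space_of M" using w by (simp add: weight_space_iff)
  have Ew: "(E ^^ k) w \<in> W (2 * of_nat k)" for k using weight_E_power[OF w, of k] by simp
  have X: "?X \<in> T.W \<mu>"
    unfolding T.weight_space_iff
  proof
    show "?X \<in> space_of (tensor \<mu>)"
      unfolding singular_vector_def tensor_def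
      by (intro sum_in_space tens_in_space vscale_in_space E_power_in_space wM bvec_in_space) (simp add: verma_ops)
    show "T.K ?X = vscale (qpow s \<mu>) ?X"
    proof (rule slice_eqI)
      fix k
      have "K ((E ^^ k) w) = vscale (qpow s (2 * of_nat k)) ((E ^^ k) w)" using Ew by (simp add: weight_space_iff)
      then show "slice k (T.K ?X) = slice k (vscale (qpow s \<mu>) ?X)"
        unfolding tensor_def slice_tensor_ops slice_linear slice_singular_vector[OF wM]
        by (simp add: mult.left_commute[of _ "phi_coeff \<mu> k"] qpow_add mult.commute)
    qed
  qed
  have EX: "T.E ?X = 0"
  proof (rule slice_eqI)
    fix k
    have "K ((E ^^ Suc k) w) = vscale (qpow s (2 * of_nat k + 2)) ((E ^^ Suc k) w)"
      using Ew[of "Suc k"] by (simp add: weight_space_iff algebra_simps)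
    then have "slice k (T.E ?X) = vscale (qnum s (of_nat (Suc k)) * qnum s (\<mu> - of_nat k) * phi_coeff \<mu> (Suc k) * qpow s (2 * of_nat k + 2) + phi_coeff \<mu> k) ((E ^^ Suc k) w)"
      unfolding tensor_def slice_tensor_ops slice_linear slice_singular_vector[OF wM] vscale_add_left lin_vscale
      by (simp only: vscale_vscale funpow.simps comp_apply mult.assoc)
    then show "slice k (T.E ?X) = slice k 0" unfolding phi_coeff_Suc[OF gen] by (simp add: slice_linear)
  qed
  show ?thesis
    unfolding is_intertwiner_def
  proof (intro ballI conjI)
    fix n
    let ?P = "\<lambda>n. (T.F ^^ n) ?X"
    have W: "?P n \<in> T.W (\<mu> - 2 * of_nat n)" by (rule T.weight_F_power[OF X])
    then show "?P n \<in> space_of (tensor \<mu>)" by (simp add: T.weight_space_iff)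
    show "lin ?P (opE (verma s \<mu>) n) = T.E (?P n)"
    proof (cases n)
      case (Suc k)
      have "\<mu> - of_nat (Suc k) + 1 = \<mu> - of_nat k" by simp
      then show ?thesis unfolding Suc T.E_F_power[OF X EX] verma_ops by simp
    qed (simp add: verma_ops EX)
    show "lin ?P (opF (verma s \<mu>) n) = T.F (?P n)" by (simp add: verma_ops)
    show "lin ?P (opK (verma s \<mu>) n) = T.K (?P n)" using W by (simp add: verma_ops T.weight_space_iff)
    show "lin ?P (opKi (verma s \<mu>) n) = T.Ki (?P n)" using T.weight_Ki[OF W] by (simp add: verma_ops)
  qed
qed

text \<open>The image of the highest weight vector is killed by E, and for generic mu the resulting
  recursion determines each slice from the preceding one, starting with w. The other images are
  obtained by applying F.\<close>

lemma intertwiner_unique: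
  assumes gen: "generic_weight s \<mu>" and w: "w \<in> W 0"
    and P: "is_intertwiner (verma s \<mu>) (tensor \<mu>) P" and P0: "\<And>j. Poly_Mapping.lookup (P 0) (0, j) = Poly_Mapping.lookup w j"
  shows "P = (\<lambda>n. (lin (opF (tensor \<mu>)) ^^ n) (singular_vector \<mu> w))"
proof -
  let ?T = "tensor \<mu>"
  have wM: "w \<in> space_of M" using w by (simp add: weight_space_iff)
  have F: "P (Suc n) = lin (opF ?T) (P n)" for n using P by (simp add: is_intertwiner_def verma_ops)
  have K: "lin (opK ?T) (P 0) = vscale (qpow s \<mu>) (P 0)"
    using P unfolding is_intertwiner_def verma_ops by (metis UNIV_I diff_zero lin_bvec lin_vscale mult_zero_right of_nat_0)
  have E: "lin (opE ?T) (P 0) = 0"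
  proof -
    have "lin P (opE (verma s \<mu>) 0) = lin (opE ?T) (P 0)" using P unfolding is_intertwiner_def verma_ops(1) by blast
    then show ?thesis by (simp add: verma_ops)
  qed
  \<comment> \<open>The total weight is mu and the first factor of slice k has weight mu - 2k, which
    leaves 2k for V.\<close>
  have Ks: "K (slice k (P 0)) = vscale (qpow s (2 * of_nat k)) (slice k (P 0))" for k
  proof -
    have "vscale (qpow s (\<mu> - 2 * of_nat k)) (K (slice k (P 0))) = vscale (qpow s \<mu>) (slice k (P 0))"
      using arg_cong[OF K, of "slice k"] unfolding tensor_def slice_tensor_ops slice_linear .
    from arg_cong[OF this, of "vscale (qpow s (2 * of_nat k - \<mu>))"] show ?thesis by (simp add: qpow_add)
  qed
  have "slice k (P 0) = vscale (phi_coeff \<mu> k) ((lin (opE M) ^^ k) w)" for k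
  proof (induction k)
    case 0
    show ?case by (rule poly_mapping_eqI) (simp add: lookup_slice P0 phi_coeff_def)
  next
    case (Suc k)
    define a where "a = qnum s (of_nat (Suc k)) * qnum s (\<mu> - of_nat k) * qpow s (2 * of_nat k + 2)"
    have a: "a \<noteq> 0" unfolding a_def using generic_qnum_nonzero[OF gen, of k] by (simp add: qpow_def)
    have pc: "- phi_coeff \<mu> k = a * phi_coeff \<mu> (Suc k)" using phi_coeff_Suc[OF gen, of k] by (simp add: a_def mult_ac)
    have "2 * of_nat (Suc k) = (2 * of_nat k + 2 :: complex)" by simp
    then have "slice k (lin (opE ?T) (P 0)) = vscale a (slice (Suc k) (P 0)) + lin (opE M) (slice k (P 0))"
      unfolding tensor_def slice_tensor_ops Ks a_def by (simp only: vscale_vscale)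
    then have "vscale a (slice (Suc k) (P 0)) + lin (opE M) (slice k (P 0)) = 0" unfolding E by (simp add: slice_linear)
    then have "vscale a (slice (Suc k) (P 0)) = - vscale (phi_coeff \<mu> k) ((lin (opE M) ^^ Suc k) w)"
      unfolding Suc by (simp add: add_eq_0_iff2)
    also have "\<dots> = vscale (- phi_coeff \<mu> k) ((lin (opE M) ^^ Suc k) w)"
      by (rule poly_mapping_eqI) simp
    finally have "vscale (1 / a) (vscale a (slice (Suc k) (P 0))) = vscale (1 / a) (vscale (a * phi_coeff \<mu> (Suc k)) ((lin (opE M) ^^ Suc k) w))"
      unfolding pc by simp
    then show ?case using a by simp
  qed
  then have "P 0 = singular_vector \<mu> w" by (intro slice_eqI) (simp add: slice_singular_vector[OF wM])
  then have "P n = (lin (opF ?T) ^^ n) (singular_vector \<mu> w)" for n by (induction n) (simp_all add: F)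
  then show ?thesis by blast
qed

lemma Phi_eq:
  assumes gen: "generic_weight s \<mu>" and w: "w \<in> W 0"
  shows "Phi s M w \<mu> = (\<lambda>n. (lin (opF (tensor \<mu>)) ^^ n) (singular_vector \<mu> w))"
  unfolding Phi_def
proof (rule the_equality)
  have wM: "w \<in> space_of M" using w by (simp add: weight_space_iff)
  have "Poly_Mapping.lookup (singular_vector \<mu> w) (0, j) = Poly_Mapping.lookup w j" for j
    using slice_singular_vector[OF wM, of 0 \<mu>] by (simp add: lookup_slice[symmetric] phi_coeff_def)
  then show "is_intertwiner (verma s \<mu>) (tensor_module (verma s \<mu>) M) (\<lambda>n. (lin (opF (tensor \<mu>)) ^^ n) (singular_vector \<mu> w)) \<and>
    (\<forall>j. Poly_Mapping.lookup ((lin (opF (tensor \<mu>)) ^^ 0) (singular_vector \<mu> w)) (0, j) = Poly_Mapping.lookup w j)"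
    using intertwiner_exists[OF gen w] by (simp add: tensor_def)
next
  fix P assume "is_intertwiner (verma s \<mu>) (tensor_module (verma s \<mu>) M) P \<and>
    (\<forall>j. Poly_Mapping.lookup (P 0) (0, j) = Poly_Mapping.lookup w j)"
  then show "P = (\<lambda>n. (lin (opF (tensor \<mu>)) ^^ n) (singular_vector \<mu> w))"
    by (intro intertwiner_unique[OF gen w]) (auto simp: tensor_def)
qed

lemma power_qpow_neq_1: "j > 0 \<Longrightarrow> qpow s 2 ^ j \<noteq> 1"
proof -
  assume "j > 0"
  have "qpow s 2 ^ j = qpow s (of_real (2 * of_nat j))"
    by (simp add: qpow_def mult_ac flip: exp_of_nat_mult)
  then show ?thesis using qpow_neq_1[OF s, of "2 * of_nat j"] \<open>j > 0\<close> by simp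
qed

text \<open>The two summands of the coproduct of \<open>F\<close> commute up to the factor \<open>q\<^sup>2\<close>, so that the
  powers of \<open>F\<close> on the tensor product are given by the Gaussian binomial theorem.\<close>

lemma slice_F_power:
  "slice k ((lin (opF (tensor \<mu>)) ^^ n) X) =
     (\<Sum>j\<le>n. vscale (gauss_binomial (qpow s 2) n j)
        (if n \<le> k + j then vscale (qpow s (of_nat j * (2 * of_nat (k + j - n) - \<mu>))) ((F ^^ j) (slice (k + j - n) X)) else 0))"
proof (induction n arbitrary: k)
  case (Suc n)
  \<comment> \<open>Here j of the n factors act on V and n - j raise the index in the Verma module,
    so slice k comes from slice k + j - n of X. The guard discards the indices that would be
    negative.\<close>
  define R where "R = (\<lambda>n k j. if n \<le> k + j then vscale (qpow s (of_nat j * (2 * of_nat (k + j - n) - \<mu>))) ((F ^^ j) (slice (k + j - n) X)) else 0)"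
  define gb where "gb = gauss_binomial (qpow s 2)"
  have gb0: "gb n (Suc n) = 0" "gb n 0 = 1" for n by (simp_all add: gb_def gauss_binomial_eq_0)
  have 1: "(if k = 0 then 0 else (\<Sum>j\<le>n. vscale (gb n j) (R n (k - 1) j))) = (\<Sum>j\<le>n. vscale (gb n j) (R (Suc n) k j))"
  proof (cases k)
    case 0
    have "R (Suc n) 0 j = 0" if "j \<le> n" for j using that by (simp add: R_def)
    then show ?thesis using 0 by simp
  next
    case (Suc i)
    have "R n i j = R (Suc n) (Suc i) j" for j by (simp add: R_def)
    then show ?thesis using Suc by simp
  qed
  have 2: "vscale (qpow s (2 * of_nat k - \<mu>)) (F (\<Sum>j\<le>n. vscale (gb n j) (R n k j)))
     = (\<Sum>j\<le>n. vscale (qpow s 2 ^ (n - j) * gb n j) (R (Suc n) k (Suc j)))"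
    unfolding lin_sum vscale_sum
  proof (intro sum.cong refl)
    fix j assume "j \<in> {..n}"
    then have jn: "j \<le> n" by simp
    show "vscale (qpow s (2 * of_nat k - \<mu>)) (F (vscale (gb n j) (R n k j))) = vscale (qpow s 2 ^ (n - j) * gb n j) (R (Suc n) k (Suc j))"
    proof (cases "n \<le> k + j")
      case True
      define i where "i = k + j - n"
      have ki: "of_nat k = (of_nat i + of_nat (n - j) :: complex)" 
      proof -
        have "k = i + (n - j)" using True jn unfolding i_def by linarith
        then show ?thesis by (metis of_nat_add)
      qed
      \<comment> \<open>The last F acting on V meets the index k = i + (n - j) instead of i, which
        accounts for the power of q^2.\<close>
      have "qpow s 2 ^ (n - j) * qpow s (of_nat (Suc j) * (2 * of_nat i - \<mu>))
         = qpow s (2 * of_nat k - \<mu>) * qpow s (of_nat j * (2 * of_nat i - \<mu>))"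
        unfolding ki by (simp add: qpow_def algebra_simps flip: exp_add exp_of_nat_mult)
      then show ?thesis using True by (simp add: R_def i_def[symmetric] mult_ac)
    qed (simp add: R_def)
  qed
  have "slice k ((lin (opF (tensor \<mu>)) ^^ Suc n) X)
    = (if k = 0 then 0 else (\<Sum>j\<le>n. vscale (gb n j) (R n (k - 1) j))) + vscale (qpow s (2 * of_nat k - \<mu>)) (F (\<Sum>j\<le>n. vscale (gb n j) (R n k j)))"
    using slice_tensor_ops(2)[of k s \<mu> M "(lin (opF (tensor \<mu>)) ^^ n) X", folded tensor_def]
    unfolding Suc R_def gb_def by simp
  also have "\<dots> = (\<Sum>j\<le>Suc n. vscale (gb n j) (R (Suc n) k j)) + (\<Sum>j\<le>n. vscale (qpow s 2 ^ (n - j) * gb n j) (R (Suc n) k (Suc j)))"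
    unfolding 1 2 by (simp add: gb0)
  also have "\<dots> = R (Suc n) k 0 + (\<Sum>j\<le>n. vscale (gb n (Suc j) + qpow s 2 ^ (n - j) * gb n j) (R (Suc n) k (Suc j)))"
    unfolding sum.atMost_Suc_shift by (simp add: gb0 vscale_add_left sum.distrib)
  also have "(\<Sum>j\<le>n. vscale (gb n (Suc j) + qpow s 2 ^ (n - j) * gb n j) (R (Suc n) k (Suc j)))
     = (\<Sum>j\<le>n. vscale (gb (Suc n) (Suc j)) (R (Suc n) k (Suc j)))"
    unfolding gb_def using gauss_binomial_pascal(1)[of "qpow s 2"] power_qpow_neq_1 by (intro sum.cong refl) simp
  also have "R (Suc n) k 0 + \<dots> = (\<Sum>j\<le>Suc n. vscale (gb (Suc n) j) (R (Suc n) k j))"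
    unfolding sum.atMost_Suc_shift by (simp add: gb0)
  finally show ?case unfolding R_def gb_def .
qed simp

text \<open>On the diagonal the j-th term takes slice j of the singular vector, so F^j meets E^j w
  and returns a multiple of w.\<close>

lemma Phi_diagonal:
  assumes gen: "generic_weight s \<mu>" and w: "w \<in> W 0"
  shows "slice n (Phi s M w \<mu> n) = vscale (\<Sum>j\<le>n. gauss_binomial (qpow s 2) n j * qpow s (of_nat j * (2 * of_nat j - \<mu>)) *
     phi_coeff \<mu> j * (\<Prod>i<j. qnum s (of_nat m - of_nat i) * qnum s (of_nat m + of_nat i + 1))) w"
proof -
  have wM: "w \<in> space_of M" using w by (simp add: weight_space_iff)
  have hom: "(F ^^ n) (vscale c y) = vscale c ((F ^^ n) y)" for n c y by (induction n) auto
  have vs: "(\<Sum>j\<in>A. vscale (h j) w) = vscale (\<Sum>j\<in>A. h j) w" for h and A :: "nat set"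
    by (induction A rule: infinite_finite_induct) (simp_all add: vscale_add_left)
  show ?thesis
    unfolding Phi_eq[OF gen w] slice_F_power vs[symmetric]
    by (intro sum.cong refl) (simp add: slice_singular_vector[OF wM] hom F_power_E_power[OF w] mult_ac)
qed

end


subsection \<open>The trace function\<close>

text \<open>A crude bound from the second Pascal rule. Any positive radius of convergence determines
  the rational function, and 2^n leads to the radius 1/2.\<close>

lemma norm_gauss_binomial_le:
  assumes P: "norm P \<le> 1" "\<And>j. j > 0 \<Longrightarrow> P ^ j \<noteq> 1"
  shows "norm (gauss_binomial P n k) \<le> 2 ^ n"
proof (induction n arbitrary: k)
  case 0
  show ?case by (cases k) (simp_all add: gauss_binomial_eq_0)
next
  case (Suc n)
  show ?case
  proof (cases k)
    case 0
    have "1 \<le> (2::real) ^ Suc n" by (rule one_le_power) simp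
    then show ?thesis using 0 by simp
  next
    case (Suc i)
    have "norm (gauss_binomial P (Suc n) k) \<le> norm (P ^ Suc i * gauss_binomial P n (Suc i)) + norm (gauss_binomial P n i)"
    proof -
      have "gauss_binomial P (Suc n) (Suc i) = P ^ Suc i * gauss_binomial P n (Suc i) + gauss_binomial P n i"
        using P(2) by (rule gauss_binomial_pascal(2))
      then show ?thesis unfolding Suc by (simp only: norm_triangle_ineq)
    qed
    also have "norm (P ^ Suc i * gauss_binomial P n (Suc i)) \<le> 1 * 2 ^ n"
      unfolding norm_mult norm_power by (intro mult_mono power_le_one P Suc.IH) auto
    finally show ?thesis using Suc.IH[of i] by simp
  qed
qed

text \<open>For the sums S_k the second Pascal rule gives S_(k+1) = x (P^(k+1) S_(k+1) + S_k), which
  is solved for S_(k+1). Summability has to be known beforehand.\<close>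

lemma gauss_binomial_generating_function:
  assumes P: "norm P \<le> 1" "\<And>j. j > 0 \<Longrightarrow> P ^ j \<noteq> 1" and x: "norm x < 1 / 2"
  shows "(\<lambda>n. gauss_binomial P n k * x ^ n) sums (x ^ k / (\<Prod>i\<le>k. 1 - P ^ i * x))"
proof (induction k)
  case 0
  have "(\<lambda>n. x ^ n) sums (1 / (1 - x))" by (rule geometric_sums) (use x in simp)
  then show ?case by simp
next
  case (Suc k)
  define a where "a = (\<lambda>n. gauss_binomial P n (Suc k) * x ^ n)"
  have "summable a"
  proof (rule summable_comparison_test)
    have "norm (a n) \<le> (2 * norm x) ^ n" for n
      unfolding a_def norm_mult norm_power power_mult_distrib
      by (intro mult_right_mono norm_gauss_binomial_le P) auto
    then show "\<exists>N. \<forall>n\<ge>N. norm (a n) \<le> (2 * norm x) ^ n" by blast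
    show "summable (\<lambda>n. (2 * norm x) ^ n)" by (rule summable_geometric) (use x in simp)
  qed
  then have S: "a sums suminf a" by (rule summable_sums)
  define T where "T = x ^ k / (\<Prod>i\<le>k. 1 - P ^ i * x)"
  have "(\<lambda>n. x * (P ^ Suc k * a n + gauss_binomial P n k * x ^ n)) sums (x * (P ^ Suc k * suminf a + T))"
    unfolding T_def by (intro sums_mult sums_add S Suc)
  moreover have "x * (P ^ Suc k * a n + gauss_binomial P n k * x ^ n) = a (Suc n)" for n
  proof -
    have "gauss_binomial P (Suc n) (Suc k) = P ^ Suc k * gauss_binomial P n (Suc k) + gauss_binomial P n k"
      using P(2) by (rule gauss_binomial_pascal(2))
    then show ?thesis unfolding a_def by (simp add: algebra_simps)
  qed
  ultimately have "(\<lambda>n. a (Suc n)) sums (x * (P ^ Suc k * suminf a + T))" by simp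
  moreover have "(\<lambda>n. a (Suc n)) sums (suminf a - a 0)" using S by (simp add: sums_Suc_iff)
  moreover have "a 0 = 0" by (simp add: a_def gauss_binomial_eq_0)
  ultimately have "suminf a = x * (P ^ Suc k * suminf a + T)" using sums_unique2 by fastforce
  then have "suminf a * (1 - P ^ Suc k * x) = x * T" by (simp add: algebra_simps)
  moreover have "1 - P ^ Suc k * x \<noteq> 0"
  proof
    assume "1 - P ^ Suc k * x = 0"
    then have "norm (P ^ Suc k * x) = 1" by simp
    moreover have "norm (P ^ Suc k * x) \<le> 1 * norm x"
      unfolding norm_mult norm_power by (intro mult_right_mono power_le_one P) auto
    ultimately show False using x by simp
  qed
  ultimately have "suminf a = x * T / (1 - P ^ Suc k * x)" by (simp add: field_simps)
  then show ?case using S by (simp add: a_def T_def)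
qed

lemma eval2_ring [simp]:
  "eval2 (A + B) x y = eval2 A x y + eval2 B x y" "eval2 (A - B) x y = eval2 A x y - eval2 B x y"
  "eval2 (A * B) x y = eval2 A x y * eval2 B x y" "eval2 (sum f I) x y = (\<Sum>i\<in>I. eval2 (f i) x y)"
  "eval2 (prod f I) x y = (\<Prod>i\<in>I. eval2 (f i) x y)" "eval2 [:[:c:]:] x y = c"
  "eval2 [:[:a, 1:]:] x y = x + a" "eval2 [:[:a:], 1:] x y = y + a" "eval2 0 x y = 0"
  by (simp_all add: eval2_def poly_sum poly_prod algebra_simps)

text \<open>The set of x may depend on y, as the radius in \<open>is_trace_function\<close> depends
  on mu. For each y in \<open>Y\<close> the polynomial in x is 0, so the outer polynomial has
  infinitely many constant roots.\<close>

lemma eval2_eq_0I: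
  assumes "infinite Y" "\<And>y. y \<in> Y \<Longrightarrow> infinite {x. eval2 R x y = 0}"
  shows "R = 0"
proof (rule ccontr)
  assume "R \<noteq> 0"
  have "poly R [:y:] = 0" if "y \<in> Y" for y
    using assms(2)[OF that] poly_roots_finite[of "poly R [:y:]"] unfolding eval2_def by blast
  then have "(\<lambda>y. [:y:]) ` Y \<subseteq> {z. poly R z = 0}" by auto
  then have "finite ((\<lambda>y. [:y:]) ` Y)" using poly_roots_finite[OF \<open>R \<noteq> 0\<close>] finite_subset by blast
  then show False using assms(1) by (auto simp: finite_image_iff inj_on_def)
qed

lemma qpow_surj:
  assumes "s \<noteq> 0" "z \<noteq> 0"
  obtains a where "qpow s (2 * a) = z"
proof
  show "qpow s (2 * (Ln z / (2 * s))) = z" using assms by (simp add: qpow_def)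
qed

text \<open>The j-th term of the diagonal component without the Gaussian binomial, after its
  dependence on mu has been split off as the product of the 1 / (q^(2 mu) - q^(2 i)) with i < j; see
  \<open>trace_coeff_eq\<close>.\<close>

definition trace_coeff :: "complex \<Rightarrow> nat \<Rightarrow> nat \<Rightarrow> complex"
  where "trace_coeff s m j = qpow s (2 * of_nat j * of_nat j) * (\<Prod>i<j. - (qpow s 1 - qpow s (- 1)) * qpow s (- of_nat i - 2) *
     (qnum s (of_nat m - of_nat i) * qnum s (of_nat m + of_nat i + 1)) / qnum s (of_nat (Suc i)))"

text \<open>The single factor x in every summand arises because x^(-j) divided by the product of the
  1 - q^(2i) / x with i <= j is x divided by the product of the x - q^(2i).\<close>

definition trace_num :: "complex \<Rightarrow> nat \<Rightarrow> complex poly poly"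
  where "trace_num s m = (\<Sum>j\<le>m. [:[:trace_coeff s m j:]:] * [:[:0, 1:]:] *
     (\<Prod>i\<in>{j<..m}. [:[:- (qpow s 2 ^ i), 1:]:]) * (\<Prod>i\<in>{j..<m}. [:[:- (qpow s 2 ^ i):], 1:]))"

definition trace_den :: "complex \<Rightarrow> nat \<Rightarrow> complex poly poly"
  where "trace_den s m = (\<Prod>i\<le>m. [:[:- (qpow s 2 ^ i), 1:]:]) * (\<Prod>i<m. [:[:- (qpow s 2 ^ i):], 1:])"

lemma eval2_trace_num: "eval2 (trace_num s m) x y = (\<Sum>j\<le>m. trace_coeff s m j * x *
     (\<Prod>i\<in>{j<..m}. x - qpow s 2 ^ i) * (\<Prod>i\<in>{j..<m}. y - qpow s 2 ^ i))"
  unfolding trace_num_def by (simp only: eval2_ring) simp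

lemma eval2_trace_den: "eval2 (trace_den s m) x y = (\<Prod>i\<le>m. x - qpow s 2 ^ i) * (\<Prod>i<m. y - qpow s 2 ^ i)"
  unfolding trace_den_def by (simp only: eval2_ring) simp

lemma trace_quotient:
  assumes "eval2 (trace_den s m) x y \<noteq> 0" "x \<noteq> 0"
  shows "eval2 (trace_num s m) x y / eval2 (trace_den s m) x y =
    (\<Sum>j\<le>m. trace_coeff s m j / (\<Prod>i<j. y - qpow s 2 ^ i) * ((1 / x) ^ j / (\<Prod>i\<le>j. 1 - qpow s 2 ^ i * (1 / x))))"
proof -
  let ?X = "\<lambda>i. x - qpow s 2 ^ i" and ?Y = "\<lambda>i. y - qpow s 2 ^ i"
  have "trace_coeff s m j * x * prod ?X {j<..m} * prod ?Y {j..<m} / (prod ?X {..m} * prod ?Y {..<m})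
    = trace_coeff s m j / prod ?Y {..<j} * ((1 / x) ^ j / (\<Prod>i\<le>j. 1 - qpow s 2 ^ i * (1 / x)))" if "j \<le> m" for j
  proof -
    have a: "prod ?X {..m} = prod ?X {..j} * prod ?X {j<..m}"
      using that by (subst prod.union_disjoint[symmetric]) (auto intro!: prod.cong)
    have b: "prod ?Y {..<m} = prod ?Y {..<j} * prod ?Y {j..<m}"
      using that by (subst prod.union_disjoint[symmetric]) (auto intro!: prod.cong)
    have nz: "prod ?X {..j} \<noteq> 0" "prod ?X {j<..m} \<noteq> 0" "prod ?Y {..<j} \<noteq> 0" "prod ?Y {j..<m} \<noteq> 0"
      using assms(1) unfolding eval2_trace_den a b by auto
    have "prod ?X {..j} = (\<Prod>i\<le>j. x * (1 - qpow s 2 ^ i * (1 / x)))"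
      by (intro prod.cong) (use assms(2) in \<open>auto simp: algebra_simps\<close>)
    then have "prod ?X {..j} = x ^ Suc j * (\<Prod>i\<le>j. 1 - qpow s 2 ^ i * (1 / x))" by (simp add: prod.distrib)
    moreover from this have "(\<Prod>i\<le>j. 1 - qpow s 2 ^ i * (1 / x)) \<noteq> 0" using nz(1) by auto
    moreover have "c * x * v * z / (x ^ Suc j * u * v * (w * z)) = c / w * ((1 / x) ^ j / u)"
      if "u \<noteq> 0" "v \<noteq> 0" "w \<noteq> 0" "z \<noteq> 0" for c u v w z :: complex
      using that assms(2) by (simp add: field_simps)
    ultimately show ?thesis unfolding a b using nz by (simp only:)
  qed
  then show ?thesis unfolding eval2_trace_num eval2_trace_den sum_divide_distrib by (intro sum.cong) auto
qed

section \<open>The trace as a rational function and its uniqueness\<close>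

context spin_rep
begin

text \<open>Each [mu-i] equals q^(-mu-i) (q^(2 mu) - q^(2 i)) / (q - 1/q). Its factor q^(-mu)
  absorbs one of the j factors q^(-mu) in front, and what is left is rational in q^(2 mu).\<close>

lemma trace_coeff_eq:
  assumes gen: "generic_weight s \<mu>"
  shows "qpow s (of_nat j * (2 * of_nat j - \<mu>)) * phi_coeff \<mu> j * (\<Prod>i<j. qnum s (of_nat m - of_nat i) * qnum s (of_nat m + of_nat i + 1))
    = trace_coeff s m j / (\<Prod>i<j. qpow s (2 * \<mu>) - qpow s 2 ^ i)"
proof -
  define d where "d = qpow s 1 - qpow s (- 1)"
  have d: "d \<noteq> 0" unfolding d_def by (rule qpow_1_diff_nonzero[OF s])
  have "qpow s (of_nat j * (2 * of_nat j - \<mu>)) = qpow s (2 * of_nat j * of_nat j) * qpow s (- \<mu>) ^ j"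
    unfolding qpow_power qpow_add by (rule arg_cong[of _ _ "qpow s"]) (simp add: algebra_simps)
  moreover have "qpow s (- \<mu>) * (- qpow s (- 2 * of_nat i - 2) / (qnum s (of_nat (Suc i)) * qnum s (\<mu> - of_nat i))) *
      (qnum s (of_nat m - of_nat i) * qnum s (of_nat m + of_nat i + 1))
    = (- d * qpow s (- of_nat i - 2) *
     (qnum s (of_nat m - of_nat i) * qnum s (of_nat m + of_nat i + 1)) / qnum s (of_nat (Suc i))) / (qpow s (2 * \<mu>) - qpow s 2 ^ i)" for i
  proof -
    have "qnum s (\<mu> - of_nat i) = qpow s (- \<mu> - of_nat i) * (qpow s (2 * \<mu>) - qpow s 2 ^ i) / d"
      unfolding qnum_def d_def[symmetric] right_diff_distrib qpow_power qpow_add by (simp add: algebra_simps)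
    moreover have "qpow s (- \<mu>) * qpow s (- 2 * of_nat i - 2) = qpow s (- \<mu> - of_nat i) * qpow s (- of_nat i - 2)"
      unfolding qpow_add by (rule arg_cong[of _ _ "qpow s"]) (simp add: algebra_simps)
    moreover have "a * (- b / (c * (e * f / d))) * g = (- d * h * g / c) / f" if "a * b = e * h" "e \<noteq> 0" for a b c e f g h :: complex
    proof -
      have "a * (- b / (c * (e * f / d))) * g = - (a * b) * d * g / (c * e * f)" using d by (simp add: field_simps)
      then show ?thesis unfolding that(1) using that(2) by (simp add: mult_ac)
    qed
    ultimately show ?thesis by (simp only: qpow_nonzero not_False_eq_True)
  qed
  moreover have "a * c ^ j * (\<Prod>i<j. f i) * (\<Prod>i<j. g i) = a * (\<Prod>i<j. h i) / (\<Prod>i<j. e i)"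
    if fac: "\<And>i. c * f i * g i = h i / e i" for a c :: complex and f g h e :: "nat \<Rightarrow> complex"
  proof -
    have "(\<Prod>i<j. c * f i * g i) = c ^ j * (\<Prod>i<j. f i) * (\<Prod>i<j. g i)" by (simp add: prod.distrib)
    then show ?thesis unfolding fac prod_dividef
      by (simp only: times_divide_eq_right[symmetric] mult.assoc)
  qed
  ultimately show ?thesis
    unfolding phi_coeff_def trace_coeff_def d_def[symmetric] by (simp only:)
qed

lemma trace_function:
  assumes "Re s < 0"
  shows "is_trace_function s M (trace_num s m) (trace_den s m)"
  unfolding is_trace_function_def
proof (intro conjI ballI impI allI)
  let ?P = "qpow s 2"
  show "trace_den s m \<noteq> 0" unfolding trace_den_def by (simp add: prod_zero_iff)
  fix w \<mu> assume w: "w \<in> weight_space s M 0" and gen: "generic_weight s \<mu>"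
  have P: "norm ?P \<le> 1" using assms by (simp add: qpow_def)
  show "\<exists>r>0. \<forall>l. cmod (qpow s (- 2 * l)) < r \<longrightarrow>
       eval2 (trace_den s m) (qpow s (2 * l)) (qpow s (2 * \<mu>)) \<noteq> 0 \<and>
       has_trace (\<lambda>k. lin (Phi s M w \<mu>) (q2lam s \<mu> l k))
        (vscale (qpow s (l * \<mu>) * eval2 (trace_num s m) (qpow s (2 * l)) (qpow s (2 * \<mu>)) /
           eval2 (trace_den s m) (qpow s (2 * l)) (qpow s (2 * \<mu>))) w)"
  proof (intro exI[of _ "1/2"] conjI allI impI)
    fix l assume l: "cmod (qpow s (- 2 * l)) < 1 / 2"
    define x where "x = qpow s (- 2 * l)"
    have x: "norm x < 1 / 2" "1 / qpow s (2 * l) = x" "qpow s (2 * l) = 1 / x" "x \<noteq> 0"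
      using l qpow_minus[of s "2 * l"] by (simp_all add: x_def)
    show den: "eval2 (trace_den s m) (qpow s (2 * l)) (qpow s (2 * \<mu>)) \<noteq> 0"
    proof -
      have "qpow s (2 * l) - ?P ^ i \<noteq> 0" for i
      proof
        assume "qpow s (2 * l) - ?P ^ i = 0"
        then have "norm (qpow s (2 * l)) \<le> 1" using P by (simp add: norm_power power_le_one)
        then have "norm (1 / x) \<le> 1" unfolding x(3) .
        then show False using x(1,4) by (simp add: norm_divide divide_simps)
      qed
      moreover have "qpow s (2 * \<mu>) - ?P ^ i \<noteq> 0" for i
      proof
        assume "qpow s (2 * \<mu>) - ?P ^ i = 0"
        then have "qpow s (2 * \<mu>) * qpow s (- 2 * of_nat i) = ?P ^ i * qpow s (- 2 * of_nat i)" by simp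
        then have "qpow s (2 * (\<mu> - of_nat i)) = 1" unfolding qpow_power qpow_add by (simp add: algebra_simps)
        then show False using gen unfolding generic_weight_def by blast
      qed
      ultimately show ?thesis unfolding eval2_trace_den by simp
    qed
    define dj where "dj = (\<lambda>j. qpow s (of_nat j * (2 * of_nat j - \<mu>)) * phi_coeff \<mu> j * (\<Prod>i<j. qnum s (of_nat m - of_nat i) * qnum s (of_nat m + of_nat i + 1)))"
    \<comment> \<open>The factor [m-i] with i = m vanishes. Together with the vanishing of Gaussian
      binomials beyond n, this replaces the upper limit n of the sum by m.\<close>
    have dj0: "dj j = 0" if "m < j" for j
      unfolding dj_def using that by (auto intro!: prod_zero bexI[of _ m])
    show "has_trace (\<lambda>k. lin (Phi s M w \<mu>) (q2lam s \<mu> l k))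
        (vscale (qpow s (l * \<mu>) * eval2 (trace_num s m) (qpow s (2 * l)) (qpow s (2 * \<mu>)) /
           eval2 (trace_den s m) (qpow s (2 * l)) (qpow s (2 * \<mu>))) w)"
      unfolding has_trace_def
    proof
      fix i
      have "(\<lambda>n. qpow s (l * \<mu>) * (\<Sum>j\<le>m. dj j * (gauss_binomial ?P n j * x ^ n)) * Poly_Mapping.lookup w i)
        sums (qpow s (l * \<mu>) * (\<Sum>j\<le>m. dj j * (x ^ j / (\<Prod>i\<le>j. 1 - ?P ^ i * x))) * Poly_Mapping.lookup w i)"
        by (intro sums_mult sums_mult2 sums_sum gauss_binomial_generating_function P power_qpow_neq_1 x(1))
      moreover have "qpow s (l * \<mu>) * (\<Sum>j\<le>m. dj j * (gauss_binomial ?P n j * x ^ n)) * Poly_Mapping.lookup w i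
         = Poly_Mapping.lookup (lin (Phi s M w \<mu>) (q2lam s \<mu> l n)) (n, i)" for n
      proof -
        have "(\<Sum>j\<le>n. gauss_binomial ?P n j * dj j) = (\<Sum>j\<le>m. gauss_binomial ?P n j * dj j)"
          by (rule sum.mono_neutral_cong) (auto simp: gauss_binomial_eq_0 dj0)
        then have "slice n (Phi s M w \<mu> n) = vscale (\<Sum>j\<le>m. gauss_binomial ?P n j * dj j) w"
          unfolding Phi_diagonal[OF gen w] dj_def by (simp add: mult_ac)
        then have "Poly_Mapping.lookup (Phi s M w \<mu> n) (n, i) = (\<Sum>j\<le>m. gauss_binomial ?P n j * dj j) * Poly_Mapping.lookup w i"
          by (simp flip: lookup_slice)
        moreover have "qpow s (l * (\<mu> - 2 * of_nat n)) = qpow s (l * \<mu>) * x ^ n"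
          unfolding x_def qpow_power qpow_add by (rule arg_cong[of _ _ "qpow s"]) (simp add: algebra_simps)
        moreover have "(\<Sum>j\<le>m. dj j * (gauss_binomial ?P n j * x ^ n)) = x ^ n * (\<Sum>j\<le>m. gauss_binomial ?P n j * dj j)"
          unfolding sum_distrib_left by (simp add: mult_ac)
        ultimately show ?thesis by (simp add: q2lam_def mult_ac)
      qed
      moreover have "qpow s (l * \<mu>) * (\<Sum>j\<le>m. dj j * (x ^ j / (\<Prod>i\<le>j. 1 - ?P ^ i * x))) * Poly_Mapping.lookup w i
         = Poly_Mapping.lookup (vscale (qpow s (l * \<mu>) * eval2 (trace_num s m) (qpow s (2 * l)) (qpow s (2 * \<mu>)) /
           eval2 (trace_den s m) (qpow s (2 * l)) (qpow s (2 * \<mu>))) w) i"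
        using trace_quotient[OF den] unfolding dj_def trace_coeff_eq[OF gen] x(2) by (simp flip: times_divide_eq_right)
      ultimately show "(\<lambda>k. Poly_Mapping.lookup (lin (Phi s M w \<mu>) (q2lam s \<mu> l k)) (k, i)) sums
         Poly_Mapping.lookup (vscale (qpow s (l * \<mu>) * eval2 (trace_num s m) (qpow s (2 * l)) (qpow s (2 * \<mu>)) /
           eval2 (trace_den s m) (qpow s (2 * l)) (qpow s (2 * \<mu>))) w) i" by simp
    qed
  qed simp
qed

text \<open>The sum of a series is unique, so the two quotients agree for every generic mu and all x
  of large norm. This is enough for a polynomial identity.\<close>

lemma trace_function_unique:
  assumes "is_trace_function s M P Q" "is_trace_function s M P' Q'"
  shows "P * Q' = P' * Q"
proof -
  have s0: "s \<noteq> 0" using s by auto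
  obtain w where w: "w \<in> W 0" "w \<noteq> 0" using zero_weight_vector by blast
  obtain i where i: "Poly_Mapping.lookup w i \<noteq> 0" using w(2) by (metis lookup_zero poly_mapping_eqI)
  \<comment> \<open>Every y in this set is q^(2 mu) for a generic mu, and its complement is
    countable.\<close>
  let ?Y = "UNIV - insert 0 (range (\<lambda>n. qpow s (2 * of_nat n)))"
  have "P * Q' - P' * Q = 0"
  proof (rule eval2_eq_0I)
    show "infinite ?Y"
    proof
      assume "finite ?Y"
      then have "countable ?Y" by (rule countable_finite)
      moreover have "countable (insert 0 (range (\<lambda>n. qpow s (2 * of_nat n))))" by simp
      ultimately have "countable (?Y \<union> insert 0 (range (\<lambda>n. qpow s (2 * of_nat n))))" by (rule countable_Un)
      moreover have "?Y \<union> insert 0 (range (\<lambda>n. qpow s (2 * of_nat n))) = UNIV" by blast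
      ultimately show False using uncountable_UNIV_complex by (simp only:)
    qed
    fix y assume y: "y \<in> ?Y"
    then obtain \<mu> where \<mu>: "qpow s (2 * \<mu>) = y" using qpow_surj[OF s0, of y] by blast
    have gen: "generic_weight s \<mu>" unfolding generic_weight_def
    proof (intro allI notI)
      fix n :: nat assume "qpow s (2 * (\<mu> - of_nat n)) = 1"
      then have "qpow s (2 * (\<mu> - of_nat n)) * qpow s (2 * of_nat n) = qpow s (2 * of_nat n)" by simp
      then have "y = qpow s (2 * of_nat n)" unfolding qpow_add \<mu>[symmetric] by (simp add: algebra_simps)
      then show False using y by blast
    qed
    obtain r where r: "r > 0" "\<And>l. norm (qpow s (- 2 * l)) < r \<Longrightarrow>
           eval2 Q (qpow s (2 * l)) (qpow s (2 * \<mu>)) \<noteq> 0 \<and>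
           has_trace (\<lambda>k. lin (Phi s M w \<mu>) (q2lam s \<mu> l k))
             (vscale (qpow s (l * \<mu>) * eval2 P (qpow s (2 * l)) (qpow s (2 * \<mu>))
                       / eval2 Q (qpow s (2 * l)) (qpow s (2 * \<mu>))) w)"
      using assms(1) w gen unfolding is_trace_function_def by blast
    obtain r' where r': "r' > 0" "\<And>l. norm (qpow s (- 2 * l)) < r' \<Longrightarrow>
           eval2 Q' (qpow s (2 * l)) (qpow s (2 * \<mu>)) \<noteq> 0 \<and>
           has_trace (\<lambda>k. lin (Phi s M w \<mu>) (q2lam s \<mu> l k))
             (vscale (qpow s (l * \<mu>) * eval2 P' (qpow s (2 * l)) (qpow s (2 * \<mu>))
                       / eval2 Q' (qpow s (2 * l)) (qpow s (2 * \<mu>))) w)"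
      using assms(2) w gen unfolding is_trace_function_def by blast
    let ?X = "{x :: complex. 1 / min r r' < norm x}"
    have "?X \<subseteq> {x. eval2 (P * Q' - P' * Q) x y = 0}"
    proof
      fix x assume "x \<in> ?X"
      then have x: "1 / min r r' < norm x" by simp
      moreover have "1 / min r r' > 0" using r(1) r'(1) by simp
      ultimately have x0: "norm x > 0" by linarith
      then obtain l where l: "qpow s (2 * l) = x" using qpow_surj[OF s0, of x] by auto
      have "norm (qpow s (- 2 * l)) = 1 / norm x"
        using qpow_minus[of s "2 * l"] l by (simp add: norm_divide)
      also have "1 / norm x < min r r'"
      proof -
        have "1 / a < c" if "1 / c < a" "c > 0" "a > 0" for a c :: real using that by (simp add: field_simps)
        from this[OF x _ x0] show ?thesis using r(1) r'(1) by simp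
      qed
      finally have "norm (qpow s (- 2 * l)) < r" "norm (qpow s (- 2 * l)) < r'" by auto
      note R = r(2)[OF this(1)] and R' = r'(2)[OF this(2)]
      have 1: "(\<lambda>k. Poly_Mapping.lookup (lin (Phi s M w \<mu>) (q2lam s \<mu> l k)) (k, i)) sums
          (qpow s (l * \<mu>) * eval2 P x y / eval2 Q x y * Poly_Mapping.lookup w i)"
        using R unfolding has_trace_def l \<mu> lookup_vscale by blast
      have 2: "(\<lambda>k. Poly_Mapping.lookup (lin (Phi s M w \<mu>) (q2lam s \<mu> l k)) (k, i)) sums
          (qpow s (l * \<mu>) * eval2 P' x y / eval2 Q' x y * Poly_Mapping.lookup w i)"
        using R' unfolding has_trace_def l \<mu> lookup_vscale by blast
      have "qpow s (l * \<mu>) * Poly_Mapping.lookup w i * (eval2 P x y / eval2 Q x y)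
          = qpow s (l * \<mu>) * Poly_Mapping.lookup w i * (eval2 P' x y / eval2 Q' x y)"
        using sums_unique2[OF 1 2] by (simp add: mult_ac)
      then have "eval2 P x y / eval2 Q x y = eval2 P' x y / eval2 Q' x y"
        using i by (metis mult_left_cancel mult_eq_0_iff qpow_nonzero)
      then show "x \<in> {x. eval2 (P * Q' - P' * Q) x y = 0}" using R R' unfolding l \<mu> by (simp add: field_simps)
    qed
    moreover have "infinite ?X"
    proof -
      have "(\<lambda>n. of_nat (n + nat \<lceil>1 / min r r'\<rceil> + 1)) ` (UNIV :: nat set) \<subseteq> ?X"
      proof (clarsimp simp del: of_nat_add)
        fix n :: nat
        have "1 / min r r' < real (Suc (n + nat \<lceil>1 / min r r'\<rceil>))" by linarith
        then show "1 / min r r' < cmod (1 + of_nat (n + nat \<lceil>1 / min r r'\<rceil>))"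
          by (metis norm_of_nat of_nat_Suc)
      qed
      moreover have "infinite ((\<lambda>n. of_nat (n + nat \<lceil>1 / min r r'\<rceil> + 1) :: complex) ` (UNIV :: nat set))"
        by (simp add: finite_image_iff inj_on_def)
      ultimately show ?thesis using finite_subset by blast
    qed
    ultimately show "infinite {x. eval2 (P * Q' - P' * Q) x y = 0}" using finite_subset by blast
  qed
  then show ?thesis by simp
qed

text \<open>Multiplied out, because regularity provides some pair with nonzero denominator at the
  point, while \<open>trace_den\<close> itself may vanish there.\<close>

lemma Psi_mult_den:
  assumes "Re s < 0" and reg: "Psi_regular s M l \<mu>"
  shows "Psi s M l \<mu> * eval2 (trace_den s m) (qpow s (2 * l)) (qpow s (2 * \<mu>))
    = qpow s (l * \<mu>) * eval2 (trace_num s m) (qpow s (2 * l)) (qpow s (2 * \<mu>))"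
proof -
  let ?x = "qpow s (2 * l)" and ?y = "qpow s (2 * \<mu>)"
  obtain P Q where PQ: "is_trace_function s M P Q" "eval2 Q ?x ?y \<noteq> 0"
    using reg unfolding Psi_regular_def by blast
  have cross: "eval2 P ?x ?y * eval2 Q' ?x ?y = eval2 P' ?x ?y * eval2 Q ?x ?y" if "is_trace_function s M P' Q'" for P' Q'
    using trace_function_unique[OF PQ(1) that] by (metis eval2_ring(3))
  have "Psi s M l \<mu> = qpow s (l * \<mu>) * eval2 P ?x ?y / eval2 Q ?x ?y"
    unfolding Psi_def
  proof (rule the_equality)
    show "\<exists>P' Q'. is_trace_function s M P' Q' \<and> eval2 Q' ?x ?y \<noteq> 0 \<and>
      qpow s (l * \<mu>) * eval2 P ?x ?y / eval2 Q ?x ?y = qpow s (l * \<mu>) * eval2 P' ?x ?y / eval2 Q' ?x ?y"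
      using PQ by blast
    fix c assume "\<exists>P' Q'. is_trace_function s M P' Q' \<and> eval2 Q' ?x ?y \<noteq> 0 \<and> c = qpow s (l * \<mu>) * eval2 P' ?x ?y / eval2 Q' ?x ?y"
    then obtain P' Q' where *: "is_trace_function s M P' Q'" "eval2 Q' ?x ?y \<noteq> 0" "c = qpow s (l * \<mu>) * eval2 P' ?x ?y / eval2 Q' ?x ?y"
      by blast
    then show "c = qpow s (l * \<mu>) * eval2 P ?x ?y / eval2 Q ?x ?y"
      using cross[OF *(1)] PQ(2) by (simp add: frac_eq_eq mult_ac)
  qed
  then show ?thesis using cross[OF trace_function[OF assms(1)]] PQ(2) by (simp add: frac_eq_eq mult_ac)
qed

end


subsection \<open>Comparison of the two sides\<close>

definition qdiff :: "complex \<Rightarrow> complex \<Rightarrow> complex"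
  where "qdiff t a = qpow t a - qpow t (- a)"

definition qdiff_fact :: "complex \<Rightarrow> nat \<Rightarrow> complex"
  where "qdiff_fact t n = (\<Prod>i<n. qdiff t (of_nat (Suc i)))"

text \<open>The common form of the two sides: summand j belongs to E^j on the trace side and to m -
  j nonzero residues on the integral side.\<close>

definition explicit_sum :: "complex \<Rightarrow> nat \<Rightarrow> complex \<Rightarrow> complex \<Rightarrow> complex"
  where "explicit_sum t m l \<mu> = qpow t (- l * \<mu>) * (\<Sum>j\<le>m.
     qpow t (- of_nat j * (l + \<mu>) - of_nat j * (of_nat j - 1) / 2) *
     (qdiff_fact t (m + j) / (qdiff_fact t (m - j) * qdiff_fact t j)) *
     (\<Prod>i\<in>{j<..m}. qdiff t (l + of_nat i) * qdiff t (\<mu> + of_nat i)))"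

section \<open>Products of q-differences as quotients of factorials\<close>

lemma prod_qpow: "(\<Prod>i<n. qpow t (a + b * of_nat i)) = qpow t (of_nat n * a + b * (of_nat n * (of_nat n - 1) / 2))"
proof (induction n)
  case (Suc n)
  show ?case unfolding prod.lessThan_Suc Suc qpow_add
    by (rule arg_cong[of _ _ "qpow t"]) (simp add: field_simps)
qed simp

lemma qdiff_nonzero: "Re t \<noteq> 0 \<Longrightarrow> n > 0 \<Longrightarrow> qdiff t (of_nat n) \<noteq> 0"
  using qnum_nonzero[of t n] unfolding qnum_def qdiff_def by auto

lemma qdiff_fact_nonzero: "Re t \<noteq> 0 \<Longrightarrow> qdiff_fact t n \<noteq> 0"
  unfolding qdiff_fact_def using qdiff_nonzero[of t "Suc _"] by (simp add: prod_zero_iff del: of_nat_Suc)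

lemma qdiff_fact_descending:
  assumes "Re t \<noteq> 0" "r \<le> n"
  shows "(\<Prod>i<r. qdiff t (of_nat n - of_nat i)) = qdiff_fact t n / qdiff_fact t (n - r)"
  using assms(2)
proof (induction r)
  case (Suc r)
  then obtain k where k: "n - r = Suc k" by (cases "n - r") auto
  then have "of_nat n - of_nat r = (of_nat (Suc k) :: complex)" using Suc.prems by (metis Suc_leD of_nat_diff)
  moreover have "n - Suc r = k" using k by simp
  moreover have "qdiff_fact t (Suc k) = qdiff_fact t k * qdiff t (of_nat (Suc k))" by (simp add: qdiff_fact_def)
  moreover have "qdiff t (of_nat (Suc k)) \<noteq> 0" by (rule qdiff_nonzero[OF assms(1)]) simp
  ultimately show ?case using Suc k by (simp del: of_nat_Suc)
qed (use qdiff_fact_nonzero[OF assms(1)] in simp)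

lemma qdiff_fact_ascending:
  assumes "Re t \<noteq> 0"
  shows "(\<Prod>i<j. qdiff t (of_nat m + of_nat i + 1)) = qdiff_fact t (m + j) / qdiff_fact t m"
proof (induction j)
  case (Suc j)
  have "qdiff_fact t (m + Suc j) = qdiff_fact t (m + j) * qdiff t (of_nat m + of_nat j + 1)"
    by (simp add: qdiff_fact_def algebra_simps)
  then show ?case using Suc by simp
qed (use qdiff_fact_nonzero[OF assms] in simp)

lemma qnum_eq_qdiff: "qnum t a = qdiff t a / qdiff t 1"
  by (simp add: qnum_def qdiff_def)

lemma qfact_eq_qdiff_fact: "qfact t n = qdiff_fact t n / qdiff t 1 ^ n"
proof (induction n)
  case (Suc n)
  have "qfact t (Suc n) = qfact t n * qnum t (of_nat (Suc n))" by (simp add: qfact_def prod.nat_ivl_Suc' mult.commute)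
  moreover have "qdiff_fact t (Suc n) = qdiff_fact t n * qdiff t (of_nat (Suc n))" by (simp add: qdiff_fact_def)
  ultimately show ?case unfolding Suc qnum_eq_qdiff by (simp del: of_nat_Suc)
qed (simp add: qfact_def qdiff_fact_def)

lemma qnum_neg: "qnum (- t) a = qnum t a"
proof -
  have "qpow (- t) a = qpow t (- a)" for a by (simp add: qpow_def)
  then have "qnum (- t) a = (- (qpow t a - qpow t (- a))) / (- (qpow t 1 - qpow t (- 1)))" by (simp add: qnum_def)
  then show ?thesis unfolding minus_divide_divide by (simp add: qnum_def)
qed

lemma one_minus_qpow: "1 - qpow t (2 * a) = - qpow t a * qdiff t a"
  unfolding qdiff_def by (simp add: algebra_simps qpow_add)

text \<open>q-numbers are even in t, and the products of [m-i] and [m+i+1] telescope to [m+j]! /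
  [m-j]!.\<close>

lemma trace_coeff_neg:
  assumes t: "Re t \<noteq> 0" and jm: "j \<le> m"
  shows "trace_coeff (- t) m j = qpow t (of_nat j * (of_nat j - 1) / 2 + 2 * of_nat j - 2 * of_nat j * of_nat j) *
    (qdiff_fact t (m + j) / (qdiff_fact t (m - j) * qdiff_fact t j))"
proof -
  have d: "qdiff t 1 \<noteq> 0" using qdiff_nonzero[OF t, of 1] by simp
  have q: "qpow (- t) a = qpow t (- a)" for a by (simp add: qpow_def)
  have "trace_coeff (- t) m j = qpow t (- (2 * of_nat j * of_nat j)) * (\<Prod>i<j. qpow t (2 + 1 * of_nat i) *
     (qdiff t (of_nat m - of_nat i) * qdiff t (of_nat m + of_nat i + 1) / qdiff t (of_nat (Suc i))))"
    unfolding trace_coeff_def q qnum_neg unfolding qnum_eq_qdiff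
  proof (rule arg_cong2[of _ _ _ _ "(*)"], simp only: mult.assoc, rule prod.cong[OF refl])
    fix i
    have "- (qpow t (- 1) - qpow t (- (- 1))) = qdiff t 1" by (simp add: qdiff_def)
    moreover have "- (- of_nat i - 2) = 2 + 1 * (of_nat i :: complex)" by simp
    moreover have "d * u * (a / d * (b / d)) / (c / d) = u * (a * b / c)" if "d \<noteq> 0" for a b c d u :: complex
      using that by (cases "c = 0") (simp_all add: field_simps)
    ultimately show "- (qpow t (- 1) - qpow t (- (- 1))) * qpow t (- (- of_nat i - 2)) *
         (qdiff t (of_nat m - of_nat i) / qdiff t 1 * (qdiff t (of_nat m + of_nat i + 1) / qdiff t 1)) /
         (qdiff t (of_nat (Suc i)) / qdiff t 1) =
         qpow t (2 + 1 * of_nat i) * (qdiff t (of_nat m - of_nat i) * qdiff t (of_nat m + of_nat i + 1) / qdiff t (of_nat (Suc i)))"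
      using d by (simp only: not_False_eq_True)
  qed
  also have "\<dots> = qpow t (- (2 * of_nat j * of_nat j)) * qpow t (of_nat j * 2 + 1 * (of_nat j * (of_nat j - 1) / 2)) *
     (qdiff_fact t m / qdiff_fact t (m - j) * (qdiff_fact t (m + j) / qdiff_fact t m) / qdiff_fact t j)"
    unfolding prod.distrib prod_dividef prod_qpow qdiff_fact_descending[OF t jm] qdiff_fact_ascending[OF t]
    by (simp only: qdiff_fact_def mult.assoc)
  also have "qdiff_fact t m / qdiff_fact t (m - j) * (qdiff_fact t (m + j) / qdiff_fact t m) / qdiff_fact t j
    = qdiff_fact t (m + j) / (qdiff_fact t (m - j) * qdiff_fact t j)"
    using qdiff_fact_nonzero[OF t] by (simp add: field_simps)
  finally show ?thesis unfolding qpow_add by (simp add: algebra_simps)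
qed

text \<open>Identifies the factors of \<open>trace_den\<close> at -t, up to a nonzero power of q,
  with those of the delta functions.\<close>

lemma qpow_diff_power: "qpow t (2 * a) - qpow (- t) 2 ^ i = qpow t (a - of_nat i) * qdiff t (a + of_nat i)"
proof -
  have "qpow (- t) 2 ^ i = qpow t (- 2 * of_nat i)" unfolding qpow_power by (simp add: qpow_def mult_ac)
  then show ?thesis unfolding qdiff_def right_diff_distrib qpow_add by (simp add: algebra_simps)
qed

text \<open>The delta factors are \<open>trace_den\<close> up to the monomials \<open>x\<close> and
  \<open>y\<close>, since the two signs (-1)^m cancel. Thus \<open>Psi_mult_den\<close> evaluates
  the product even where the denominator is 0.\<close>

lemma modified_trace_eq:
  assumes t: "Re t > 0" and V: "spin_rep (- t) (V (- t)) m"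
    and reg: "Psi_regular (- t) (V (- t)) (- l) (- \<mu> - 1)"
  shows "u_V t V m l \<mu> = explicit_sum t m l \<mu>"
proof -
  interpret spin_rep "- t" "V (- t)" m by (rule V)
  define \<Psi> where "\<Psi> = Psi (- t) (V (- t)) (- l) (- \<mu> - 1)"
  have t0: "Re t \<noteq> 0" using t by simp
  have q: "qpow (- t) (2 * (- l)) = qpow t (2 * l)" "qpow (- t) (2 * (- \<mu> - 1)) = qpow t (2 * (\<mu> + 1))"
    "qpow (- t) (- l * (- \<mu> - 1)) = qpow t (- l * (\<mu> + 1))"
    by (simp_all add: qpow_def algebra_simps)
  define x where "x = (\<lambda>A. \<Prod>i\<in>A. qpow t (l - of_nat i))"
  define y where "y = (\<lambda>A. \<Prod>i\<in>A. qpow t (\<mu> + 1 - of_nat i))"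
  define f where "f = (\<lambda>A. \<Prod>i\<in>A. qdiff t (l + of_nat i))"
  define g where "g = (\<lambda>A. \<Prod>i\<in>A. qdiff t (\<mu> + 1 + of_nat i))"
  have X: "(\<Prod>i\<in>A. qpow t (2 * l) - qpow (- t) 2 ^ i) = x A * f A" for A
    unfolding qpow_diff_power x_def f_def prod.distrib ..
  have Y: "(\<Prod>i\<in>A. qpow t (2 * (\<mu> + 1)) - qpow (- t) 2 ^ i) = y A * g A" for A
    unfolding qpow_diff_power y_def g_def prod.distrib ..
  have xy0: "x A \<noteq> 0" "y A \<noteq> 0" for A
    unfolding x_def y_def by (cases "finite A"; simp add: prod_zero_iff)+
  have "\<Psi> * eval2 (trace_den (- t) m) (qpow t (2 * l)) (qpow t (2 * (\<mu> + 1)))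
    = qpow t (- l * (\<mu> + 1)) * eval2 (trace_num (- t) m) (qpow t (2 * l)) (qpow t (2 * (\<mu> + 1)))"
    using Psi_mult_den[OF _ reg] t unfolding q \<Psi>_def by simp
  then have 1: "\<Psi> * (x {..m} * f {..m} * (y {..<m} * g {..<m})) = qpow t (- l * (\<mu> + 1)) *
     (\<Sum>j\<le>m. trace_coeff (- t) m j * qpow t (2 * l) * (x {j<..m} * f {j<..m}) * (y {j..<m} * g {j..<m}))"
    unfolding eval2_trace_den eval2_trace_num X Y .
  have 2: "u_V t V m l \<mu> = f {..m} * g {..<m} * \<Psi>"
  proof -
    have "delta_V t m (- a - 1) = (\<Prod>n=1..m. - qdiff t (a + of_nat n))" for a
      unfolding delta_V_def by (intro prod.cong) (auto simp: qdiff_def algebra_simps)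
    then have dV: "delta_V t m (- a - 1) = (- 1) ^ m * (\<Prod>n=1..m. qdiff t (a + of_nat n))" for a
      by (simp add: prod_uminus)
    have "f {..m} = qdiff t l * (\<Prod>n=1..m. qdiff t (l + of_nat n))"
      unfolding f_def One_nat_def prod.atLeast1_atMost_eq prod.atMost_shift by simp
    moreover have "g {..<m} = (\<Prod>n=1..m. qdiff t (\<mu> + of_nat n))"
      unfolding g_def One_nat_def prod.atLeast1_atMost_eq by (simp add: add_ac)
    moreover have "(- 1) ^ m * ((- 1) ^ m * c) = c" for c :: complex
      by (simp flip: power_add mult.assoc)
    moreover have "delta_q t l = qdiff t l" by (simp add: delta_q_def qdiff_def)
    ultimately show ?thesis unfolding u_V_def dV \<Psi>_def by (simp add: mult_ac)
  qed
  \<comment> \<open>Only the monomials are cancelled at the end, because the q-differences may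
    vanish.\<close>
  have "u_V t V m l \<mu> * (x {..m} * y {..<m}) = explicit_sum t m l \<mu> * (x {..m} * y {..<m})"
  proof -
    have "u_V t V m l \<mu> * (x {..m} * y {..<m}) = qpow t (- l * (\<mu> + 1)) *
       (\<Sum>j\<le>m. trace_coeff (- t) m j * qpow t (2 * l) * (x {j<..m} * f {j<..m}) * (y {j..<m} * g {j..<m}))"
      unfolding 1[symmetric] 2 by (simp only: mult_ac)
    also have "\<dots> = explicit_sum t m l \<mu> * (x {..m} * y {..<m})"
      unfolding explicit_sum_def sum_distrib_left sum_distrib_right mult.assoc[of "qpow t (- l * \<mu>)"]
    proof (intro sum.cong refl)
      fix j assume "j \<in> {..m}"
      then have jm: "j \<le> m" by simp
      have a: "x {..m} = x {..j} * x {j<..m}"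
        using jm unfolding x_def by (subst prod.union_disjoint[symmetric]) (auto intro!: prod.cong)
      have b: "y {..<m} = y {..<j} * y {j..<m}"
        using jm unfolding y_def by (subst prod.union_disjoint[symmetric]) (auto intro!: prod.cong)
      have c: "x {..j} = qpow t (of_nat (Suc j) * l + - 1 * (of_nat (Suc j) * (of_nat (Suc j) - 1) / 2))"
        using prod_qpow[of t l "- 1" "Suc j"] unfolding x_def lessThan_Suc_atMost by simp
      have d: "y {..<j} = qpow t (of_nat j * (\<mu> + 1) + - 1 * (of_nat j * (of_nat j - 1) / 2))"
        using prod_qpow[of t "\<mu> + 1" "- 1" j] unfolding y_def by simp
      have e: "(\<Prod>i\<in>{j<..m}. qdiff t (l + of_nat i) * qdiff t (\<mu> + of_nat i)) = f {j<..m} * g {j..<m}"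
      proof -
        have "g {j..<m} = (\<Prod>i\<in>{j<..m}. qdiff t (\<mu> + of_nat i))"
          unfolding g_def by (rule prod.reindex_bij_witness[of _ "\<lambda>i. i - 1" Suc]) (auto simp: add_ac)
        then show ?thesis unfolding f_def prod.distrib by simp
      qed
      have h: "qpow t (- l * (\<mu> + 1)) * (qpow t (of_nat j * (of_nat j - 1) / 2 + 2 * of_nat j - 2 * of_nat j * of_nat j) * qpow t (2 * l))
         = qpow t (- l * \<mu>) * (qpow t (- of_nat j * (l + \<mu>) - of_nat j * (of_nat j - 1) / 2) * (x {..j} * y {..<j}))"
        unfolding c d qpow_add by (rule arg_cong[of _ _ "qpow t"]) (simp add: field_simps)
      have "a1 * (a2 * k * a3 * (x1 * f1) * (y1 * g1)) = b1 * (b2 * k * (f1 * g1) * (x0 * x1 * (y0 * y1)))"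
        if "a1 * (a2 * a3) = b1 * (b2 * (x0 * y0))" for a1 a2 a3 b1 b2 k x1 x0 y1 y0 f1 g1 :: complex
        using arg_cong[OF that, of "\<lambda>z. z * (k * (x1 * f1) * (y1 * g1))"] by (simp only: mult_ac)
      from this[OF h] show "qpow t (- l * (\<mu> + 1)) * (trace_coeff (- t) m j * qpow t (2 * l) * (x {j<..m} * f {j<..m}) * (y {j..<m} * g {j..<m}))
        = qpow t (- l * \<mu>) * (qpow t (- of_nat j * (l + \<mu>) - of_nat j * (of_nat j - 1) / 2) *
     (qdiff_fact t (m + j) / (qdiff_fact t (m - j) * qdiff_fact t j)) *
     (\<Prod>i\<in>{j<..m}. qdiff t (l + of_nat i) * qdiff t (\<mu> + of_nat i)) * (x {..m} * y {..<m}))"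
        unfolding trace_coeff_neg[OF t0 jm] a b e .
    qed
    finally show ?thesis .
  qed
  then show ?thesis using xy0 by simp
qed

text \<open>As 1 - q^(-2a) is q^(-a) times a q-difference, the symmetrization constants contribute
  q^(m(m-1)/2), which combines with q^(-2m(m-1)) from the pairs.\<close>

lemma int_const_eq:
  assumes t: "Re t \<noteq> 0"
  shows "int_const t m l \<mu> = qpow t (- l * \<mu>) * qpow t (- 3 * (of_nat m * (of_nat m - 1)) / 2) *
    (of_nat (fact m) * qdiff t 1 ^ m / qdiff_fact t m)"
proof -
  have "(\<Prod>j=1..m. of_nat j * (1 - qpow t (- 2)) / (1 - qpow t (- 2) ^ j))
    = (\<Prod>i<m. qpow t (0 + 1 * of_nat i) * (of_nat (Suc i) * (qdiff t 1 / qdiff t (of_nat (Suc i)))))"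
    unfolding One_nat_def prod.atLeast1_atMost_eq
  proof (intro prod.cong refl)
    fix i
    have n: "qdiff t (of_nat (Suc i)) \<noteq> 0" by (rule qdiff_nonzero[OF t]) simp
    have q: "1 - qpow t (- 2 * a) = qpow t (- a) * qdiff t a" for a
      unfolding qdiff_def right_diff_distrib qpow_add by simp
    have "qpow t (- 2) ^ Suc i = qpow t (- 2 * of_nat (Suc i))" unfolding qpow_power by (rule arg_cong[of _ _ "qpow t"]) simp
    moreover have "1 - qpow t (- 2) = qpow t (- 1) * qdiff t 1" using q[of 1] by simp
    moreover have "qpow t (- 1) = qpow t (- of_nat (Suc i)) * qpow t (0 + 1 * of_nat i)"
      unfolding qpow_add by (rule arg_cong[of _ _ "qpow t"]) simp
    moreover have "c * (a * b * d) / (a * e) = b * (c * (d / e))" if "a \<noteq> 0" for a b c d e :: complex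
      using that by simp
    ultimately show "of_nat (Suc i) * (1 - qpow t (- 2)) / (1 - qpow t (- 2) ^ Suc i)
      = qpow t (0 + 1 * of_nat i) * (of_nat (Suc i) * (qdiff t 1 / qdiff t (of_nat (Suc i))))"
      using q[of "of_nat (Suc i)"] qpow_nonzero by (simp only: not_False_eq_True)
  qed
  also have "\<dots> = qpow t (of_nat m * (of_nat m - 1) / 2) * (of_nat (fact m) * (qdiff t 1 ^ m / qdiff_fact t m))"
  proof -
    have "(\<Prod>i<m. of_nat (Suc i)) = (of_nat (fact m) :: complex)"
      by (simp only: fact_prod_Suc atLeast0LessThan of_nat_prod of_nat_id)
    then show ?thesis unfolding prod.distrib prod_dividef prod_qpow qdiff_fact_def by simp
  qed
  finally have 1: "(\<Prod>j=1..m. of_nat j * (1 - qpow t (- 2)) / (1 - qpow t (- 2) ^ j)) = \<dots>" .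
  have "qpow t (- 2) ^ (m * (m - 1)) = qpow t (- 2 * (of_nat m * (of_nat m - 1)))"
    unfolding qpow_power by (cases m) (simp_all add: algebra_simps)
  then have "qpow t (- 2) ^ (m * (m - 1)) * qpow t (of_nat m * (of_nat m - 1) / 2) = qpow t (- 3 * (of_nat m * (of_nat m - 1)) / 2)"
    by (simp add: qpow_add field_simps)
  then show ?thesis unfolding int_const_def 1 by (simp add: mult.assoc[symmetric])
qed

text \<open>At r = m - j the continued denominators run down from 2m to m + j + 1 and give [2m]! /
  [m+j]!, while a residue numerator q^(-2i) q^(a+m) - q^(-a-m) is q^(-i) times the q-difference of a
  + m - i.\<close>

lemma int_coeff_eq:
  assumes t: "Re t \<noteq> 0" and jm: "j \<le> m"
  shows "int_coeff t m l \<mu> (m - j) / (\<Prod>i<m - j. 1 - qpow t (4 * of_nat m - 2 * of_nat i))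
    = qpow t (- of_nat j * (l + \<mu> + 2 * of_nat m) - of_nat (m - j) * (of_nat m + 1) - of_nat (m - j) * (of_nat (m - j) - 1) / 2) *
      (qdiff_fact t m / (qdiff_fact t j * qdiff_fact t (m - j))) * (qdiff_fact t (m + j) / qdiff_fact t (2 * m)) *
      (\<Prod>i\<in>{j<..m}. qdiff t (l + of_nat i) * qdiff t (\<mu> + of_nat i))"
proof -
  define r where "r = m - j"
  have r: "r \<le> m" "m - r = j" "2 * m - r = m + j" using jm by (auto simp: r_def)
  have q: "1 - qpow t (2 * a) = - (qpow t a * qdiff t a)" for a
    using one_minus_qpow[of t a] by simp
  have "gauss_binomial (qpow t 2) m r = (\<Prod>i<r. qpow t (of_nat m - 1 + - 2 * of_nat i) * (qdiff t (of_nat m - of_nat i) / qdiff t (of_nat (Suc i))))"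
    unfolding gauss_binomial_def
  proof (intro prod.cong refl)
    fix i assume "i \<in> {..<r}"
    then have "i \<le> m" using r by auto
    have "qpow t 2 ^ (m - i) = qpow t (2 * (of_nat m - of_nat i))"
      unfolding qpow_power using \<open>i \<le> m\<close> by (simp add: of_nat_diff mult.commute)
    moreover have "qpow t 2 ^ Suc i = qpow t (2 * of_nat (Suc i))" unfolding qpow_power by (simp add: mult.commute)
    moreover have "qpow t (of_nat m - of_nat i) = qpow t (of_nat (Suc i)) * qpow t (of_nat m - 1 + - 2 * of_nat i)"
      unfolding qpow_add by (rule arg_cong[of _ _ "qpow t"]) simp
    moreover have "- (a * b * c) / (- (a * e)) = b * (c / e)" if "a \<noteq> 0" for a b c e :: complex
      using that by simp
    ultimately show "(1 - qpow t 2 ^ (m - i)) / (1 - qpow t 2 ^ Suc i)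
      = qpow t (of_nat m - 1 + - 2 * of_nat i) * (qdiff t (of_nat m - of_nat i) / qdiff t (of_nat (Suc i)))"
      using q qpow_nonzero by (simp only: not_False_eq_True)
  qed
  then have gb: "gauss_binomial (qpow t 2) m r = qpow t (of_nat r * (of_nat m - 1) + - 2 * (of_nat r * (of_nat r - 1) / 2)) *
     (qdiff_fact t m / (qdiff_fact t j * qdiff_fact t r))"
    unfolding prod.distrib prod_dividef prod_qpow qdiff_fact_descending[OF t r(1)] r(2)
    by (simp add: qdiff_fact_def)
  have pw: "(qpow t (- l - of_nat m) * qpow t (- \<mu> - of_nat m)) ^ (m - r) = qpow t (- of_nat j * (l + \<mu> + 2 * of_nat m))"
    unfolding qpow_add qpow_power r(2) by (rule arg_cong[of _ _ "qpow t"]) (simp add: algebra_simps)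
  define h where "h = (\<lambda>i. qdiff t (l + of_nat i) * qdiff t (\<mu> + of_nat i))"
  have "(\<Prod>i<r. - ((qpow t (- 2) ^ i * qpow t (l + of_nat m) - qpow t (- l - of_nat m)) *
       (qpow t (- 2) ^ i * qpow t (\<mu> + of_nat m) - qpow t (- \<mu> - of_nat m))) / qpow t (- 2) ^ i) /
       (\<Prod>i<r. 1 - qpow t (4 * of_nat m - 2 * of_nat i))
     = (\<Prod>i<r. qpow t (- 2 * of_nat m + 1 * of_nat i) * (h (m - i) / qdiff t (of_nat (2 * m) - of_nat i)))"
    unfolding prod_dividef[symmetric]
  proof (intro prod.cong refl)
    fix i assume "i \<in> {..<r}"
    then have "i \<le> m" using r by auto
    have p: "qpow t (- 2) ^ i = qpow t (- of_nat i) * qpow t (- of_nat i)" unfolding qpow_power qpow_add by (simp add: algebra_simps)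
    have s: "qpow t (- 2) ^ i * qpow t (a + of_nat m) - qpow t (- a - of_nat m) = qpow t (- of_nat i) * qdiff t (a + of_nat (m - i))" for a
      unfolding p qdiff_def right_diff_distrib mult.assoc qpow_add using \<open>i \<le> m\<close> by (simp add: of_nat_diff algebra_simps)
    have "4 * of_nat m - 2 * of_nat i = 2 * (of_nat (2 * m) - of_nat i :: complex)" by simp
    then have d: "1 - qpow t (4 * of_nat m - 2 * of_nat i) = - (qpow t (of_nat (2 * m) - of_nat i) * qdiff t (of_nat (2 * m) - of_nat i))"
      using q by metis
    have e: "qpow t (- 2 * of_nat m + 1 * of_nat i) = 1 / qpow t (of_nat (2 * m) - of_nat i)"
      unfolding qpow_minus[symmetric] by (rule arg_cong[of _ _ "qpow t"]) simp
    have K: "- (a * b * (a * c)) / (a * a) / (- (u * v)) = 1 / u * (b * c / v)" if "a \<noteq> 0" for a b c u v :: complex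
      using that by simp
    show "- ((qpow t (- 2) ^ i * qpow t (l + of_nat m) - qpow t (- l - of_nat m)) *
       (qpow t (- 2) ^ i * qpow t (\<mu> + of_nat m) - qpow t (- \<mu> - of_nat m))) / qpow t (- 2) ^ i / (1 - qpow t (4 * of_nat m - 2 * of_nat i))
      = qpow t (- 2 * of_nat m + 1 * of_nat i) * (h (m - i) / qdiff t (of_nat (2 * m) - of_nat i))"
      unfolding s d e h_def unfolding p by (rule K[OF qpow_nonzero])
  qed
  also have "\<dots> = qpow t (of_nat r * (- 2 * of_nat m) + 1 * (of_nat r * (of_nat r - 1) / 2)) *
     ((\<Prod>i<r. h (m - i)) / (qdiff_fact t (2 * m) / qdiff_fact t (m + j)))"
  proof -
    have "(\<Prod>i<r. qdiff t (of_nat (2 * m) - of_nat i)) = qdiff_fact t (2 * m) / qdiff_fact t (m + j)"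
      unfolding r(3)[symmetric] by (rule qdiff_fact_descending[OF t]) (use r(1) in simp)
    then show ?thesis unfolding prod.distrib prod_dividef prod_qpow by (simp only:)
  qed
  also have "(\<Prod>i<r. h (m - i)) = (\<Prod>i\<in>{j<..m}. h i)"
    by (rule prod.reindex_bij_witness[of _ "\<lambda>i. m - i" "\<lambda>i. m - i"]) (use jm in \<open>auto simp: r_def\<close>)
  finally have pr: "(\<Prod>i<r. - ((qpow t (- 2) ^ i * qpow t (l + of_nat m) - qpow t (- l - of_nat m)) *
       (qpow t (- 2) ^ i * qpow t (\<mu> + of_nat m) - qpow t (- \<mu> - of_nat m))) / qpow t (- 2) ^ i) /
       (\<Prod>i<r. 1 - qpow t (4 * of_nat m - 2 * of_nat i))
     = qpow t (of_nat r * (- 2 * of_nat m) + 1 * (of_nat r * (of_nat r - 1) / 2)) *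
     ((\<Prod>i\<in>{j<..m}. h i) / (qdiff_fact t (2 * m) / qdiff_fact t (m + j)))" .
  have ex: "qpow t (of_nat r * (of_nat m - 1) + - 2 * (of_nat r * (of_nat r - 1) / 2)) * qpow t (- of_nat j * (l + \<mu> + 2 * of_nat m)) *
     qpow t (of_nat r * (- 2 * of_nat m) + 1 * (of_nat r * (of_nat r - 1) / 2))
    = qpow t (- of_nat j * (l + \<mu> + 2 * of_nat m) - of_nat r * (of_nat m + 1) - of_nat r * (of_nat r - 1) / 2)"
    unfolding qpow_add by (rule arg_cong[of _ _ "qpow t"]) (simp add: field_simps)
  have "int_coeff t m l \<mu> r / (\<Prod>i<r. 1 - qpow t (4 * of_nat m - 2 * of_nat i))
    = gauss_binomial (qpow t 2) m r * (qpow t (- l - of_nat m) * qpow t (- \<mu> - of_nat m)) ^ (m - r) *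
      ((\<Prod>i<r. - ((qpow t (- 2) ^ i * qpow t (l + of_nat m) - qpow t (- l - of_nat m)) *
       (qpow t (- 2) ^ i * qpow t (\<mu> + of_nat m) - qpow t (- \<mu> - of_nat m))) / qpow t (- 2) ^ i) /
       (\<Prod>i<r. 1 - qpow t (4 * of_nat m - 2 * of_nat i)))"
    unfolding int_coeff_def by (simp only: times_divide_eq_right)
  moreover have "(a * u) * b * (c * (v / (x / y))) = (a * b * c) * u * (y / x) * v" for a b c u v x y :: complex
    by simp
  ultimately show ?thesis
    unfolding pr gb pw ex[symmetric] h_def[symmetric] r_def[symmetric] by (simp only:)
qed

text \<open>The prefactor supplies [2m]!, which cancels the denominators of the continuation; m! and
  the powers of q - 1/q cancel against \<open>int_const\<close>.\<close>

lemma normalised_integral_eq: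
  assumes t: "Re t > 0"
  shows "qpow t ((3 * of_nat m - 1) * of_nat m) * (qfact t (2 * m) / of_nat (fact m)) *
         (qpow t 1 - qpow t (- 1)) ^ m * u_m t m l \<mu> = explicit_sum t m l \<mu>"
proof -
  have t0: "Re t \<noteq> 0" using t by simp
  define D where "D = qdiff t 1"
  have D: "D \<noteq> 0" unfolding D_def using qdiff_nonzero[OF t0, of 1] by simp
  define c where "c = int_coeff t m l \<mu>"
  have rev: "(\<Sum>r\<le>m. c r / (\<Prod>i<r. 1 - qpow t (4 * of_nat m - 2 * of_nat i)))
     = (\<Sum>j\<le>m. c (m - j) / (\<Prod>i<m - j. 1 - qpow t (4 * of_nat m - 2 * of_nat i)))"
    by (rule sum.reindex_bij_witness[of _ "\<lambda>i. m - i" "\<lambda>i. m - i"]) auto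
  have C: "qpow t ((3 * of_nat m - 1) * of_nat m) * (qfact t (2 * m) / of_nat (fact m)) * D ^ m * int_const t m l \<mu>
    = qpow t (- l * \<mu>) * (qpow t ((3 * of_nat m - 1) * of_nat m) * qpow t (- 3 * (of_nat m * (of_nat m - 1)) / 2)) * (qdiff_fact t (2 * m) / qdiff_fact t m)"
  proof -
    have "a * (u / (D ^ m * D ^ m) / f) * D ^ m * (b * e * (f * D ^ m / v)) = b * (a * e) * (u / v)" if "f \<noteq> 0" for a b e f u v :: complex
      using that D by (simp add: field_simps)
    moreover have "D ^ (2 * m) = D ^ m * D ^ m" by (simp add: mult_2 power_add)
    moreover have "of_nat (fact m) \<noteq> (0 :: complex)" by simp
    ultimately show ?thesis unfolding int_const_eq[OF t0] qfact_eq_qdiff_fact D_def[symmetric] by (simp only:)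
  qed
  have "qpow t ((3 * of_nat m - 1) * of_nat m) * (qfact t (2 * m) / of_nat (fact m)) * D ^ m * u_m t m l \<mu>
    = qpow t (- l * \<mu>) * (qpow t ((3 * of_nat m - 1) * of_nat m) * qpow t (- 3 * (of_nat m * (of_nat m - 1)) / 2)) * (qdiff_fact t (2 * m) / qdiff_fact t m) *
      (\<Sum>j\<le>m. c (m - j) / (\<Prod>i<m - j. 1 - qpow t (4 * of_nat m - 2 * of_nat i)))"
    unfolding u_m_eq[OF t] c_def[symmetric] rev mult.assoc[symmetric] C[folded mult.assoc[symmetric]] 
    unfolding c_def using C by (simp only: mult.assoc)
  also have "\<dots> = qpow t (- l * \<mu>) * (\<Sum>j\<le>m. qpow t ((3 * of_nat m - 1) * of_nat m) * qpow t (- 3 * (of_nat m * (of_nat m - 1)) / 2) *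
      (qdiff_fact t (2 * m) / qdiff_fact t m) * (c (m - j) / (\<Prod>i<m - j. 1 - qpow t (4 * of_nat m - 2 * of_nat i))))"
    unfolding sum_distrib_left[symmetric] by (simp only: mult.assoc)
  also have "\<dots> = explicit_sum t m l \<mu>"
    unfolding explicit_sum_def
  proof (rule arg_cong2[of _ _ _ _ "(*)", OF refl], rule sum.cong[OF refl])
    fix j assume "j \<in> {..m}"
    then have jm: "j \<le> m" by simp
    define r where "r = m - j"
    have m: "of_nat m = (of_nat j + of_nat r :: complex)" using jm unfolding r_def by (simp flip: of_nat_add)
    \<comment> \<open>With m = j + r all terms that contain r cancel; this is where the exponent
      (3m-1)m is needed.\<close>
    have ex: "qpow t ((3 * of_nat m - 1) * of_nat m) * qpow t (- 3 * (of_nat m * (of_nat m - 1)) / 2) *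
        qpow t (- of_nat j * (l + \<mu> + 2 * of_nat m) - of_nat r * (of_nat m + 1) - of_nat r * (of_nat r - 1) / 2)
      = qpow t (- of_nat j * (l + \<mu>) - of_nat j * (of_nat j - 1) / 2)"
      unfolding qpow_add m by (rule arg_cong[of _ _ "qpow t"]) (simp add: field_simps)
    have "a * b * (g / gm) * (c * (gm / (gj * gr)) * (gk / g) * h) = (a * b * c) * (gk / (gr * gj)) * h"
      if "g \<noteq> 0" "gm \<noteq> 0" "gj \<noteq> 0" "gr \<noteq> 0" for a b c g gm gj gr gk h :: complex
      using that by (simp add: field_simps)
    from this[OF qdiff_fact_nonzero[OF t0] qdiff_fact_nonzero[OF t0] qdiff_fact_nonzero[OF t0] qdiff_fact_nonzero[OF t0]]
    show "qpow t ((3 * of_nat m - 1) * of_nat m) * qpow t (- 3 * (of_nat m * (of_nat m - 1)) / 2) * (qdiff_fact t (2 * m) / qdiff_fact t m) *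
       (c (m - j) / (\<Prod>i<m - j. 1 - qpow t (4 * of_nat m - 2 * of_nat i)))
      = qpow t (- of_nat j * (l + \<mu>) - of_nat j * (of_nat j - 1) / 2) *
     (qdiff_fact t (m + j) / (qdiff_fact t (m - j) * qdiff_fact t j)) *
     (\<Prod>i\<in>{j<..m}. qdiff t (l + of_nat i) * qdiff t (\<mu> + of_nat i))"
      unfolding c_def int_coeff_eq[OF t0 jm] ex[symmetric] r_def .
  qed
  finally show ?thesis unfolding D_def qdiff_def .
qed

text \<open>The first two conjuncts give the descriptions in \<open>u_m\<close> and
  \<open>Psi\<close> a meaning: a continuation regular at q^m and a rational trace function exist.
  The identity is asserted wherever the trace function at the inverse of q is regular.\<close>

theorem theorem8p1:
  fixes t :: complex and m :: nat and V :: "complex \<Rightarrow> 'i uq_module"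
  assumes "Re t > 0"
    and "\<And>s. s \<in> {t, - t} \<Longrightarrow> irreducible_highest_weight s (V s) (2 * of_nat m)"
  shows "(\<forall>l \<mu>. \<exists>N D. is_continuation t m l \<mu> N D \<and> poly D (qpow t (of_nat m)) \<noteq> 0) \<and>
    (\<exists>P Q. is_trace_function (- t) (V (- t)) P Q) \<and>
    (\<forall>l \<mu>. Psi_regular (- t) (V (- t)) (- l) (- \<mu> - 1) \<longrightarrow>
       u_V t V m l \<mu> =
         qpow t ((3 * of_nat m - 1) * of_nat m) * (qfact t (2 * m) / of_nat (fact m)) *
         (qpow t 1 - qpow t (- 1)) ^ m * u_m t m l \<mu>)"
proof (intro conjI allI impI)
  have V: "spin_rep (- t) (V (- t)) m"
    using assms(1) assms(2)[of "- t"]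
    by unfold_locales (auto simp: irreducible_highest_weight_def)
  show "\<exists>N D. is_continuation t m l \<mu> N D \<and> poly D (qpow t (of_nat m)) \<noteq> 0" for l \<mu>
    using continuation_exists[OF assms(1)] by metis
  show "\<exists>P Q. is_trace_function (- t) (V (- t)) P Q"
    using spin_rep.trace_function[OF V] assms(1) by auto
  show "u_V t V m l \<mu> = qpow t ((3 * of_nat m - 1) * of_nat m) * (qfact t (2 * m) / of_nat (fact m)) *
         (qpow t 1 - qpow t (- 1)) ^ m * u_m t m l \<mu>"
    if "Psi_regular (- t) (V (- t)) (- l) (- \<mu> - 1)" for l \<mu>
    unfolding normalised_integral_eq[OF assms(1)] by (rule modified_trace_eq[where t = t and V = V, OF assms(1) V that])
qed

end
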